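(* The following statements concerning distributions hold. (i) (Circular ensemble) Let $\beta>0$ be arbitrary and let $e^{i\eta_1},\dots,e^{i\eta_n}$ be a sample from $C\beta E(n)$. Then for all $\theta\in\mathbb{R}$, $$\prod_{k=1}^n \bigl(1-e^{-i(\theta-\eta_k)}\bigr)\ \stackrel{\text{law}}{=}\ \prod_{k=1}^n\bigl(1+e^{i\theta_k}\sqrt{X_{k-1}}\bigr),$$ where $\theta_1,\dots,\theta_n,X_0,\dots,X_{n-1}$ are all independent, each $e^{i\theta_k}$ is uniformly distributed on the unit circle $S^1$, and $X_j\sim B_{[0,1]}\bigl(1,\tfrac{j\beta}{2}\bigr)$. (ii) (Jacobi ensemble) Let $\beta>0$ be arbitrary and let $x_1,\dots,x_n\in[-2,2]$ be a sample from $J\beta E_{a,b}(n)$. Then $$\prod_{k=1}^n(\pm2-x_k)\ \stackrel{\text{law}}{=}\ 2\prod_{k=0}^{2n-2}\bigl(1-(\pm1)^{k+1}X_k\bigr),$$ where the $X_k$ are all independent and distributed as $$X_k\sim\begin{cases}B_{[-1,1]}\Bigl(\tfrac{k}{4}\beta+a+1,\ \tfrac{k}{4}\beta+b+1\Bigr), & k\text{ even},\\[4pt] B_{[-1,1]}\Bigl(\tfrac{k-1}{4}\beta+a+b+2,\ \tfrac{k+1}{4}\beta\Bigr), & k\text{ odd}.\end{cases}$$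
   Context: $\Delta(z_1,\dots,z_n)=\prod_{1\le i<j\le n}(z_j-z_i)$ is the Vandermonde determinant. For $\beta>0$, $C\beta E(n)$, the circular $\beta$ ensemble with $n$ points, is the random point process $e^{i\eta_1},\dots,e^{i\eta_n}$ on the unit circle such that for any symmetric function $f$, $$\mathbb{E}_n^\beta(f)=\frac{1}{Z_n^\beta}\int_{-\pi}^{\pi}\cdots\int_{-\pi}^{\pi} f(e^{i\eta_1},\dots,e^{i\eta_n})\,|\Delta(e^{i\eta_1},\dots,e^{i\eta_n})|^\beta\,\frac{d\eta_1}{2\pi}\cdots\frac{d\eta_n}{2\pi},\qquad Z_n^\beta=\frac{\Gamma(\frac{n\beta}{2}+1)}{[\Gamma(\frac{\beta}{2}+1)]^n}.$$ $J\beta E_{a,b}(n)$, the Jacobi $\beta$ ensemble with $n$ points ($\beta>0$, $a,b>-1$), is the random point process $x_1,\dots,x_n$ on $[-2,2]$ with joint probability density proportional to $|\Delta(x_1,\dots,x_n)|^\beta\prod_j(2-x_j)^a(2+x_j)^b\,dx_1\cdots dx_n$. $X\sim B_{[0,1]}(s,t)$ means that $X$ has density $\frac{\Gamma(s+t)}{\Gamma(s)\Gamma(t)}x^{s-1}(1-x)^{t-1}$ on $[0,1]$; $B_{[0,1]}(1,0)$ denotes the point mass at $1$. $X\sim B_{[-1,1]}(s,t)$ means that $X$ has density $\frac{2^{1-s-t}\Gamma(s+t)}{\Gamma(s)\Gamma(t)}(1-x)^{s-1}(1+x)^{t-1}$ on $[-1,1]$. In the Jacobi statement the same choice of sign is made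 throughout the formula. $\stackrel{\text{law}}{=}$ denotes equality in distribution.
   Formalization: In (ii) the right-hand side carries an extra factor (±1)^n: as printed, the lower sign with n odd is false (for n=1 the left side −2−x_1 is negative while the right side 2(1+X_0) is nonnegative); the upper sign and even n are as printed. *)

theory Defs
  imports "HOL-Probability.Probability" "HOL-Combinatorics.Permutations"
begin

definition vandermonde :: "nat \<Rightarrow> (nat \<Rightarrow> 'a::comm_ring_1) \<Rightarrow> 'a" where
  "vandermonde n z = (\<Prod>i=1..n. \<Prod>j=i+1..n. z j - z i)"

definition symmetric_fun :: "nat \<Rightarrow> ((nat \<Rightarrow> 'a) \<Rightarrow> 'b) \<Rightarrow> bool" where
  "symmetric_fun n f \<longleftrightarrow>
     (\<forall>p z. p permutes {1..n} \<longrightarrow> z \<in> extensional {1..n} \<longrightarrow> f (z \<circ> p) = f z)"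

definition circular_Z :: "nat \<Rightarrow> real \<Rightarrow> real" where
  "circular_Z n \<beta> = Gamma (real n * \<beta> / 2 + 1) / Gamma (\<beta> / 2 + 1) ^ n"

text \<open>
  The circular ensemble is a point process, so only the expectations of symmetric functions of
  the points are prescribed; nothing is assumed about the labelling of the points. Test
  functions are bounded and Borel measurable, so that both sides are well-defined integrals.
\<close>

definition circular_beta_ensemble ::
  "'s measure \<Rightarrow> nat \<Rightarrow> real \<Rightarrow> (nat \<Rightarrow> 's \<Rightarrow> complex) \<Rightarrow> bool" where
  "circular_beta_ensemble M n \<beta> z \<longleftrightarrow>
     prob_space M \<and>
     (\<forall>k\<in>{1..n}. z k \<in> borel_measurable M \<and> (\<forall>\<omega>\<in>space M. norm (z k \<omega>) = 1)) \<and>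
     (\<forall>f :: (nat \<Rightarrow> complex) \<Rightarrow> complex.
        f \<in> borel_measurable (Pi\<^sub>M {1..n} (\<lambda>_. borel)) \<longrightarrow> bounded (range f) \<longrightarrow>
        symmetric_fun n f \<longrightarrow>
        (\<integral>\<omega>. f (\<lambda>k\<in>{1..n}. z k \<omega>) \<partial>M) =
          complex_of_real (1 / circular_Z n \<beta>) *
          (LINT \<eta>:({1..n} \<rightarrow>\<^sub>E {-pi..pi})|Pi\<^sub>M {1..n} (\<lambda>_. lborel).
             f (\<lambda>k\<in>{1..n}. cis (\<eta> k)) *
             complex_of_real (norm (vandermonde n (\<lambda>k. cis (\<eta> k))) powr \<beta> / (2 * pi) ^ n)))"

definition jacobi_weight :: "nat \<Rightarrow> real \<Rightarrow> real \<Rightarrow> real \<Rightarrow> (nat \<Rightarrow> real) \<Rightarrow> real" where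
  "jacobi_weight n \<beta> a b x =
     \<bar>vandermonde n x\<bar> powr \<beta> * (\<Prod>j=1..n. (2 - x j) powr a * (2 + x j) powr b) *
     indicator ({1..n} \<rightarrow>\<^sub>E {-2..2}) x"

definition jacobi_beta_ensemble ::
  "'s measure \<Rightarrow> nat \<Rightarrow> real \<Rightarrow> real \<Rightarrow> real \<Rightarrow> (nat \<Rightarrow> 's \<Rightarrow> real) \<Rightarrow> bool" where
  "jacobi_beta_ensemble M n \<beta> a b x \<longleftrightarrow>
     prob_space M \<and>
     (\<exists>c>0. distributed M (Pi\<^sub>M {1..n} (\<lambda>_. lborel)) (\<lambda>\<omega>. \<lambda>k\<in>{1..n}. x k \<omega>)
              (\<lambda>y. ennreal (c * jacobi_weight n \<beta> a b y)))"

definition beta_unit :: "real \<Rightarrow> real \<Rightarrow> real measure" where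
  "beta_unit s t =
     (if s = 1 \<and> t = 0 then return borel 1
      else density lborel (\<lambda>x. ennreal (Gamma (s + t) / (Gamma s * Gamma t) *
             x powr (s - 1) * (1 - x) powr (t - 1) * indicator {0..1} x)))"

definition beta_sym :: "real \<Rightarrow> real \<Rightarrow> real measure" where
  "beta_sym s t =
     density lborel (\<lambda>x. ennreal (2 powr (1 - s - t) * Gamma (s + t) / (Gamma s * Gamma t) *
       (1 - x) powr (s - 1) * (1 + x) powr (t - 1) * indicator {-1..1} x))"

definition uniform_circle :: "complex measure" where
  "uniform_circle = distr (uniform_measure lborel {-pi..pi}) borel cis"

end

theory Submission imports Defs begin

text \<open>
  Both laws are laws of bounded random variables, so by the Stone-Weierstrass theorem they are
  determined by moments: \<open>E Z^m\<close> for a real variable, and the mixed moments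
  \<open>E (Z^p * cnj Z^r)\<close> for a complex one (\<open>measure_eq_of_moments\<close>).

  For the products of independent factors the moments are products of one-variable integrals.
  In the Jacobi case these are beta integrals; in the circular case the uniform angle leaves only
  the diagonal terms of a double binomial expansion, and these sum up by the Chu-Vandermonde
  identity (\<open>circular_factor_moment\<close>).

  For the ensembles the moments are integrals of Selberg and Morris type in which an exponent has
  been shifted by an integer. The zeroth moment of a probability measure is 1, so it suffices to
  know the quotient of two consecutive moments, and this is what Aomoto's argument provides. Let
  \<open>W\<close> be the density of the ensemble, with one-body weight \<open>h\<close> and pair weight \<open>d\<close>, and let
  \<open>I k\<close> be the integral of \<open>q (x 1) * \<dots> * q (x k) * W x\<close>, where \<open>q\<close> is the factor whose product
  over all particles is under study. The integral of the derivative with respect to \<open>x 1\<close> of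
  \<open>\<rho> (x 1) * q (x 2) * \<dots> * q (x k) * W x\<close> vanishes when \<open>\<rho>\<close> is chosen to cancel the boundary
  terms. The derivative produces for every other particle a singular interaction term
  \<open>\<kappa> (x 1) (x j)\<close>; averaging over the exchange of the particles 1 and \<open>j\<close> turns it into a
  polynomial in \<open>q (x 1)\<close> and \<open>q (x j)\<close>. What is left is a linear relation between \<open>I k\<close> and
  \<open>I (k - 1)\<close>. Multiplied up it gives the quotient of \<open>I n\<close> and \<open>I 0\<close>, and since \<open>I n\<close> has the
  same integrand as \<open>I 0\<close> with one more power of \<open>q\<close> in \<open>h\<close>, this is the quotient of
  consecutive moments.

  The locale \<open>pair_gas\<close> carries out this argument once (\<open>mean_prod_recurrence\<close>). The Jacobi
  ensemble is the instance \<open>q x = 2 - x\<close> with flux factor \<open>\<rho> x = (2 - x) * (2 + x)\<close>; the circular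
  ensemble is the instance \<open>q x = 1 - c * cis x\<close> with \<open>\<rho> = q\<close>. The lower sign in the Jacobi
  statement follows from the upper one by the reflection \<open>x \<mapsto> - x\<close>, which exchanges \<open>a\<close> and \<open>b\<close>.
\<close>

section \<open>Products over pairs of particles\<close>

definition pair_prod :: "('a \<Rightarrow> 'a \<Rightarrow> real) \<Rightarrow> nat \<Rightarrow> (nat \<Rightarrow> 'a) \<Rightarrow> real" where
  "pair_prod d n x = (\<Prod>i=1..n. \<Prod>j=i+1..n. d (x i) (x j))"

text \<open>
  Only pairs \<open>i < j\<close> enter the product, which hides its invariance under permutations. The
  square runs over all ordered pairs, where the invariance is visible; for nonnegative factors it
  determines the product.
\<close>

lemma pair_prod_power2:
  assumes sym: "\<And>a b. d a b = d b a"
  shows "(pair_prod d n x)\<^sup>2 = (\<Prod>i\<in>{1..n}. \<Prod>j\<in>{1..n} - {i}. d (x i) (x j))"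
proof -
  have "(\<Prod>i\<in>{1..n}. \<Prod>j\<in>{1..n} - {i}. d (x i) (x j)) =
        (\<Prod>i\<in>{1..n}. (\<Prod>j=i+1..n. d (x i) (x j)) * (\<Prod>j\<in>{j\<in>{1..n}. j < i}. d (x i) (x j)))"
  proof (rule prod.cong[OF refl])
    fix i assume "i \<in> {1..n}"
    then have *: "{1..n} - {i} = {i+1..n} \<union> {j\<in>{1..n}. j < i}" by auto
    show "(\<Prod>j\<in>{1..n} - {i}. d (x i) (x j)) =
        (\<Prod>j=i+1..n. d (x i) (x j)) * (\<Prod>j\<in>{j\<in>{1..n}. j < i}. d (x i) (x j))"
      unfolding * by (rule prod.union_disjoint) auto
  qed
  also have "\<dots> = pair_prod d n x * (\<Prod>i\<in>{1..n}. \<Prod>j\<in>{j. j \<in> {1..n} \<and> j < i}. d (x i) (x j))"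
    by (simp add: prod.distrib pair_prod_def)
  also have "(\<Prod>i\<in>{1..n}. \<Prod>j\<in>{j. j \<in> {1..n} \<and> j < i}. d (x i) (x j)) =
      (\<Prod>j\<in>{1..n}. \<Prod>i\<in>{i. i \<in> {1..n} \<and> j < i}. d (x i) (x j))"
    by (rule prod.swap_restrict) auto
  also have "\<dots> = pair_prod d n x"
    unfolding pair_prod_def
  proof (intro prod.cong refl)
    fix j assume "j \<in> {1..n}"
    then show "{i. i \<in> {1..n} \<and> j < i} = {j+1..n}" by auto
  qed (rule sym)
  finally show ?thesis by (simp add: power2_eq_square)
qed

lemma pair_prod_nonneg:
  assumes "\<And>a b. 0 \<le> d a b"
  shows "0 \<le> pair_prod d n x"
  unfolding pair_prod_def by (intro prod_nonneg ballI assms)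

lemma pair_prod_permutes:
  assumes sym: "\<And>a b. d a b = d b a" and nonneg: "\<And>a b. 0 \<le> d a b"
    and p: "p permutes {1..n}"
  shows "pair_prod d n (\<lambda>i. x (p i)) = pair_prod d n x"
proof -
  have "(pair_prod d n (\<lambda>i. x (p i)))\<^sup>2 = (\<Prod>i\<in>{1..n}. \<Prod>j\<in>{1..n} - {p i}. d (x (p i)) (x j))"
    unfolding pair_prod_power2[of d, OF sym]
  proof (rule prod.cong[OF refl])
    fix i assume "i \<in> {1..n}"
    have "p ` ({1..n} - {i}) = {1..n} - {p i}"
      using permutes_image[OF p] permutes_inj[OF p] by (auto simp: inj_def)
    then have "bij_betw p ({1..n} - {i}) ({1..n} - {p i})"
      using permutes_inj[OF p] by (auto simp: bij_betw_def inj_on_def)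
    from prod.reindex_bij_betw[OF this]
    show "(\<Prod>j\<in>{1..n} - {i}. d (x (p i)) (x (p j))) = (\<Prod>j\<in>{1..n} - {p i}. d (x (p i)) (x j))" .
  qed
  also have "\<dots> = (\<Prod>i\<in>{1..n}. \<Prod>j\<in>{1..n} - {i}. d (x i) (x j))"
    by (rule prod.reindex_bij_betw[OF permutes_imp_bij[OF p]])
  also have "\<dots> = (pair_prod d n x)\<^sup>2" by (rule pair_prod_power2[of d, OF sym, symmetric])
  finally show ?thesis
    using pair_prod_nonneg[of d, OF nonneg] by (metis power2_eq_imp_eq)
qed

lemma pair_prod_split_first:
  assumes "1 \<le> n"
  shows "pair_prod d n x = (\<Prod>j=2..n. d (x 1) (x j)) * (\<Prod>i=2..n. \<Prod>j=i+1..n. d (x i) (x j))"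
proof -
  have "{1..n} = insert 1 {2..n}" using assms by auto
  then have "pair_prod d n x = (\<Prod>i\<in>insert 1 {2..n}. \<Prod>j=i+1..n. d (x i) (x j))"
    by (simp only: pair_prod_def)
  also have "\<dots> = (\<Prod>j=1+1..n. d (x 1) (x j)) * (\<Prod>i=2..n. \<Prod>j=i+1..n. d (x i) (x j))"
    by (rule prod.insert) auto
  finally show ?thesis by (simp only: one_add_one)
qed

section \<open>Symmetries of Lebesgue measure on products\<close>

abbreviation lborel_n :: "nat \<Rightarrow> (nat \<Rightarrow> real) measure" where
  "lborel_n n \<equiv> Pi\<^sub>M {1..n} (\<lambda>_. lborel)"

lemma coordinate_measurable:
  "i \<in> I \<Longrightarrow> (\<lambda>x. x i) \<in> borel_measurable (Pi\<^sub>M I (\<lambda>_. lborel :: real measure))"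
  using measurable_component_singleton[of i I "\<lambda>_. lborel :: real measure"] by simp

lemma measurable_pair_prod [measurable (raw)]:
  fixes d :: "real \<Rightarrow> real \<Rightarrow> real"
  assumes [measurable]: "case_prod d \<in> borel_measurable (borel \<Otimes>\<^sub>M borel)"
  shows "pair_prod d n \<in> borel_measurable (lborel_n n)"
  unfolding pair_prod_def
proof (intro borel_measurable_prod)
  fix i j assume "i \<in> {1..n}" "j \<in> {i+1..n}"
  then have [measurable]: "(\<lambda>x. x i) \<in> borel_measurable (lborel_n n)" "(\<lambda>x. x j) \<in> borel_measurable (lborel_n n)"
    by (auto intro: coordinate_measurable)
  have "(\<lambda>x. case_prod d (x i, x j)) \<in> borel_measurable (lborel_n n)" by measurable
  then show "(\<lambda>x. d (x i) (x j)) \<in> borel_measurable (lborel_n n)" by simp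
qed

text \<open>
  It suffices to compare the measures of boxes: a permutation of the coordinates permutes the sides
  of a box, and \<open>T\<close> preserves the measure of each side.
\<close>

lemma distr_PiM_permutes_map:
  assumes fin: "finite I" and sf: "sigma_finite_measure M" and p: "p permutes I"
    and T [measurable]: "T \<in> measurable M M" and inv: "distr M M T = M"
  shows "distr (Pi\<^sub>M I (\<lambda>_. M)) (Pi\<^sub>M I (\<lambda>_. M)) (\<lambda>x. \<lambda>i\<in>I. T (x (p i))) = Pi\<^sub>M I (\<lambda>_. M)"
    (is "distr ?P ?P ?f = _")
proof -
  interpret product_sigma_finite "\<lambda>_. M" using sf by (simp add: product_sigma_finite_def)
  have p_in: "p i \<in> I" if "i \<in> I" for i using p that by (simp add: permutes_in_image)
  have q_in: "inv p i \<in> I" if "i \<in> I" for i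
    using permutes_inv[OF p] that by (simp add: permutes_in_image)
  have f [measurable]: "?f \<in> measurable ?P ?P"
  proof (rule measurable_restrict)
    fix i assume "i \<in> I"
    show "(\<lambda>x. T (x (p i))) \<in> measurable ?P M"
      by (rule measurable_compose[where f = "\<lambda>x. x (p i)", OF measurable_component_singleton[OF p_in[OF \<open>i \<in> I\<close>]] T])
  qed
  show ?thesis
  proof (rule PiM_eqI)
    fix A assume A: "\<And>i. i \<in> I \<Longrightarrow> A i \<in> sets M"
    let ?A = "\<lambda>i. T -` A (inv p i) \<inter> space M"
    have A': "?A i \<in> sets M" if "i \<in> I" for i
      using A[OF q_in[OF that]] by measurable
    have pre: "?f -` Pi\<^sub>E I A \<inter> space ?P = Pi\<^sub>E I ?A"
    proof (intro set_eqI iffI)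
      fix x assume "x \<in> ?f -` Pi\<^sub>E I A \<inter> space ?P"
      then have x: "x \<in> extensional I" "\<And>i. i \<in> I \<Longrightarrow> T (x (p i)) \<in> A i" "\<And>i. i \<in> I \<Longrightarrow> x i \<in> space M"
        by (auto simp: space_PiM PiE_iff)
      have "T (x i) \<in> A (inv p i)" if "i \<in> I" for i
        using x(2)[OF q_in[OF that]] p by (simp add: permutes_inverses)
      with x(1,3) show "x \<in> Pi\<^sub>E I ?A" by (simp add: PiE_iff)
    next
      fix x assume x: "x \<in> Pi\<^sub>E I ?A"
      have "T (x (p i)) \<in> A i" if "i \<in> I" for i
        using x p_in[OF that] p by (auto simp: PiE_iff permutes_inverses dest!: bspec[of _ _ "p i"])
      then show "x \<in> ?f -` Pi\<^sub>E I A \<inter> space ?P"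
        using x by (auto simp: space_PiM PiE_iff)
    qed
    have "emeasure (distr ?P ?P ?f) (Pi\<^sub>E I A) = emeasure ?P (Pi\<^sub>E I ?A)"
      using A fin by (subst emeasure_distr) (auto simp: pre intro!: sets_PiM_I_finite)
    also have "\<dots> = (\<Prod>i\<in>I. emeasure M (?A i))"
      using A' fin by (subst emeasure_PiM) auto
    also have "\<dots> = (\<Prod>i\<in>I. emeasure M (A (inv p i)))"
    proof (rule prod.cong[OF refl])
      fix i assume "i \<in> I"
      then have "emeasure (distr M M T) (A (inv p i)) = emeasure M (?A i)"
        using A[OF q_in] by (intro emeasure_distr) auto
      then show "emeasure M (?A i) = emeasure M (A (inv p i))" by (simp only: inv)
    qed
    also have "\<dots> = (\<Prod>i\<in>I. emeasure M (A i))"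
      by (rule prod.reindex_bij_betw[OF permutes_imp_bij[OF permutes_inv[OF p]]])
    finally show "emeasure (distr ?P ?P ?f) (Pi\<^sub>E I A) = (\<Prod>i\<in>I. emeasure M (A i))" .
  qed (use fin in auto)
qed

lemma distr_PiM_permutes:
  assumes "finite I" and "sigma_finite_measure M" and "p permutes I"
  shows "distr (Pi\<^sub>M I (\<lambda>_. M)) (Pi\<^sub>M I (\<lambda>_. M)) (\<lambda>x. \<lambda>i\<in>I. x (p i)) = Pi\<^sub>M I (\<lambda>_. M)"
  using distr_PiM_permutes_map[of I M p "\<lambda>x. x"] assms by (simp add: distr_id2)

lemma distr_PiM_uminus:
  assumes fin: "finite I"
  shows "distr (Pi\<^sub>M I (\<lambda>_. lborel)) (Pi\<^sub>M I (\<lambda>_. lborel)) (\<lambda>x. \<lambda>i\<in>I. - x i) = Pi\<^sub>M I (\<lambda>_. lborel :: real measure)"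
proof -
  have "distr lborel lborel uminus = distr lborel borel (uminus :: real \<Rightarrow> real)"
    by (rule distr_cong) simp_all
  then have "distr lborel lborel uminus = (lborel :: real measure)"
    by (simp only: lborel_distr_uminus)
  from distr_PiM_permutes_map[OF fin sigma_finite_lborel permutes_id _ this] show ?thesis by simp
qed

section \<open>Aomoto's recursion for a gas with pair interaction\<close>

text \<open>
  A gas of particles on the interval \<open>{l..u}\<close> with one-body weight \<open>h\<close>, extended by 0, and pair weight
  \<open>d\<close>. The function \<open>\<kappa>\<close> is the logarithmic derivative of \<open>d\<close> in its first argument, and \<open>q\<close> is the
  one-particle function whose products are averaged. The flux \<open>\<rho> * h\<close> is the quantity to be
  integrated by parts: its derivative is \<open>h\<close> times a linear function of \<open>q\<close>, and its boundary
  terms cancel, either because it vanishes at both ends or because flux and pair weight are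
  periodic. By \<open>exchange_q\<close> and
  \<open>exchange\<close> the interaction becomes a polynomial in \<open>q\<close> once it is symmetrized. The derivative of \<open>d\<close>
  may be unbounded at a collision, and \<open>singular\<close> requires it to be integrable against the flux,
  uniformly in the position of the other particle.
\<close>
locale pair_gas =
  fixes l u :: real and h \<rho> q :: "real \<Rightarrow> complex" and d \<kappa> :: "real \<Rightarrow> real \<Rightarrow> real"
    and c0 c1 e f0 f1 :: complex
  assumes lu: "l < u"
    and h_meas [measurable]: "h \<in> borel_measurable borel"
    and \<rho>_meas [measurable]: "\<rho> \<in> borel_measurable borel"
    and q_meas [measurable]: "q \<in> borel_measurable borel"
    and d_meas [measurable]: "case_prod d \<in> borel_measurable (borel \<Otimes>\<^sub>M borel)"
    and \<kappa>_meas [measurable]: "case_prod \<kappa> \<in> borel_measurable (borel \<Otimes>\<^sub>M borel)"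
    and h_outside: "\<And>x. x \<notin> {l..u} \<Longrightarrow> h x = 0"
    and h_integrable: "integrable lborel h"
    and q_bounded: "\<exists>B. \<forall>x\<in>{l..u}. norm (q x) \<le> B"
    and d_bounded: "\<exists>B. \<forall>x\<in>{l..u}. \<forall>y\<in>{l..u}. d x y \<le> B"
    and d_nonneg: "\<And>x y. 0 \<le> d x y" and d_sym: "\<And>x y. d x y = d y x"
    and d_cont: "\<And>y. y \<in> {l..u} \<Longrightarrow> continuous_on {l..u} (\<lambda>x. d x y)"
    and d_zeros: "\<And>y. y \<in> {l..u} \<Longrightarrow> finite {x \<in> {l..u}. d x y = 0}"
    and d_deriv: "\<And>x y. x \<in> {l<..<u} \<Longrightarrow> y \<in> {l..u} \<Longrightarrow> d x y \<noteq> 0 \<Longrightarrow>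
      ((\<lambda>x. d x y) has_real_derivative \<kappa> x y * d x y) (at x)"
    and \<kappa>_antisym: "\<And>x y. \<kappa> y x = - \<kappa> x y"
    and flux_cont: "continuous_on {l..u} (\<lambda>x. \<rho> x * h x)"
    and flux_deriv: "\<And>x. x \<in> {l<..<u} \<Longrightarrow>
      ((\<lambda>x. \<rho> x * h x) has_vector_derivative (c0 - c1 * q x) * h x) (at x)"
    and boundary: "(\<rho> l * h l = 0 \<and> \<rho> u * h u = 0) \<or>
      (\<rho> l * h l = \<rho> u * h u \<and> (\<forall>y\<in>{l..u}. d l y = d u y))"
    and singular: "\<exists>K<\<infinity>. \<forall>y\<in>{l..u}. (\<integral>\<^sup>+x. ennreal (norm (\<rho> x * h x) * (\<bar>\<kappa> x y\<bar> * d x y)) \<partial>lborel) \<le> K"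
    and exchange_q: "\<And>x y. x \<in> {l..u} \<Longrightarrow> y \<in> {l..u} \<Longrightarrow> d x y \<noteq> 0 \<Longrightarrow>
      (\<rho> x * q y - \<rho> y * q x) * \<kappa> x y = 2 * e * (q x * q y)"
    and exchange: "\<And>x y. x \<in> {l..u} \<Longrightarrow> y \<in> {l..u} \<Longrightarrow> d x y \<noteq> 0 \<Longrightarrow>
      (\<rho> x - \<rho> y) * \<kappa> x y = 2 * f0 - f1 * (q x + q y)"
begin

sublocale product_sigma_finite "\<lambda>_. lborel :: real measure"
  by unfold_locales

lemma measurable_d [measurable (raw)]:
  assumes [measurable]: "f \<in> borel_measurable M" "g \<in> borel_measurable M"
  shows "(\<lambda>x. d (f x) (g x)) \<in> borel_measurable M"
proof -
  have "(\<lambda>x. case_prod d (f x, g x)) \<in> borel_measurable M" by measurable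
  then show ?thesis by simp
qed

lemma measurable_\<kappa> [measurable (raw)]:
  assumes [measurable]: "f \<in> borel_measurable M" "g \<in> borel_measurable M"
  shows "(\<lambda>x. \<kappa> (f x) (g x)) \<in> borel_measurable M"
proof -
  have "(\<lambda>x. case_prod \<kappa> (f x, g x)) \<in> borel_measurable M" by measurable
  then show ?thesis by simp
qed

definition weight :: "nat \<Rightarrow> (nat \<Rightarrow> real) \<Rightarrow> complex" where
  "weight n x = (\<Prod>i=1..n. h (x i)) * of_real (pair_prod d n x)"

lemma weight_measurable [measurable]: "weight n \<in> borel_measurable (lborel_n n)"
  unfolding weight_def by measurable

lemma weight_outside: "i \<in> {1..n} \<Longrightarrow> x i \<notin> {l..u} \<Longrightarrow> weight n x = 0"
  unfolding weight_def by (subst prod_zero) (use h_outside[of "x i"] in auto)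

text \<open>
  The exchange identities hold for particles at which the pair weight is nonzero. Because the weight
  vanishes at all other configurations, they may be applied pointwise under the integral.
\<close>

lemma weight_collision: "i \<in> {1..n} \<Longrightarrow> j \<in> {1..n} \<Longrightarrow> i \<noteq> j \<Longrightarrow> d (x i) (x j) = 0 \<Longrightarrow> weight n x = 0"
proof -
  assume *: "i \<in> {1..n}" "j \<in> {1..n}" "i \<noteq> j" "d (x i) (x j) = 0"
  then have "(\<Prod>i\<in>{1..n}. \<Prod>j\<in>{1..n} - {i}. d (x i) (x j)) = 0"
    by (intro prod_zero bexI[of _ i] bexI[of _ j]) auto
  then have "(pair_prod d n x)\<^sup>2 = 0"
    using pair_prod_power2[of d n x] d_sym by simp
  then show ?thesis by (simp add: weight_def)
qed

lemma weight_permutes: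
  assumes p: "p permutes {1..n}"
  shows "weight n (\<lambda>i. x (p i)) = weight n x"
proof -
  have "(\<Prod>i=1..n. h (x (p i))) = (\<Prod>i=1..n. h (x i))"
    by (rule prod.reindex_bij_betw[OF permutes_imp_bij[OF p]])
  then show ?thesis
    using pair_prod_permutes[of d p n x] d_sym d_nonneg p by (simp add: weight_def)
qed

text \<open>
  The permuted configuration is \<open>\<lambda>i. x (p i)\<close>, which need not be extensional; the last assumption
  says that \<open>f\<close> reads the coordinates \<open>1..n\<close> only.
\<close>

lemma integral_permutes:
  assumes p: "p permutes {1..n}" and f: "(f :: (nat \<Rightarrow> real) \<Rightarrow> complex) \<in> borel_measurable (lborel_n n)"
    and f_restrict: "\<And>x. f (\<lambda>i\<in>{1..n}. x i) = f x"
  shows "(\<integral>x. f (\<lambda>i. x (p i)) \<partial>lborel_n n) = (\<integral>x. f x \<partial>lborel_n n)"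
proof -
  let ?P = "lborel_n n"
  have p_in: "p i \<in> {1..n}" if "i \<in> {1..n}" for i using p that by (simp only: permutes_in_image)
  have m: "(\<lambda>x. \<lambda>i\<in>{1..n}. x (p i)) \<in> measurable ?P ?P"
    by (intro measurable_restrict measurable_component_singleton p_in)
  have "(\<integral>x. f x \<partial>?P) = (\<integral>x. f x \<partial>distr ?P ?P (\<lambda>x. \<lambda>i\<in>{1..n}. x (p i)))"
    using p by (subst distr_PiM_permutes[OF _ sigma_finite_lborel]) simp_all
  also have "\<dots> = (\<integral>x. f (\<lambda>i\<in>{1..n}. x (p i)) \<partial>?P)"
    by (rule integral_distr[OF m f])
  finally show ?thesis by (simp only: f_restrict)
qed

lemma pair_prod_bounded: "\<exists>B\<ge>0. \<forall>x. (\<forall>i\<in>{1..n}. x i \<in> {l..u}) \<longrightarrow> pair_prod d n x \<le> B"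
proof -
  from d_bounded obtain B where B: "\<And>x y. x \<in> {l..u} \<Longrightarrow> y \<in> {l..u} \<Longrightarrow> d x y \<le> B" by blast
  have B0: "0 \<le> B" using B[of l l] d_nonneg[of l l] lu by auto
  show ?thesis
  proof (intro exI[of _ "\<Prod>i=1..n. \<Prod>j=i+1..n. B"] conjI allI impI)
    show "0 \<le> (\<Prod>i=1..n. \<Prod>j=i+1..n. B)" using B0 by (intro prod_nonneg) auto
    fix x assume "\<forall>i\<in>{1..n}. x i \<in> {l..u}"
    then show "pair_prod d n x \<le> (\<Prod>i=1..n. \<Prod>j=i+1..n. B)"
      unfolding pair_prod_def by (intro prod_mono conjI prod_nonneg ballI d_nonneg B) auto
  qed
qed

lemma integrable_times_weight:
  assumes [measurable]: "f \<in> borel_measurable (lborel_n n)"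
    and bd: "\<And>x. (\<And>i. i \<in> {1..n} \<Longrightarrow> x i \<in> {l..u}) \<Longrightarrow> norm (f x) \<le> B"
  shows "integrable (lborel_n n) (\<lambda>x. f x * weight n x)"
proof -
  obtain B' where B': "0 \<le> B'" "\<And>x. (\<And>i. i \<in> {1..n} \<Longrightarrow> x i \<in> {l..u}) \<Longrightarrow> pair_prod d n x \<le> B'"
    using pair_prod_bounded[of n] by blast
  have "integrable (lborel_n n) (\<lambda>x. of_real (\<bar>B\<bar> * B') * (\<Prod>i=1..n. h (x i)))"
    by (intro integrable_mult_right product_integrable_prod) (auto intro: h_integrable)
  then show ?thesis
  proof (rule Bochner_Integration.integrable_bound)
    show "AE x in lborel_n n. norm (f x * weight n x)
       \<le> norm (of_real (\<bar>B\<bar> * B') * (\<Prod>i=1..n. h (x i)))"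
    proof (intro AE_I2)
      fix x
      show "norm (f x * weight n x) \<le> norm (of_real (\<bar>B\<bar> * B') * (\<Prod>i=1..n. h (x i)))"
      proof (cases "\<forall>i\<in>{1..n}. x i \<in> {l..u}")
        case True
        have "norm (f x) * pair_prod d n x \<le> \<bar>B\<bar> * B'"
        proof (rule mult_mono)
          show "norm (f x) \<le> \<bar>B\<bar>" using bd[of x] True by auto
          show "pair_prod d n x \<le> B'" using B'(2)[of x] True by auto
        qed (auto intro: pair_prod_nonneg d_nonneg)
        then have "(norm (f x) * pair_prod d n x) * norm (\<Prod>i=1..n. h (x i)) \<le>
           (\<bar>B\<bar> * B') * norm (\<Prod>i=1..n. h (x i))"
          by (intro mult_right_mono) auto
        then show ?thesis
          using pair_prod_nonneg[of d n x, OF d_nonneg] B'(1)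
          by (simp add: weight_def norm_mult abs_mult mult_ac)
      next
        case False
        then show ?thesis using weight_outside by fastforce
      qed
    qed
  qed measurable
qed

lemma prod_d_deriv:
  assumes "finite J" "\<And>j. j \<in> J \<Longrightarrow> x j \<in> {l..u}" "y \<in> {l<..<u}" "\<And>j. j \<in> J \<Longrightarrow> d y (x j) \<noteq> 0"
  shows "((\<lambda>y. \<Prod>j\<in>J. d y (x j)) has_real_derivative (\<Sum>j\<in>J. \<kappa> y (x j)) * (\<Prod>j\<in>J. d y (x j))) (at y)"
  using assms
proof (induction J rule: finite_induct)
  case (insert j J)
  have "((\<lambda>y. d y (x j) * (\<Prod>j\<in>J. d y (x j))) has_real_derivative
     (\<kappa> y (x j) * d y (x j)) * (\<Prod>j\<in>J. d y (x j)) +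
     ((\<Sum>j\<in>J. \<kappa> y (x j)) * (\<Prod>j\<in>J. d y (x j))) * d y (x j)) (at y)"
  proof (rule DERIV_mult)
    show "((\<lambda>y. d y (x j)) has_real_derivative \<kappa> y (x j) * d y (x j)) (at y)"
      using insert.prems by (intro d_deriv) auto
    show "((\<lambda>y. \<Prod>j\<in>J. d y (x j)) has_real_derivative (\<Sum>j\<in>J. \<kappa> y (x j)) * (\<Prod>j\<in>J. d y (x j))) (at y)"
      using insert.prems by (intro insert.IH) auto
  qed
  moreover have "(\<lambda>y. \<Prod>j\<in>insert j J. d y (x j)) = (\<lambda>y. d y (x j) * (\<Prod>j\<in>J. d y (x j)))"
    using insert.hyps by simp
  moreover have "(\<Sum>j\<in>insert j J. \<kappa> y (x j)) * (\<Prod>j\<in>insert j J. d y (x j)) =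
     (\<kappa> y (x j) * d y (x j)) * (\<Prod>j\<in>J. d y (x j)) +
     ((\<Sum>j\<in>J. \<kappa> y (x j)) * (\<Prod>j\<in>J. d y (x j))) * d y (x j)"
    using insert.hyps by (simp only: sum.insert prod.insert not_False_eq_True) (simp only: ring_distribs mult_ac)
  ultimately show ?case by (simp only:)
qed simp

text \<open>
  The integrand is the derivative of \<open>\<rho> y * h y * (\<Prod>j\<in>J. d y (x j))\<close> in \<open>y\<close>, away from the finitely
  many zeros of the pair weights. When it fails to be integrable, its Bochner integral is 0 by
  convention, so the equation holds for every position of the other particles.
\<close>

lemma integral_total_derivative:
  assumes J: "finite J" and x: "\<And>j. j \<in> J \<Longrightarrow> x j \<in> {l..u}"
  shows "(\<integral>y. ((c0 - c1 * q y) * h y + \<rho> y * h y * of_real (\<Sum>j\<in>J. \<kappa> y (x j))) * of_real (\<Prod>j\<in>J. d y (x j)) \<partial>lborel) = 0"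
    (is "integral\<^sup>L _ ?F' = 0")
proof (cases "integrable lborel ?F'")
  case True
  let ?F = "\<lambda>y. \<rho> y * h y * of_real (\<Prod>j\<in>J. d y (x j))"
  let ?S = "\<Union>j\<in>J. {y \<in> {l..u}. d y (x j) = 0}"
  have "(?F' has_integral (?F u - ?F l)) {l..u}"
  proof (rule fundamental_theorem_of_calculus_interior_strong)
    show "finite ?S" using J x d_zeros by auto
    show "l \<le> u" using lu by simp
    show "continuous_on {l..u} ?F"
      using x by (intro continuous_intros flux_cont d_cont)
    fix y assume y: "y \<in> {l<..<u} - ?S"
    have "((\<lambda>y. \<Prod>j\<in>J. d y (x j)) has_real_derivative (\<Sum>j\<in>J. \<kappa> y (x j)) * (\<Prod>j\<in>J. d y (x j))) (at y)"
      using y by (intro prod_d_deriv J x) auto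
    then have "((\<lambda>y. complex_of_real (\<Prod>j\<in>J. d y (x j))) has_vector_derivative
        of_real ((\<Sum>j\<in>J. \<kappa> y (x j)) * (\<Prod>j\<in>J. d y (x j)))) (at y)"
      by (intro has_vector_derivative_of_real) (simp add: has_real_derivative_iff_has_vector_derivative)
    from has_vector_derivative_mult[OF flux_deriv this, of] y
    show "(?F has_vector_derivative ?F' y) (at y)"
      by (simp add: algebra_simps)
  qed
  moreover have "?F u = ?F l"
    using boundary x by (auto intro!: prod.cong)
  ultimately have "(?F' has_integral 0) {l..u}" by simp
  then have "((\<lambda>y. if y \<in> {l..u} then ?F' y else 0) has_integral 0) UNIV"
    by (simp only: has_integral_restrict_UNIV)
  moreover have "(\<lambda>y. if y \<in> {l..u} then ?F' y else 0) = ?F'"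
    using h_outside by auto
  ultimately have "(?F' has_integral 0) UNIV"
    by (simp only:)
  with has_integral_integral_lborel[OF True] show ?thesis
    by (rule has_integral_unique)
qed (rule not_integrable_integral_eq)

lemma weight_restrict: "weight n (\<lambda>i\<in>{1..n}. x i) = weight n x"
proof -
  have "pair_prod d n (\<lambda>i\<in>{1..n}. x i) = pair_prod d n x"
    unfolding pair_prod_def by (intro prod.cong refl) auto
  moreover have "(\<Prod>i=1..n. h ((\<lambda>i\<in>{1..n}. x i) i)) = (\<Prod>i=1..n. h (x i))"
    by (intro prod.cong refl) auto
  ultimately show ?thesis unfolding weight_def by (simp only:)
qed

text \<open>
  All pair weights other than the singular one are replaced by constants.
\<close>

lemma pair_prod_le_pair:
  assumes j: "j \<in> {2..n}"
  shows "\<exists>B\<ge>0. \<forall>x. (\<forall>i\<in>{1..n}. x i \<in> {l..u}) \<longrightarrow> pair_prod d n x \<le> d (x 1) (x j) * B"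
proof -
  from d_bounded obtain B where B: "\<And>x y. x \<in> {l..u} \<Longrightarrow> y \<in> {l..u} \<Longrightarrow> d x y \<le> B" by blast
  have B0: "0 \<le> B" using B[of l l] d_nonneg[of l l] lu by auto
  let ?B = "(\<Prod>i\<in>{2..n}-{j}. B) * (\<Prod>i=2..n. \<Prod>j=i+1..n. B)"
  show ?thesis
  proof (intro exI[of _ ?B] conjI allI impI)
    show "0 \<le> ?B" using B0 by (intro mult_nonneg_nonneg prod_nonneg) auto
    fix x assume x: "\<forall>i\<in>{1..n}. x i \<in> {l..u}"
    have n: "1 \<le> n" using j by auto
    have "pair_prod d n x =
        d (x 1) (x j) * ((\<Prod>i\<in>{2..n}-{j}. d (x 1) (x i)) * (\<Prod>i=2..n. \<Prod>j=i+1..n. d (x i) (x j)))"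
      unfolding pair_prod_split_first[OF n] using j by (subst prod.remove[of _ j]) (auto simp: mult_ac)
    also have "\<dots> \<le> d (x 1) (x j) * ?B"
      using x n by (intro mult_left_mono mult_mono prod_mono conjI prod_nonneg mult_nonneg_nonneg ballI d_nonneg B B0) auto
    finally show "pair_prod d n x \<le> d (x 1) (x j) * ?B" .
  qed
qed

text \<open>
  After all pair weights except \<open>d (x 1) (x j)\<close> are bounded by constants, the particle 1 occurs only
  in the kernel of assumption \<open>singular\<close>. Integrating over it first leaves a product of integrals of
  \<open>h\<close>.
\<close>

lemma integrable_singular:
  assumes j: "j \<in> {2..n}"
    and [measurable]: "f \<in> borel_measurable (lborel_n n)"
    and bd: "\<And>x. (\<And>i. i \<in> {1..n} \<Longrightarrow> x i \<in> {l..u}) \<Longrightarrow> norm (f x) \<le> B"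
  shows "integrable (lborel_n n) (\<lambda>x. f x * \<rho> (x 1) * of_real (\<kappa> (x 1) (x j)) * weight n x)"
    (is "integrable ?P ?F")
proof -
  let ?H = "\<lambda>x. \<Prod>i=2..n. ennreal (norm (h (x i)))"
  let ?k = "\<lambda>x y. norm (\<rho> x * h x) * (\<bar>\<kappa> x y\<bar> * d x y)"
  obtain B' where B': "0 \<le> B'" "\<And>x. (\<And>i. i \<in> {1..n} \<Longrightarrow> x i \<in> {l..u}) \<Longrightarrow> pair_prod d n x \<le> d (x 1) (x j) * B'"
    using pair_prod_le_pair[OF j] by blast
  let ?B = "ennreal (\<bar>B\<bar> * B')"
  obtain K where K: "K < \<infinity>"
    "\<And>y. y \<in> {l..u} \<Longrightarrow> (\<integral>\<^sup>+x. ennreal (?k x y) \<partial>lborel) \<le> K"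
    using singular by blast
  have n: "1 \<in> {1..n}" "j \<in> {1..n}" "j \<noteq> 1" and ins: "{1..n} = insert 1 {2..n}" using j by auto
  have [measurable]: "(\<lambda>x. x 1) \<in> borel_measurable ?P" "(\<lambda>x. x j) \<in> borel_measurable ?P"
    using measurable_component_singleton[OF n(1), of "\<lambda>_. lborel :: real measure"]
      measurable_component_singleton[OF n(2), of "\<lambda>_. lborel :: real measure"] by simp_all
  define G where "G x = (?B * ennreal (?k (x 1) (x j))) *
      ?H x" for x
  have G_meas: "G \<in> borel_measurable ?P"
  proof -
    have [measurable]: "(\<lambda>x. h (x i)) \<in> borel_measurable ?P" if "i \<in> {2..n}" for i
    proof -
      have "i \<in> {1..n}" using that by auto
      note coordinate_measurable[OF this, measurable]
      show ?thesis by measurable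
    qed
    show ?thesis unfolding G_def by measurable
  qed
  have "(\<integral>\<^sup>+x. ennreal (norm (?F x)) \<partial>?P) \<le> (\<integral>\<^sup>+x. G x \<partial>?P)"
  proof (rule nn_integral_mono)
    fix x
    show "ennreal (norm (?F x)) \<le> G x"
    proof (cases "\<forall>i\<in>{1..n}. x i \<in> {l..u}")
      case True
      let ?H = "norm (\<rho> (x 1)) * \<bar>\<kappa> (x 1) (x j)\<bar> * norm (\<Prod>i=1..n. h (x i))"
      have "norm (?F x) = (norm (f x) * pair_prod d n x) * ?H"
        using pair_prod_nonneg[of d n x, OF d_nonneg] by (simp add: weight_def norm_mult mult_ac)
      also have "\<dots> \<le> (\<bar>B\<bar> * (d (x 1) (x j) * B')) * ?H"
      proof (intro mult_right_mono mult_mono)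
        show "norm (f x) \<le> \<bar>B\<bar>" using bd[of x] True by auto
        show "pair_prod d n x \<le> d (x 1) (x j) * B'" using B'(2)[of x] True by auto
      qed (auto intro: pair_prod_nonneg d_nonneg)
      also have "norm (\<Prod>i=1..n. h (x i)) = norm (h (x 1)) * (\<Prod>i=2..n. norm (h (x i)))"
        unfolding ins by (subst prod.insert) (auto simp: norm_mult prod_norm)
      finally have "norm (?F x) \<le> (\<bar>B\<bar> * B') * (?k (x 1) (x j)) * (\<Prod>i=2..n. norm (h (x i)))"
        by (simp only: norm_mult mult_ac)
      then show ?thesis unfolding G_def
        using B'(1) d_nonneg[of "x 1" "x j"] by (simp add: prod_ennreal ennreal_mult prod_nonneg flip: ennreal_mult)
    next
      case False
      then show ?thesis using weight_outside by fastforce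
    qed
  qed
  also have "\<dots> = (\<integral>\<^sup>+x. (\<integral>\<^sup>+y. G (x(1:=y)) \<partial>lborel) \<partial>Pi\<^sub>M {2..n} (\<lambda>_. lborel))"
    using G_meas unfolding ins by (intro product_nn_integral_insert) auto
  also have "\<dots> \<le> (\<integral>\<^sup>+x. ?B * K * ?H x \<partial>Pi\<^sub>M {2..n} (\<lambda>_. lborel))"
  proof (rule nn_integral_mono)
    fix x
    have upd: "(\<Prod>i=2..n. ennreal (norm (h ((x(1:=y)) i)))) = ?H x" for y
      by (intro prod.cong refl) auto
    have G_upd: "G (x(1:=y)) = ?B * ennreal (?k y (x j)) *
        ?H x" for y
      using n(3) unfolding G_def upd by simp
    have "(\<integral>\<^sup>+y. G (x(1:=y)) \<partial>lborel) = ?B *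
       (\<integral>\<^sup>+y. ennreal (?k y (x j)) \<partial>lborel) * ?H x"
    proof -
      have [measurable]: "(\<lambda>y. ?k y (x j)) \<in> borel_measurable borel"
        by measurable
      show ?thesis unfolding G_upd by (simp add: nn_integral_multc nn_integral_cmult)
    qed
    also have "\<dots> \<le> ?B * K * ?H x"
    proof (cases "x j \<in> {l..u}")
      case True
      then show ?thesis by (intro mult_right_mono mult_left_mono K(2)) auto
    next
      case False
      then have "?H x = 0"
        using j h_outside[of "x j"] by (intro prod_zero bexI[of _ j]) auto
      then show ?thesis by (simp only: mult_zero_right order_refl)
    qed
    finally show "(\<integral>\<^sup>+y. G (x(1:=y)) \<partial>lborel) \<le> \<dots>" .
  qed
  also have "\<dots> = ?B * K * (\<Prod>i=2..n. (\<integral>\<^sup>+y. ennreal (norm (h y)) \<partial>lborel))"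
  proof -
    have "(\<lambda>x. ennreal (norm (h (x i)))) \<in> borel_measurable (Pi\<^sub>M {2..n} (\<lambda>_. lborel))" if "i \<in> {2..n}" for i
    proof -
      note coordinate_measurable[OF that, measurable]
      show ?thesis by measurable
    qed
    then have "(\<lambda>x. ?H x) \<in> borel_measurable (Pi\<^sub>M {2..n} (\<lambda>_. lborel))"
      by (rule borel_measurable_prod_ennreal)
    moreover have "(\<integral>\<^sup>+x. ?H x \<partial>Pi\<^sub>M {2..n} (\<lambda>_. lborel)) =
        (\<Prod>i=2..n. (\<integral>\<^sup>+y. ennreal (norm (h y)) \<partial>lborel))"
      by (rule product_nn_integral_prod[where f = "\<lambda>_ y. ennreal (norm (h y))"]) auto
    ultimately show ?thesis by (simp only: nn_integral_cmult)
  qed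
  also have "\<dots> < \<infinity>"
  proof -
    have "(\<integral>\<^sup>+y. ennreal (norm (h y)) \<partial>lborel) < \<infinity>"
      using h_integrable by (simp add: integrable_iff_bounded)
    then show ?thesis using K(1) by (auto simp: ennreal_mult_less_top intro!: power_less_top_ennreal[THEN iffD2])
  qed
  finally have "(\<integral>\<^sup>+x. ennreal (norm (?F x)) \<partial>?P) < \<infinity>" .
  moreover have "?F \<in> borel_measurable ?P" by measurable
  ultimately show ?thesis by (intro integrableI_bounded)
qed

lemma weight_update_first:
  assumes "1 \<le> n"
  shows "weight n (x(1:=y)) = (h y * of_real (\<Prod>j=2..n. d y (x j))) *
    ((\<Prod>i=2..n. h (x i)) * of_real (\<Prod>i=2..n. \<Prod>j=i+1..n. d (x i) (x j)))"
proof -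
  have ins: "{1..n} = insert 1 {2..n}" using assms by auto
  have 1: "(\<Prod>i=1..n. h ((x(1:=y)) i)) = h y * (\<Prod>i=2..n. h (x i))"
    unfolding ins by (subst prod.insert) (auto intro!: prod.cong)
  have 2: "(\<Prod>j=2..n. d ((x(1:=y)) 1) ((x(1:=y)) j)) = (\<Prod>j=2..n. d y (x j))"
    by (intro prod.cong refl) auto
  have 3: "(\<Prod>i=2..n. \<Prod>j=i+1..n. d ((x(1:=y)) i) ((x(1:=y)) j)) = (\<Prod>i=2..n. \<Prod>j=i+1..n. d (x i) (x j))"
    by (intro prod.cong refl) auto
  show ?thesis unfolding weight_def pair_prod_split_first[OF assms] 1 2 3 by (simp add: mult_ac)
qed

text \<open>
  Fubini with \<open>x 1\<close> as the inner variable: the inner integral is, up to a constant factor, that of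
  a total derivative.
\<close>

lemma integration_by_parts:
  assumes n: "1 \<le> n"
    and [measurable]: "f \<in> borel_measurable (lborel_n n)"
    and bd: "\<And>x. (\<And>i. i \<in> {1..n} \<Longrightarrow> x i \<in> {l..u}) \<Longrightarrow> norm (f x) \<le> B"
    and indep: "\<And>x y. f (x(1:=y)) = f x"
  shows "(\<integral>x. f x * (c0 - c1 * q (x 1)) * weight n x \<partial>lborel_n n) +
     (\<Sum>j=2..n. \<integral>x. f x * \<rho> (x 1) * of_real (\<kappa> (x 1) (x j)) * weight n x \<partial>lborel_n n) = 0"
proof -
  let ?P = "lborel_n n"
  have n1: "1 \<in> {1..n}" and ins: "{1..n} = insert 1 {2..n}" using n by auto
  have [measurable]: "(\<lambda>x. x 1) \<in> borel_measurable ?P"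
    using measurable_component_singleton[OF n1, of "\<lambda>_. lborel :: real measure"] by simp
  obtain Q where Q: "\<And>x. x \<in> {l..u} \<Longrightarrow> norm (q x) \<le> Q" using q_bounded by blast
  let ?A = "\<lambda>x. f x * (c0 - c1 * q (x 1)) * weight n x"
  let ?S = "\<lambda>j x. f x * \<rho> (x 1) * of_real (\<kappa> (x 1) (x j)) * weight n x"
  have intA: "integrable ?P ?A"
  proof (rule integrable_times_weight[where B = "\<bar>B\<bar> * (norm c0 + norm c1 * Q)"])
    fix x assume x: "\<And>i. i \<in> {1..n} \<Longrightarrow> x i \<in> {l..u}"
    have "norm (c0 - c1 * q (x 1)) \<le> norm c0 + norm (c1 * q (x 1))" by (rule norm_triangle_ineq4)
    also have "\<dots> \<le> norm c0 + norm c1 * Q"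
      unfolding norm_mult by (intro add_left_mono mult_left_mono Q x n1) auto
    finally have 1: "norm (c0 - c1 * q (x 1)) \<le> norm c0 + norm c1 * Q" .
    have 2: "norm (f x) \<le> \<bar>B\<bar>" using bd[of x] x by auto
    show "norm (f x * (c0 - c1 * q (x 1))) \<le> \<bar>B\<bar> * (norm c0 + norm c1 * Q)"
      unfolding norm_mult by (intro mult_mono 1 2) auto
  qed measurable
  have intS: "integrable ?P (?S j)" if "j \<in> {2..n}" for j
    using integrable_singular[OF that assms(2)] bd by blast
  let ?T = "\<lambda>x. ?A x + (\<Sum>j=2..n. ?S j x)"
  have intT: "integrable ?P ?T"
    by (intro Bochner_Integration.integrable_add Bochner_Integration.integrable_sum intA intS)
  have "(\<integral>x. ?A x \<partial>?P) + (\<Sum>j=2..n. \<integral>x. ?S j x \<partial>?P) = (\<integral>x. ?T x \<partial>?P)"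
    using intA intS by (subst Bochner_Integration.integral_add) (auto simp: Bochner_Integration.integral_sum)
  also have "\<dots> = (\<integral>x. (\<integral>y. ?T (x(1:=y)) \<partial>lborel) \<partial>Pi\<^sub>M {2..n} (\<lambda>_. lborel))"
    using intT unfolding ins by (intro product_integral_insert) auto
  also have "\<dots> = (\<integral>x. 0 \<partial>Pi\<^sub>M {2..n} (\<lambda>_. lborel :: real measure))"
  proof (rule Bochner_Integration.integral_cong[OF refl])
    fix x :: "nat \<Rightarrow> real"
    let ?C = "f x * ((\<Prod>i=2..n. h (x i)) * of_real (\<Prod>i=2..n. \<Prod>j=i+1..n. d (x i) (x j)))"
    let ?D = "\<lambda>y. ((c0 - c1 * q y) * h y + \<rho> y * h y * of_real (\<Sum>j=2..n. \<kappa> y (x j))) * of_real (\<Prod>j=2..n. d y (x j))"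
    have "?T (x(1:=y)) = ?C * ?D y" for y
    proof -
      have "(\<Sum>j=2..n. ?S j (x(1:=y))) = (\<Sum>j=2..n. f x * \<rho> y * weight n (x(1:=y)) * of_real (\<kappa> y (x j)))"
        by (intro sum.cong refl) (auto simp: indep simp del: One_nat_def)
      also have "\<dots> = f x * \<rho> y * weight n (x(1:=y)) * of_real (\<Sum>j=2..n. \<kappa> y (x j))"
        by (simp add: sum_distrib_left)
      finally have "?T (x(1:=y)) = f x * (c0 - c1 * q y) * weight n (x(1:=y)) + f x * \<rho> y * weight n (x(1:=y)) * of_real (\<Sum>j=2..n. \<kappa> y (x j))"
        by (simp only: indep fun_upd_same)
      then show ?thesis unfolding weight_update_first[OF n] by (simp only: ring_distribs mult_ac)
    qed
    then have "(\<integral>y. ?T (x(1:=y)) \<partial>lborel) = ?C * (\<integral>y. ?D y \<partial>lborel)"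
      by (simp only: integral_mult_right_zero)
    also have "\<dots> = 0"
    proof (cases "\<forall>j\<in>{2..n}. x j \<in> {l..u}")
      case True
      then show ?thesis using integral_total_derivative[of "{2..n}" x] by simp
    next
      case False
      then have "(\<Prod>i=2..n. h (x i)) = 0" using h_outside by (intro prod_zero) auto
      then show ?thesis by simp
    qed
    finally show "(\<integral>y. ?T (x(1:=y)) \<partial>lborel) = 0" .
  qed
  finally show ?thesis by simp
qed

definition mean_prod :: "nat \<Rightarrow> nat \<Rightarrow> complex" where
  "mean_prod n k = (\<integral>x. (\<Prod>i=1..k. q (x i)) * weight n x \<partial>lborel_n n)"

lemma prod_q_bounded:
  assumes "A \<subseteq> {1..n}"
  shows "\<exists>B. \<forall>x. (\<forall>i\<in>{1..n}. x i \<in> {l..u}) \<longrightarrow> norm (\<Prod>i\<in>A. q (x i)) \<le> B"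
proof -
  obtain Q where Q: "\<And>x. x \<in> {l..u} \<Longrightarrow> norm (q x) \<le> Q" using q_bounded by blast
  have "norm (\<Prod>i\<in>A. q (x i)) \<le> (\<Prod>i\<in>A. Q)" if "\<forall>i\<in>{1..n}. x i \<in> {l..u}" for x
    unfolding prod_norm[symmetric] using that assms by (intro prod_mono conjI Q) auto
  then show ?thesis by blast
qed

lemma prod_q_measurable:
  assumes "A \<subseteq> {1..n}"
  shows "(\<lambda>x. \<Prod>i\<in>A. q (x i)) \<in> borel_measurable (lborel_n n)"
proof (intro borel_measurable_prod)
  fix i assume "i \<in> A"
  then have "i \<in> {1..n}" using assms by auto
  note coordinate_measurable[OF this, measurable]
  show "(\<lambda>x. q (x i)) \<in> borel_measurable (lborel_n n)" by measurable
qed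

lemma integrable_prod_q:
  assumes "A \<subseteq> {1..n}"
  shows "integrable (lborel_n n) (\<lambda>x. (\<Prod>i\<in>A. q (x i)) * weight n x)"
proof -
  obtain B where B: "\<And>x. (\<forall>i\<in>{1..n}. x i \<in> {l..u}) \<Longrightarrow> norm (\<Prod>i\<in>A. q (x i)) \<le> B"
    using prod_q_bounded[OF assms] by blast
  show ?thesis
    by (rule integrable_times_weight[OF prod_q_measurable[OF assms]]) (use B in blast)
qed

lemma mean_prod_image:
  assumes p: "p permutes {1..n}" and k: "k \<le> n"
  shows "(\<integral>x. (\<Prod>i\<in>p ` {1..k}. q (x i)) * weight n x \<partial>lborel_n n) = mean_prod n k"
proof -
  let ?f = "\<lambda>x. (\<Prod>i=1..k. q (x i)) * weight n x"
  have "(\<Prod>i\<in>p ` {1..k}. q (x i)) = (\<Prod>i=1..k. q (x (p i)))" for x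
    using permutes_inj_on[OF p] by (subst prod.reindex) auto
  then have "(\<integral>x. (\<Prod>i\<in>p ` {1..k}. q (x i)) * weight n x \<partial>lborel_n n) = (\<integral>x. ?f (\<lambda>i. x (p i)) \<partial>lborel_n n)"
    by (simp only: weight_permutes[OF p])
  also have "\<dots> = (\<integral>x. ?f x \<partial>lborel_n n)"
  proof (rule integral_permutes[OF p])
    show "?f \<in> borel_measurable (lborel_n n)"
      using k by (intro borel_measurable_times prod_q_measurable weight_measurable) auto
    fix x
    have "(\<Prod>i=1..k. q ((\<lambda>i\<in>{1..n}. x i) i)) = (\<Prod>i=1..k. q (x i))"
      using k by (intro prod.cong refl) auto
    then show "?f (\<lambda>i\<in>{1..n}. x i) = ?f x" by (simp only: weight_restrict)
  qed
  finally show ?thesis by (simp only: mean_prod_def)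
qed

text \<open>
  The integral is averaged with its image under the exchange of the particles 1 and \<open>j\<close>. The sum
  becomes a difference because \<open>\<kappa>\<close> is antisymmetric; this difference removes the singularity.
\<close>

lemma integral_swap:
  assumes j: "j \<in> {2..n}"
    and f: "f \<in> borel_measurable (lborel_n n)"
    and f_restrict: "\<And>x. f (\<lambda>i\<in>{1..n}. x i) = f x"
    and f_bd: "\<And>x. (\<And>i. i \<in> {1..n} \<Longrightarrow> x i \<in> {l..u}) \<Longrightarrow> norm (f x) \<le> B"
  shows "2 * (\<integral>x. f x * \<rho> (x 1) * of_real (\<kappa> (x 1) (x j)) * weight n x \<partial>lborel_n n) =
    (\<integral>x. (f x * \<rho> (x 1) - f (\<lambda>i. x (Transposition.transpose 1 j i)) * \<rho> (x j)) * of_real (\<kappa> (x 1) (x j)) * weight n x \<partial>lborel_n n)"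
proof -
  let ?P = "lborel_n n"
  let ?\<tau> = "Transposition.transpose 1 j"
  let ?g = "\<lambda>x. f (\<lambda>i. x (?\<tau> i))"
  let ?F = "\<lambda>x. f x * \<rho> (x 1) * of_real (\<kappa> (x 1) (x j)) * weight n x"
  have in1: "1 \<in> {1..n}" "j \<in> {1..n}" using j by auto
  have p: "?\<tau> permutes {1..n}" using in1 by (intro permutes_swap_id)
  note coordinate_measurable[OF in1(1), measurable] coordinate_measurable[OF in1(2), measurable] f[measurable]
  have \<tau>_meas: "(\<lambda>x. \<lambda>i\<in>{1..n}. x (?\<tau> i)) \<in> measurable ?P ?P"
    using permutes_in_image[OF p] by (intro measurable_restrict measurable_component_singleton) simp
  have intF: "integrable ?P ?F" using integrable_singular[OF j f] f_bd by blast
  have F_restrict: "?F (\<lambda>i\<in>{1..n}. x i) = ?F x" for x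
    using in1 by (simp only: f_restrict weight_restrict restrict_apply if_True)
  have swF: "?F (\<lambda>i. x (?\<tau> i)) = - (?g x * \<rho> (x j) * of_real (\<kappa> (x 1) (x j)) * weight n x)" for x
    using weight_permutes[OF p, of x] \<kappa>_antisym[of "x j" "x 1"] by simp
  have eq: "(\<integral>x. ?F (\<lambda>i. x (?\<tau> i)) \<partial>?P) = (\<integral>x. ?F x \<partial>?P)"
    by (rule integral_permutes[OF p, of ?F]) (measurable, rule F_restrict)
  have int_sw: "integrable ?P (\<lambda>x. ?F (\<lambda>i. x (?\<tau> i)))"
  proof -
    have "integrable (distr ?P ?P (\<lambda>x. \<lambda>i\<in>{1..n}. x (?\<tau> i))) ?F"
      using intF by (subst distr_PiM_permutes[OF _ sigma_finite_lborel p]) simp_all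
    from integrable_distr[OF \<tau>_meas this] show ?thesis by (simp only: F_restrict)
  qed
  have "2 * (\<integral>x. ?F x \<partial>?P) = (\<integral>x. ?F x + ?F (\<lambda>i. x (?\<tau> i)) \<partial>?P)"
    using intF int_sw by (subst Bochner_Integration.integral_add) (simp_all only: eq mult_2)
  also have "\<dots> = (\<integral>x. (f x * \<rho> (x 1) - ?g x * \<rho> (x j)) * of_real (\<kappa> (x 1) (x j)) * weight n x \<partial>?P)"
    unfolding swF by (simp only: ring_distribs minus_mult_left diff_conv_add_uminus)
  finally show ?thesis .
qed

text \<open>
  Aomoto's recursion. A particle \<open>j \<le> k\<close> has its factor \<open>q (x j)\<close> in the product, so the exchange
  with particle 1 is governed by \<open>exchange_q\<close> and contributes \<open>e\<close> times the \<open>k\<close>-fold mean. A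
  particle \<open>j > k\<close> is governed by \<open>exchange\<close> and contributes a combination of both means.
\<close>

theorem mean_prod_recurrence:
  assumes k: "1 \<le> k" "k \<le> n"
  shows "(c1 - of_nat (k - 1) * e + of_nat (n - k) * f1) * mean_prod n k =
    (c0 + of_nat (n - k) * f0) * mean_prod n (k - 1)"
proof -
  let ?P = "lborel_n n"
  let ?\<tau> = "Transposition.transpose (1::nat)"
  define f where "f x = (\<Prod>i=2..k. q (x i))" for x :: "nat \<Rightarrow> real"
  define S where "S j = (\<integral>x. f x * \<rho> (x 1) * of_real (\<kappa> (x 1) (x j)) * weight n x \<partial>?P)" for j
  have sub: "{2..k} \<subseteq> {1..n}" using k by auto
  obtain B where B: "\<And>x. (\<And>i. i \<in> {1..n} \<Longrightarrow> x i \<in> {l..u}) \<Longrightarrow> norm (f x) \<le> B"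
    using prod_q_bounded[OF sub] unfolding f_def by blast
  have f_meas: "f \<in> borel_measurable ?P"
    unfolding f_def by (rule prod_q_measurable[OF sub])
  have f_restrict: "f (\<lambda>i\<in>{1..n}. x i) = f x" for x
    unfolding f_def using sub by (intro prod.cong refl) auto
  have mean_f: "(\<integral>x. f x * weight n x \<partial>?P) = mean_prod n (k - 1)"
  proof -
    \<comment> \<open>the exchange of 1 and \<open>k\<close> maps \<open>{1..k - 1}\<close> to \<open>{2..k}\<close>\<close>
    have "?\<tau> k permutes {1..n}" using k by (intro permutes_swap_id) auto
    moreover have "?\<tau> k ` {1..k - 1} = {2..k}"
      using k by (auto simp: Transposition.transpose_def image_iff)
    ultimately show ?thesis using mean_prod_image[of "?\<tau> k" n "k - 1"] k by (simp add: f_def)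
  qed
  have int_f: "integrable ?P (\<lambda>x. f x * weight n x)"
    unfolding f_def by (rule integrable_prod_q[OF sub])
  have mean_fq: "(\<integral>x. f x * q (x i) * weight n x \<partial>?P) = mean_prod n k"
    and int_fq: "integrable ?P (\<lambda>x. f x * q (x i) * weight n x)"
    if i: "i \<in> {1..n}" "i \<notin> {2..k}" for i
  proof -
    have sub': "insert i {2..k} \<subseteq> {1..n}" using i sub by auto
    have eq: "f x * q (x i) = (\<Prod>i\<in>insert i {2..k}. q (x i))" for x
      using i(2) by (subst prod.insert) (auto simp: f_def mult.commute)
    have "?\<tau> i permutes {1..n}" using i k by (intro permutes_swap_id) auto
    moreover have "?\<tau> i ` {1..k} = insert i {2..k}"
      using i k by (auto simp: Transposition.transpose_def image_iff)
    ultimately show "(\<integral>x. f x * q (x i) * weight n x \<partial>?P) = mean_prod n k"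
      unfolding eq using mean_prod_image[of "?\<tau> i" n k] k by simp
    show "integrable ?P (\<lambda>x. f x * q (x i) * weight n x)"
      unfolding eq by (rule integrable_prod_q[OF sub'])
  qed
  have one: "1 \<in> {1..n}" "1 \<notin> {2..k}" using k by auto
  let ?swap = "\<lambda>j x. (f x * \<rho> (x 1) - f (\<lambda>i. x (?\<tau> j i)) * \<rho> (x j)) * of_real (\<kappa> (x 1) (x j))"
  have ibp: "(\<integral>x. f x * (c0 - c1 * q (x 1)) * weight n x \<partial>?P) + (\<Sum>j=2..n. S j) = 0"
    unfolding S_def
  proof (rule integration_by_parts[OF _ f_meas])
    show "f (x(1:=y)) = f x" for x y unfolding f_def by (intro prod.cong refl) auto
  qed (use k B in auto)
  have "(\<integral>x. f x * (c0 - c1 * q (x 1)) * weight n x \<partial>?P) =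
      (\<integral>x. c0 * (f x * weight n x) - c1 * (f x * q (x 1) * weight n x) \<partial>?P)"
    by (intro Bochner_Integration.integral_cong refl) (simp add: algebra_simps)
  also have "\<dots> = c0 * mean_prod n (k - 1) - c1 * mean_prod n k"
    using int_f int_fq[OF one] by (subst Bochner_Integration.integral_diff) (simp_all only: integrable_mult_right integral_mult_right_zero mean_f mean_fq[OF one])
  finally have A: "(\<integral>x. f x * (c0 - c1 * q (x 1)) * weight n x \<partial>?P) =
    c0 * mean_prod n (k - 1) - c1 * mean_prod n k" .
  have S_inner: "S j = e * mean_prod n k" if j: "j \<in> {2..k}" for j
  proof -
    have jn: "j \<in> {2..n}" using j k by auto
    have "2 * S j = (\<integral>x. ?swap j x * weight n x \<partial>?P)"
      unfolding S_def
      by (rule integral_swap[where f = f and B = B, OF jn f_meas f_restrict]) (use B in blast)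
    also have "\<dots> = (\<integral>x. 2 * e * (f x * q (x 1) * weight n x) \<partial>?P)"
    proof (intro Bochner_Integration.integral_cong refl)
      fix x :: "nat \<Rightarrow> real"
      let ?g = "\<Prod>i\<in>{2..k}-{j}. q (x i)"
      have fx: "f x = q (x j) * ?g" unfolding f_def using j by (intro prod.remove) auto
      have "(\<Prod>i=2..k. q (x (?\<tau> j i))) = q (x (?\<tau> j j)) * (\<Prod>i\<in>{2..k}-{j}. q (x (?\<tau> j i)))"
        using j by (intro prod.remove) auto
      also have "(\<Prod>i\<in>{2..k}-{j}. q (x (?\<tau> j i))) = ?g"
        by (intro prod.cong refl) (auto simp: Transposition.transpose_def)
      finally have f\<tau>: "f (\<lambda>i. x (?\<tau> j i)) = q (x 1) * ?g" unfolding f_def by simp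
      show "?swap j x * weight n x =
        2 * e * (f x * q (x 1) * weight n x)"
      proof (cases "weight n x = 0")
        case False
        then have "x 1 \<in> {l..u}" "x j \<in> {l..u}" "d (x 1) (x j) \<noteq> 0"
          using weight_outside[of 1 n x] weight_outside[of j n x] weight_collision[of 1 n j x] jn by auto
        note exchange_q[OF this]
        moreover have "?swap j x =
            ((\<rho> (x 1) * q (x j) - \<rho> (x j) * q (x 1)) * of_real (\<kappa> (x 1) (x j))) * ?g"
          unfolding fx f\<tau> by (simp add: algebra_simps)
        ultimately show ?thesis by (simp add: fx mult_ac)
      qed simp
    qed
    also have "\<dots> = 2 * e * mean_prod n k" by (simp only: integral_mult_right_zero mean_fq[OF one])
    finally show ?thesis by simp
  qed
  have S_outer: "S j = f0 * mean_prod n (k - 1) - f1 * mean_prod n k" if j: "j \<in> {k+1..n}" for j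
  proof -
    have jn: "j \<in> {2..n}" and j': "j \<in> {1..n}" "j \<notin> {2..k}" using j k by auto
    have "2 * S j = (\<integral>x. ?swap j x * weight n x \<partial>?P)"
      unfolding S_def
      by (rule integral_swap[where f = f and B = B, OF jn f_meas f_restrict]) (use B in blast)
    also have "\<dots> = (\<integral>x. 2 * f0 * (f x * weight n x) - f1 * (f x * q (x 1) * weight n x + f x * q (x j) * weight n x) \<partial>?P)"
    proof (intro Bochner_Integration.integral_cong refl)
      fix x :: "nat \<Rightarrow> real"
      have f\<tau>: "f (\<lambda>i. x (?\<tau> j i)) = f x"
        unfolding f_def using j by (intro prod.cong refl) (auto simp: Transposition.transpose_def)
      show "?swap j x * weight n x =
        2 * f0 * (f x * weight n x) - f1 * (f x * q (x 1) * weight n x + f x * q (x j) * weight n x)"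
      proof (cases "weight n x = 0")
        case False
        then have "x 1 \<in> {l..u}" "x j \<in> {l..u}" "d (x 1) (x j) \<noteq> 0"
          using weight_outside[of 1 n x] weight_outside[of j n x] weight_collision[of 1 n j x] jn by auto
        note ex = exchange[OF this]
        have "?swap j x =
            f x * (2 * f0 - f1 * (q (x 1) + q (x j)))"
          unfolding f\<tau> ex[symmetric] by (simp add: algebra_simps)
        then show ?thesis by (simp only:) (simp add: algebra_simps)
      qed simp
    qed
    also have "\<dots> = 2 * f0 * mean_prod n (k - 1) - f1 * (mean_prod n k + mean_prod n k)"
      using int_f int_fq[OF one] int_fq[OF j']
      by (subst Bochner_Integration.integral_diff)
        (simp_all only: integrable_mult_right integral_mult_right_zero Bochner_Integration.integrable_add
          Bochner_Integration.integral_add mean_f mean_fq[OF one] mean_fq[OF j'])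
    finally have "2 * S j = 2 * (f0 * mean_prod n (k - 1) - f1 * mean_prod n k)" by (simp add: algebra_simps)
    then show ?thesis by (simp only: mult_cancel_left) simp
  qed
  have "{2..n} = {2..k} \<union> {k+1..n}" using k by auto
  then have "(\<Sum>j=2..n. S j) = (\<Sum>j=2..k. S j) + (\<Sum>j=k+1..n. S j)"
    by (simp only:) (rule sum.union_disjoint, auto)
  also have "(\<Sum>j=2..k. S j) = of_nat (k - 1) * (e * mean_prod n k)"
    by (simp add: S_inner)
  also have "(\<Sum>j=k+1..n. S j) = of_nat (n - k) * (f0 * mean_prod n (k - 1) - f1 * mean_prod n k)"
    by (simp add: S_outer)
  finally have sumS: "(\<Sum>j=2..n. S j) = of_nat (k - 1) * (e * mean_prod n k) +
    of_nat (n - k) * (f0 * mean_prod n (k - 1) - f1 * mean_prod n k)" .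
  have "(c1 - of_nat (k - 1) * e + of_nat (n - k) * f1) * mean_prod n k - (c0 + of_nat (n - k) * f0) * mean_prod n (k - 1) =
      - (c0 * mean_prod n (k - 1) - c1 * mean_prod n k + (\<Sum>j=2..n. S j))"
    unfolding sumS by (simp add: algebra_simps)
  also have "\<dots> = 0" using ibp unfolding A by (simp only: neg_equal_0_iff_equal)
  finally show ?thesis by (simp only: right_minus_eq)
qed

text \<open>
  The recursion multiplied over \<open>k = 1..n\<close>; the index \<open>j = n - k\<close> counts the particles outside the
  product.
\<close>

lemma mean_prod_top:
  assumes nz: "\<And>j. j < n \<Longrightarrow> c1 - of_nat (n - 1 - j) * e + of_nat j * f1 \<noteq> 0"
  shows "mean_prod n n = mean_prod n 0 * (\<Prod>j<n. (c0 + of_nat j * f0) / (c1 - of_nat (n - 1 - j) * e + of_nat j * f1))"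
proof -
  let ?r = "\<lambda>j. (c0 + of_nat j * f0) / (c1 - of_nat (n - 1 - j) * e + of_nat j * f1)"
  have "mean_prod n k = mean_prod n 0 * (\<Prod>i<k. ?r (n - Suc i))" if "k \<le> n" for k
    using that
  proof (induction k)
    case (Suc k)
    have k: "n - 1 - (n - Suc k) = Suc k - 1" using Suc.prems by simp
    have "c1 - of_nat (Suc k - 1) * e + of_nat (n - Suc k) * f1 \<noteq> 0"
      using nz[of "n - Suc k"] Suc.prems unfolding k by simp
    then have "mean_prod n (Suc k) = mean_prod n k * ?r (n - Suc k)"
      using mean_prod_recurrence[of "Suc k" n] Suc.prems unfolding k by (simp add: field_simps)
    then show ?case using Suc by simp
  qed simp
  then have "mean_prod n n = mean_prod n 0 * (\<Prod>i<n. ?r (n - Suc i))" by blast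
  also have "(\<Prod>i<n. ?r (n - Suc i)) = (\<Prod>j<n. ?r j)"
    by (rule prod.nat_diff_reindex)
  finally show ?thesis .
qed

end

section \<open>The Jacobi weight on an interval\<close>

text \<open>
  The supremum over \<open>y\<close> is taken trivially by translation invariance, and evenness reduces
  the integral over \<open>{-R..R}\<close> to twice the one over \<open>{0..R}\<close>.
\<close>

lemma even_kernel_bound:
  fixes k :: "real \<Rightarrow> real"
  assumes [measurable]: "k \<in> borel_measurable borel" and even: "\<And>t. k (- t) = k t"
    and I: "(k has_integral I) {0..R}" and nonneg: "\<And>t. 0 \<le> k t"
  shows "\<exists>K<\<infinity>. \<forall>y. (\<integral>\<^sup>+x. ennreal (indicator {-R..R} (x - y) * k (x - y)) \<partial>lborel) \<le> K"
proof -
  let ?f = "\<lambda>t. ennreal (indicator {0..R} t * k t)"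
  let ?g = "\<lambda>t. ennreal (indicator {-R..R} t * k t)"
  have fin: "(\<integral>\<^sup>+t. ?f t \<partial>lborel) = ennreal I"
  proof (rule nn_integral_has_integral_lborel)
    show "((\<lambda>t. indicator {0..R} t * k t) has_integral I) UNIV"
    proof -
      have "((\<lambda>t. if t \<in> {0..R} then k t else 0) has_integral I) UNIV"
        using I by (simp only: has_integral_restrict_UNIV)
      moreover have "(\<lambda>t. if t \<in> {0..R} then k t else 0) = (\<lambda>t. indicator {0..R} t * k t)"
        by (auto simp: indicator_def)
      ultimately show ?thesis by (simp only:)
    qed
  qed (auto simp: nonneg)
  have "(\<integral>\<^sup>+t. ?g t \<partial>lborel) \<le> (\<integral>\<^sup>+t. ?f t + ?f (- t) \<partial>lborel)"
    using nonneg by (intro nn_integral_mono) (auto simp: indicator_def even)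
  also have "\<dots> = (\<integral>\<^sup>+t. ?f t \<partial>lborel) + (\<integral>\<^sup>+t. ?f (- t) \<partial>lborel)"
    by (rule nn_integral_add) measurable
  also have "(\<integral>\<^sup>+t. ?f (- t) \<partial>lborel) = (\<integral>\<^sup>+t. ?f t \<partial>lborel)"
    using nn_integral_real_affine[of ?f "-1" 0] by simp
  finally have le: "(\<integral>\<^sup>+t. ?g t \<partial>lborel) \<le> ennreal I + ennreal I" by (simp only: fin)
  have "(\<integral>\<^sup>+x. ?g (x - y) \<partial>lborel) = (\<integral>\<^sup>+t. ?g t \<partial>lborel)" for y
    using nn_integral_real_affine[of ?g 1 "- y"] by simp
  with le show ?thesis by (intro exI[of _ "ennreal I + ennreal I"]) auto
qed

text \<open>
  For \<open>x\<close> and \<open>y\<close> in \<open>{l..u}\<close> the difference \<open>x - y\<close> stays within \<open>u - l\<close> of 0, which is why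
  the kernel is integrated up to \<open>u - l\<close>. This provides the assumption \<open>singular\<close> of the locale for
  interactions that depend on the difference of the positions.
\<close>

lemma flux_kernel_bound:
  fixes k :: "real \<Rightarrow> real"
  assumes [measurable]: "k \<in> borel_measurable borel" and even: "\<And>t. k (- t) = k t"
    and I: "(k has_integral I) {0..u - l}" and nonneg: "\<And>t. 0 \<le> k t"
    and g: "\<And>x. x \<in> {l..u} \<Longrightarrow> g x \<le> B" "\<And>x. x \<notin> {l..u} \<Longrightarrow> g x = 0" and B: "0 \<le> B"
  shows "\<exists>K<\<infinity>. \<forall>y\<in>{l..u}. (\<integral>\<^sup>+x. ennreal (g x * k (x - y)) \<partial>lborel) \<le> K"
proof -
  let ?k = "\<lambda>t. indicator {-(u - l)..u - l} t * k t"
  obtain K where K: "K < \<infinity>" "\<And>y. (\<integral>\<^sup>+x. ennreal (?k (x - y)) \<partial>lborel) \<le> K"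
    using even_kernel_bound[of k I "u - l", OF assms(1) even I nonneg] by auto
  have "(\<integral>\<^sup>+x. ennreal (g x * k (x - y)) \<partial>lborel) \<le> ennreal B * K" if y: "y \<in> {l..u}" for y
  proof -
    have "(\<integral>\<^sup>+x. ennreal (g x * k (x - y)) \<partial>lborel) \<le> (\<integral>\<^sup>+x. ennreal B * ennreal (?k (x - y)) \<partial>lborel)"
    proof (rule nn_integral_mono)
      fix x :: real
      show "ennreal (g x * k (x - y)) \<le> ennreal B * ennreal (?k (x - y))"
      proof (cases "x \<in> {l..u}")
        case True
        have "g x * k (x - y) \<le> B * k (x - y)" using g(1)[OF True] nonneg by (rule mult_right_mono)
        also have "\<dots> = B * ?k (x - y)" using True y by (simp add: indicator_def)
        finally show ?thesis using B by (subst ennreal_mult'[symmetric]) (auto intro: ennreal_leI)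
      qed (simp add: g(2))
    qed
    also have "\<dots> = ennreal B * (\<integral>\<^sup>+x. ennreal (?k (x - y)) \<partial>lborel)"
      by (rule nn_integral_cmult) measurable
    also have "\<dots> \<le> ennreal B * K" by (intro mult_left_mono K(2)) auto
    finally show ?thesis .
  qed
  moreover have "ennreal B * K < \<infinity>" using K(1) by (simp add: ennreal_mult_less_top)
  ultimately show ?thesis by blast
qed

text \<open>
  The parameters follow the convention of the beta distribution; \<open>s\<close> belongs to the right end point
  because the recursion multiplies by \<open>u - x\<close>.
\<close>

definition beta_weight :: "real \<Rightarrow> real \<Rightarrow> real \<Rightarrow> real \<Rightarrow> real \<Rightarrow> real" where
  "beta_weight l u s t x = indicator {l..u} x * ((u - x) powr (s - 1) * (x - l) powr (t - 1))"

lemma beta_weight_measurable [measurable]: "beta_weight l u s t \<in> borel_measurable borel"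
  unfolding beta_weight_def by measurable

lemma beta_weight_nonneg: "0 \<le> beta_weight l u s t x"
  by (simp add: beta_weight_def)

lemma has_integral_beta_weight_unit:
  assumes s: "0 < s" and t: "0 < t"
  shows "(beta_weight 0 1 s t has_integral Beta t s) UNIV"
proof -
  have "((\<lambda>x. if x \<in> {0..1} then x powr (t - 1) * (1 - x) powr (s - 1) else 0) has_integral Beta t s) UNIV"
    using has_integral_Beta_real[OF t s] by (simp only: has_integral_restrict_UNIV)
  moreover have "(\<lambda>x. if x \<in> {0..1} then x powr (t - 1) * (1 - x) powr (s - 1) else 0) = beta_weight 0 1 s t"
    by (auto simp: beta_weight_def)
  ultimately show ?thesis by (simp only:)
qed

text \<open>
  The beta integral on \<open>{0..1}\<close>, transported by the affine map onto \<open>{l..u}\<close>.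
\<close>

lemma integrable_beta_weight:
  assumes s: "0 < s" and t: "0 < t" and lu: "l < u"
  shows "integrable lborel (beta_weight l u s t)"
proof -
  let ?f = "beta_weight 0 1 s t" and ?L = "u - l"
  have "(\<integral>\<^sup>+z. ennreal (?f z) \<partial>lborel) = ennreal (Beta t s)"
    by (rule nn_integral_has_integral_lborel[OF _ beta_weight_nonneg has_integral_beta_weight_unit[OF s t]]) measurable
  then have "integrable lborel ?f" by (intro integrableI_nonneg) (auto simp: beta_weight_nonneg)
  from lborel_integrable_real_affine[OF this, of "1 / ?L" "- l / ?L"] lu
  have "integrable lborel (\<lambda>x. ?L powr (s - 1) * ?L powr (t - 1) * ?f (- l / ?L + 1 / ?L * x))"
    by (intro integrable_mult_right) auto
  moreover have "?L powr (s - 1) * ?L powr (t - 1) * ?f (- l / ?L + 1 / ?L * x) = beta_weight l u s t x" for x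
  proof -
    have z: "- l / ?L + 1 / ?L * x = (x - l) / ?L" by (simp add: diff_divide_distrib)
    have z': "1 - (x - l) / ?L = (u - x) / ?L" using lu by (simp add: field_simps)
    have "(x - l) / ?L \<in> {0..1} \<longleftrightarrow> x \<in> {l..u}" using lu by (auto simp: field_simps)
    then show ?thesis unfolding z beta_weight_def z' using lu
      by (cases "x \<in> {l..u}") (auto simp: powr_divide indicator_def)
  qed
  ultimately show ?thesis by (simp only:)
qed

lemma power2_powr_half: "a\<^sup>2 powr (b / 2) = \<bar>a\<bar> powr b" for a b :: real
proof (cases "a = 0")
  case False
  then have "a\<^sup>2 = \<bar>a\<bar> powr 2" by simp
  then show ?thesis by (simp only: powr_powr) simp
qed simp

lemma DERIV_abs_diff_powr:
  fixes x y \<beta> :: real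
  assumes "x \<noteq> y"
  shows "((\<lambda>x. \<bar>x - y\<bar> powr \<beta>) has_real_derivative \<beta> / (x - y) * \<bar>x - y\<bar> powr \<beta>) (at x)"
proof -
  let ?q = "(x - y)\<^sup>2"
  have "0 < ?q" using assms by simp
  then have D: "((\<lambda>x. ((x - y)\<^sup>2) powr (\<beta> / 2)) has_real_derivative
      ?q powr (\<beta> / 2) * (0 * ln ?q + (2 * (x - y)) * (\<beta> / 2) / ?q)) (at x)"
    by (intro DERIV_powr) (auto intro!: derivative_eq_intros)
  have "(2 * t) * (\<beta> / 2) / t\<^sup>2 = \<beta> / t" if "t \<noteq> 0" for t :: real
    using that by (simp add: power2_eq_square)
  from this[of "x - y"] have "(2 * (x - y)) * (\<beta> / 2) / ?q = \<beta> / (x - y)" using assms by simp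
  then have "?q powr (\<beta> / 2) * (0 * ln ?q + (2 * (x - y)) * (\<beta> / 2) / ?q) = \<beta> / (x - y) * \<bar>x - y\<bar> powr \<beta>"
    by (simp only: power2_powr_half mult_zero_left add_0 mult.commute)
  with D show ?thesis by (simp only: power2_powr_half)
qed

text \<open>
  At an end point the left-hand side has a zero factor, and the right-hand side vanishes because
  \<open>0 powr s = 0\<close>.
\<close>

lemma beta_flux:
  assumes "x \<in> {l..u}"
  shows "(u - x) * (x - l) * beta_weight l u s t x = (u - x) powr s * (x - l) powr t"
proof -
  have "(u - x) * (u - x) powr (s - 1) = (u - x) powr s" "(x - l) * (x - l) powr (t - 1) = (x - l) powr t"
    using assms by (auto simp: powr_mult_base)
  moreover have "(u - x) * (x - l) * beta_weight l u s t x =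
      ((u - x) * (u - x) powr (s - 1)) * ((x - l) * (x - l) powr (t - 1))"
    using assms by (simp add: beta_weight_def)
  ultimately show ?thesis by (simp only:)
qed

lemma DERIV_beta_flux:
  assumes x: "x \<in> {l<..<u}"
  shows "((\<lambda>x. (u - x) powr s * (x - l) powr t) has_real_derivative
    (- (s * (u - l)) + (s + t) * (u - x)) * beta_weight l u s t x) (at x)"
proof -
  have "((\<lambda>x. (u - x) powr s * (x - l) powr t) has_real_derivative
     ((u - x) powr s * (0 * ln (u - x) + - 1 * s / (u - x))) * (x - l) powr t +
     ((x - l) powr t * (0 * ln (x - l) + 1 * t / (x - l))) * (u - x) powr s) (at x)"
    using x by (intro DERIV_mult DERIV_powr) (auto intro!: derivative_eq_intros)
  moreover have "((u - x) powr s * (0 * ln (u - x) + - 1 * s / (u - x))) * (x - l) powr t +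
     ((x - l) powr t * (0 * ln (x - l) + 1 * t / (x - l))) * (u - x) powr s =
     (- (s * (u - l)) + (s + t) * (u - x)) * beta_weight l u s t x"
  proof -
    define U V where "U = (u - x) powr (s - 1)" and "V = (x - l) powr (t - 1)"
    have U: "(u - x) powr s = (u - x) * U" and V: "(x - l) powr t = (x - l) * V"
      using x by (auto simp: powr_mult_base U_def V_def)
    have W: "beta_weight l u s t x = U * V" using x by (simp add: beta_weight_def U_def V_def)
    have 1: "(u - x) * U * (0 * ln (u - x) + - 1 * s / (u - x)) = - s * U" using x by simp
    have 2: "(x - l) * V * (0 * ln (x - l) + 1 * t / (x - l)) = t * V" using x by simp
    show ?thesis unfolding U V 1 2 W by (simp add: algebra_simps)
  qed
  ultimately show ?thesis by (simp only:)
qed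

text \<open>
  The interaction \<open>\<bar>\<kappa>\<bar> * d\<close> equals \<open>\<beta> * \<bar>x - y\<bar> powr (\<beta> - 1)\<close>, which is integrable near the diagonal
  for \<open>\<beta> > 0\<close>, and the flux is bounded.
\<close>

lemma beta_flux_singular:
  assumes s: "0 < s" and t: "0 < t" and lu: "l < u" and \<beta>: "0 < \<beta>"
  shows "\<exists>K<\<infinity>. \<forall>y\<in>{l..u}. (\<integral>\<^sup>+x. ennreal (\<bar>(u - x) * (x - l) * beta_weight l u s t x\<bar> *
    (\<bar>\<beta> / (x - y)\<bar> * \<bar>x - y\<bar> powr \<beta>)) \<partial>lborel) \<le> K"
proof (rule flux_kernel_bound[where k = "\<lambda>t. \<bar>\<beta> / t\<bar> * \<bar>t\<bar> powr \<beta>" and B = "(u - l) powr s * (u - l) powr t"])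
  have "((\<lambda>t. \<beta> * t powr (\<beta> - 1)) has_integral \<beta> * ((u - l) powr (\<beta> - 1 + 1) / (\<beta> - 1 + 1))) {0..u - l}"
    using lu \<beta> by (intro has_integral_mult_right has_integral_powr_from_0) auto
  then show "((\<lambda>t. \<bar>\<beta> / t\<bar> * \<bar>t\<bar> powr \<beta>) has_integral \<beta> * ((u - l) powr (\<beta> - 1 + 1) / (\<beta> - 1 + 1))) {0..u - l}"
  proof (rule has_integral_eq[rotated])
    fix t :: real assume t: "t \<in> {0..u - l}"
    show "\<beta> * t powr (\<beta> - 1) = \<bar>\<beta> / t\<bar> * \<bar>t\<bar> powr \<beta>"
      using t \<beta> by (cases "t = 0") (auto simp: powr_diff)
  qed
  show "\<bar>(u - x) * (x - l) * beta_weight l u s t x\<bar> \<le> (u - l) powr s * (u - l) powr t" if "x \<in> {l..u}" for x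
    unfolding beta_flux[OF that] using that s t by (auto simp: abs_mult intro!: mult_mono powr_mono2)
qed (auto simp: beta_weight_def)

text \<open>
  Here \<open>x - y = q y - q x\<close> and \<open>\<rho> = q * (L - q)\<close> with \<open>L = u - l\<close>. Hence the difference
  \<open>\<rho> x * q y - \<rho> y * q x\<close> is \<open>q x * q y * (x - y)\<close>, and \<open>\<rho> x - \<rho> y\<close> is
  \<open>(x - y) * (q x + q y - L)\<close>; in both cases the factor \<open>x - y\<close> cancels the pole of \<open>\<kappa>\<close>.
\<close>

lemma pair_gas_jacobi:
  assumes s: "0 < s" and t: "0 < t" and lu: "l < u" and \<beta>: "0 < \<beta>"
  shows "pair_gas l u (\<lambda>x. of_real (beta_weight l u s t x))
    (\<lambda>x. of_real ((u - x) * (x - l))) (\<lambda>x. of_real (u - x))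
    (\<lambda>x y. \<bar>x - y\<bar> powr \<beta>) (\<lambda>x y. \<beta> / (x - y))
    (of_real (- (s * (u - l)))) (of_real (- (s + t))) (of_real (\<beta> / 2)) (of_real (- (\<beta> / 2 * (u - l)))) (of_real (- \<beta>))"
proof -
  let ?h = "\<lambda>x. complex_of_real (beta_weight l u s t x)" and ?\<rho> = "\<lambda>x. complex_of_real ((u - x) * (x - l))"
  have flux: "?\<rho> x * ?h x = of_real ((u - x) powr s * (x - l) powr t)"
    if "x \<in> {l..u}" for x
    unfolding of_real_mult[symmetric] beta_flux[OF that] ..
  show ?thesis
  proof
    show "l < u" by fact
    show "integrable lborel (\<lambda>x. ?h x)"
      using integrable_beta_weight[OF s t lu] by (rule integrable_of_real)
    show "\<exists>B. \<forall>x\<in>{l..u}. cmod (complex_of_real (u - x)) \<le> B"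
    proof (intro exI[of _ "u - l"] ballI)
      fix x assume "x \<in> {l..u}"
      then show "cmod (complex_of_real (u - x)) \<le> u - l" unfolding norm_of_real by auto
    qed
    show "\<exists>B. \<forall>x\<in>{l..u}. \<forall>y\<in>{l..u}. \<bar>x - y\<bar> powr \<beta> \<le> B"
      using \<beta> by (intro exI[of _ "(u - l) powr \<beta>"]) (auto intro!: powr_mono2)
    show "continuous_on {l..u} (\<lambda>x. \<bar>x - y\<bar> powr \<beta>)" for y
      using \<beta> by (intro continuous_on_powr' continuous_intros) auto
    show "finite {x \<in> {l..u}. \<bar>x - y\<bar> powr \<beta> = 0}" for y
      by (rule finite_subset[of _ "{y}"]) auto
    show "((\<lambda>x. \<bar>x - y\<bar> powr \<beta>) has_real_derivative \<beta> / (x - y) * \<bar>x - y\<bar> powr \<beta>) (at x)"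
      if "\<bar>x - y\<bar> powr \<beta> \<noteq> 0" for x y
      using that by (intro DERIV_abs_diff_powr) auto
    show "\<beta> / (y - x) = - (\<beta> / (x - y))" for x y
      by (metis minus_diff_eq divide_minus_right)
    show "continuous_on {l..u} (\<lambda>x. ?\<rho> x * ?h x)"
    proof (subst continuous_on_cong[OF refl flux])
      show "continuous_on {l..u} (\<lambda>x. complex_of_real ((u - x) powr s * (x - l) powr t))"
        using s t by (intro continuous_on_of_real continuous_on_mult continuous_on_powr' continuous_intros) auto
    qed
    show "((\<lambda>x. ?\<rho> x * ?h x) has_vector_derivative
        (of_real (- (s * (u - l))) - of_real (- (s + t)) * complex_of_real (u - x)) * ?h x) (at x)"
      if x: "x \<in> {l<..<u}" for x
    proof -
      have "((\<lambda>x. complex_of_real ((u - x) powr s * (x - l) powr t)) has_vector_derivative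
          complex_of_real ((- (s * (u - l)) + (s + t) * (u - x)) * beta_weight l u s t x)) (at x)"
        using DERIV_beta_flux[OF x]
        by (intro has_vector_derivative_of_real) (simp only: has_real_derivative_iff_has_vector_derivative)
      then have "((\<lambda>x. ?\<rho> x * ?h x) has_vector_derivative
          complex_of_real ((- (s * (u - l)) + (s + t) * (u - x)) * beta_weight l u s t x)) (at x)"
        by (rule has_vector_derivative_transform_within_open[where S = "{l<..<u}"])
          (use x flux in auto)
      moreover have "(of_real (- (s * (u - l))) - of_real (- (s + t)) * complex_of_real (u - x)) * ?h x =
          complex_of_real ((- (s * (u - l)) + (s + t) * (u - x)) * beta_weight l u s t x)"
        unfolding of_real_mult of_real_add of_real_minus by (simp only: mult_minus_left diff_minus_eq_add)
      ultimately show ?thesis by (simp only:)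
    qed
    show "?\<rho> l * ?h l = 0 \<and>
        ?\<rho> u * ?h u = 0 \<or>
        ?\<rho> l * ?h l =
        ?\<rho> u * ?h u \<and>
        (\<forall>y\<in>{l..u}. \<bar>l - y\<bar> powr \<beta> = \<bar>u - y\<bar> powr \<beta>)" by simp
    show "\<exists>K<\<infinity>. \<forall>y\<in>{l..u}. (\<integral>\<^sup>+x. ennreal (cmod (?\<rho> x * ?h x) *
        (\<bar>\<beta> / (x - y)\<bar> * \<bar>x - y\<bar> powr \<beta>)) \<partial>lborel) \<le> K"
      using beta_flux_singular[OF s t lu \<beta>] unfolding of_real_mult[symmetric] norm_of_real .
    fix x y :: real assume "\<bar>x - y\<bar> powr \<beta> \<noteq> 0"
    then have xy: "x \<noteq> y" by auto
    have "((u - x) * (x - l) * (u - y) - (u - y) * (y - l) * (u - x)) = (u - x) * (u - y) * (x - y)"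
      by (simp add: algebra_simps)
    then have "((u - x) * (x - l) * (u - y) - (u - y) * (y - l) * (u - x)) * (\<beta> / (x - y)) = 2 * (\<beta> / 2) * ((u - x) * (u - y))"
      using xy by simp
    from arg_cong[OF this, of complex_of_real]
    show "(?\<rho> x * complex_of_real (u - y) - ?\<rho> y * complex_of_real (u - x)) *
      complex_of_real (\<beta> / (x - y)) = 2 * complex_of_real (\<beta> / 2) * (complex_of_real (u - x) * complex_of_real (u - y))"
      by (simp only: of_real_mult of_real_diff of_real_numeral)
    have "((u - x) * (x - l) - (u - y) * (y - l)) = (x - y) * ((u - x) + (u - y) - (u - l))"
      by (simp add: algebra_simps)
    then have "((u - x) * (x - l) - (u - y) * (y - l)) * (\<beta> / (x - y)) = 2 * - (\<beta> / 2 * (u - l)) - - \<beta> * ((u - x) + (u - y))"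
      using xy by simp (simp add: algebra_simps)
    from arg_cong[OF this, of complex_of_real]
    show "(?\<rho> x - ?\<rho> y) * complex_of_real (\<beta> / (x - y)) =
      2 * complex_of_real (- (\<beta> / 2 * (u - l))) - complex_of_real (- \<beta>) * (complex_of_real (u - x) + complex_of_real (u - y))"
      by (simp only: of_real_mult of_real_diff of_real_add of_real_minus of_real_numeral)
  qed (auto simp: abs_minus_commute beta_weight_def)
qed

section \<open>The circular weight\<close>

lemma DERIV_chord_powr:
  assumes "cos t \<noteq> 1"
  shows "((\<lambda>t. (2 - 2 * cos t) powr g) has_real_derivative g * sin t / (1 - cos t) * (2 - 2 * cos t) powr g) (at t)"
proof -
  have pos: "2 - 2 * cos t > 0" using assms cos_le_one[of t] by linarith
  have D: "((\<lambda>t. (2 - 2 * cos t) powr g) has_real_derivative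
      (2 - 2 * cos t) powr g * (0 * ln (2 - 2 * cos t) + (2 * sin t) * g / (2 - 2 * cos t))) (at t)"
    using pos by (intro DERIV_powr) (auto intro!: derivative_eq_intros)
  have X: "(2 * sin t) * g / (2 - 2 * cos t) = g * sin t / (1 - cos t)"
    using pos by (simp add: field_simps)
  have eq: "(2 - 2 * cos t) powr g * (0 * ln (2 - 2 * cos t) + (2 * sin t) * g / (2 - 2 * cos t)) =
      g * sin t / (1 - cos t) * (2 - 2 * cos t) powr g"
    unfolding X by (simp only: mult_zero_left add_0 mult.commute)
  show ?thesis using D unfolding eq .
qed

text \<open>
  The kernel is the modulus of the derivative of \<open>(2 - 2 * cos t) powr g\<close>. This function increases
  from 0 to \<open>4 powr g\<close> on \<open>{0..pi}\<close> and decreases back to 0 on \<open>{pi..2 * pi}\<close>, so the integral is its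
  total variation. The singularities at both ends are thus covered for all \<open>g > 0\<close>.
\<close>

lemma chord_kernel_has_integral:
  assumes g: "0 < g"
  shows "((\<lambda>t. \<bar>g * sin t / (1 - cos t)\<bar> * (2 - 2 * cos t) powr g) has_integral 2 * 4 powr g) {0..2 * pi}"
proof -
  let ?F = "\<lambda>t::real. (2 - 2 * cos t) powr g"
  let ?k = "\<lambda>t. \<bar>g * sin t / (1 - cos t)\<bar> * ?F t"
  have cont: "continuous_on A ?F" for A
    using g by (intro continuous_on_powr' continuous_intros) auto
  have not1: "cos t \<noteq> 1" if "t \<in> {0<..<2 * pi}" for t
  proof
    assume "cos t = 1"
    then obtain m :: int where m: "t = of_int m * 2 * pi" unfolding cos_one_2pi_int by blast
    then have "0 < of_int m * (2 * pi)" "of_int m * (2 * pi) < 1 * (2 * pi)" using that by (auto simp: mult_ac)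
    then have "0 < (of_int m :: real)" "(of_int m :: real) < 1"
      by (simp_all add: zero_less_mult_iff mult_less_cancel_right_disj)
    then show False by simp
  qed
  have 1: "(?k has_integral (?F pi - ?F 0)) {0..pi}"
  proof (rule fundamental_theorem_of_calculus_interior)
    fix t :: real assume t: "t \<in> {0<..<pi}"
    then have "0 < sin t" by (intro sin_gt_zero) auto
    then have eq: "?k t = g * sin t / (1 - cos t) * ?F t" using g cos_le_one[of t] by simp
    show "(?F has_vector_derivative ?k t) (at t)"
      unfolding eq has_real_derivative_iff_has_vector_derivative[symmetric]
      using t by (intro DERIV_chord_powr not1) auto
  qed (auto intro: cont)
  have 2: "(?k has_integral ((- ?F (2 * pi)) - (- ?F pi))) {pi..2 * pi}"
  proof (rule fundamental_theorem_of_calculus_interior)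
    fix t :: real assume t: "t \<in> {pi<..<2 * pi}"
    then have "sin t < 0" by (intro sin_lt_zero) auto
    then have np: "g * sin t / (1 - cos t) \<le> 0" using g cos_le_one[of t]
      by (intro divide_nonpos_nonneg mult_nonneg_nonpos) auto
    have eq: "?k t = - (g * sin t / (1 - cos t) * ?F t)"
      by (simp only: abs_of_nonpos[OF np] mult_minus_left)
    show "((\<lambda>t. - ?F t) has_vector_derivative ?k t) (at t)"
      unfolding eq has_real_derivative_iff_has_vector_derivative[symmetric]
      using t by (intro DERIV_minus DERIV_chord_powr not1) auto
  qed (auto intro!: continuous_on_minus cont)
  have "(?k has_integral ((?F pi - ?F 0) + ((- ?F (2 * pi)) - (- ?F pi)))) {0..2 * pi}"
    by (rule has_integral_combine[OF _ _ 1 2]) auto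
  moreover have "(?F pi - ?F 0) + ((- ?F (2 * pi)) - (- ?F pi)) = 2 * 4 powr g" using g by simp
  ultimately show ?thesis by (simp only:)
qed

text \<open>
  Dividing by \<open>1 - cos (x - y)\<close> shows that \<open>cis x - cis y\<close> times the cotangent of half the angle
  between the points is \<open>\<i> * (cis x + cis y)\<close>: the pole of the cotangent cancels.
\<close>

lemma chord_flux_exchange:
  "(cis x - cis y) * of_real (sin (x - y)) = \<i> * (cis x + cis y) * of_real (1 - cos (x - y))"
proof -
  define t where "t = x - y"
  have x: "cis x = cis y * cis t" by (simp add: t_def cis_mult)
  have "(cis t - 1) * of_real (sin t) = \<i> * (cis t + 1) * of_real (1 - cos t)"
    by (auto simp: complex_eq_iff algebra_simps)
  then have "cis y * ((cis t - 1) * of_real (sin t)) = cis y * (\<i> * (cis t + 1) * of_real (1 - cos t))"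
    by (simp only:)
  then show ?thesis unfolding x t_def[symmetric] by (simp add: algebra_simps)
qed

text \<open>
  On \<open>{-pi..pi}\<close> this is the integrand \<open>z ^ p * cnj z ^ r\<close> of the mixed moments at
  \<open>z = 1 - c * cis x\<close>, where \<open>c\<close> absorbs the angle \<open>\<theta>\<close>.
\<close>

definition circular_weight :: "complex \<Rightarrow> nat \<Rightarrow> nat \<Rightarrow> real \<Rightarrow> complex" where
  "circular_weight c p r x = of_real (indicator {-pi..pi} x) * ((1 - c * cis x) ^ p * cnj (1 - c * cis x) ^ r)"

lemma circular_weight_measurable [measurable]: "circular_weight c p r \<in> borel_measurable borel"
proof -
  have [measurable]: "(\<lambda>x. (1 - c * cis x) ^ p * cnj (1 - c * cis x) ^ r) \<in> borel_measurable borel"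
    by (intro borel_measurable_continuous_onI continuous_intros)
  show ?thesis unfolding circular_weight_def by measurable
qed

text \<open>
  On the unit circle \<open>w = 1 - c * cis x\<close> satisfies \<open>w * cnj w = w + cnj w\<close>. This makes the
  logarithmic derivative of the flux, multiplied by \<open>w\<close>, a linear function of \<open>w\<close>.
\<close>

lemma circular_flux_deriv:
  assumes c: "norm c = 1"
  shows "((\<lambda>x. (1 - c * cis x) ^ Suc p * cnj (1 - c * cis x) ^ r) has_vector_derivative
    (- \<i> * of_nat (p + 1 + r) - - \<i> * of_nat (p + 1) * (1 - c * cis x)) * ((1 - c * cis x) ^ p * cnj (1 - c * cis x) ^ r)) (at x)"
proof -
  define w where "w = 1 - c * cis x"
  have u: "(c * cis x) * cnj (c * cis x) = 1"
    unfolding complex_norm_square[symmetric] using c by (simp add: norm_mult)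
  have w: "w - w * cnj w = - cnj w"
    using u by (simp add: w_def algebra_simps)
  have cis': "((\<lambda>x. cis x) has_vector_derivative \<i> * cis x) (at x)"
    unfolding has_vector_derivative_def using has_derivative_cis[OF has_derivative_ident, of x UNIV] by simp
  have dw: "((\<lambda>x. 1 - c * cis x) has_vector_derivative \<i> * (w - 1)) (at x)"
  proof -
    have "((\<lambda>x. 1 - c * cis x) has_vector_derivative 0 - c * (\<i> * cis x)) (at x)"
      by (intro has_vector_derivative_diff has_vector_derivative_const has_vector_derivative_mult_right cis')
    moreover have "0 - c * (\<i> * cis x) = \<i> * (w - 1)" by (simp add: w_def)
    ultimately show ?thesis by (simp only:)
  qed
  have dcw: "((\<lambda>x. cnj (1 - c * cis x)) has_vector_derivative - \<i> * (cnj w - 1)) (at x)"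
    using has_vector_derivative_cnj[OF dw] by simp
  have pow: "((\<lambda>x. f x ^ m) has_vector_derivative of_nat m * f x ^ (m - 1) * f') (at x)"
    if "(f has_vector_derivative f') (at x)" for f :: "real \<Rightarrow> complex" and f' m
    using field_vector_diff_chain_at[OF that DERIV_power[OF DERIV_ident, of m]] by (simp add: o_def mult_ac)
  have D: "((\<lambda>x. (1 - c * cis x) ^ Suc p * cnj (1 - c * cis x) ^ r) has_vector_derivative
     w ^ Suc p * (of_nat r * cnj w ^ (r - 1) * (- \<i> * (cnj w - 1))) +
     (of_nat (Suc p) * w ^ p * (\<i> * (w - 1))) * cnj w ^ r) (at x)"
    using has_vector_derivative_mult[OF pow[OF dw, of "Suc p"] pow[OF dcw, of r]] by (simp add: w_def)
  have E: "w ^ Suc p * (of_nat r * cnj w ^ (r - 1) * (- \<i> * (cnj w - 1))) = - \<i> * of_nat r * w ^ p * cnj w ^ r"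
  proof (cases r)
    case (Suc m)
    have "w ^ Suc p * (of_nat r * cnj w ^ (r - 1) * (- \<i> * (cnj w - 1))) =
        \<i> * of_nat r * w ^ p * cnj w ^ m * (w - w * cnj w)"
      by (simp add: Suc algebra_simps)
    also have "\<dots> = - \<i> * of_nat r * w ^ p * cnj w ^ r" unfolding w by (simp add: Suc)
    finally show ?thesis .
  qed simp
  have eq: "w ^ Suc p * (of_nat r * cnj w ^ (r - 1) * (- \<i> * (cnj w - 1))) + (of_nat (Suc p) * w ^ p * (\<i> * (w - 1))) * cnj w ^ r =
      (- \<i> * of_nat (p + 1 + r) - - \<i> * of_nat (p + 1) * w) * (w ^ p * cnj w ^ r)"
    unfolding E by (simp add: algebra_simps)
  show ?thesis using D unfolding eq unfolding w_def .
qed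

lemma circular_singular:
  assumes c: "norm c = 1" and g: "0 < g"
  shows "\<exists>K<\<infinity>. \<forall>y\<in>{-pi..pi}. (\<integral>\<^sup>+x. ennreal (norm ((1 - c * cis x) * circular_weight c p r x) *
    (\<bar>g * sin (x - y) / (1 - cos (x - y))\<bar> * (2 - 2 * cos (x - y)) powr g)) \<partial>lborel) \<le> K"
proof (rule flux_kernel_bound[where k = "\<lambda>t. \<bar>g * sin t / (1 - cos t)\<bar> * (2 - 2 * cos t) powr g" and B = "2 ^ (Suc p + r)"])
  show "((\<lambda>t. \<bar>g * sin t / (1 - cos t)\<bar> * (2 - 2 * cos t) powr g) has_integral 2 * 4 powr g) {0..pi - - pi}"
    using chord_kernel_has_integral[OF g] by simp
  fix x assume x: "x \<in> {-pi..pi}"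
  have "norm (1 - c * cis x) \<le> 2"
    using norm_triangle_ineq4[of 1 "c * cis x"] c by (simp add: norm_mult)
  then have "norm (1 - c * cis x) ^ (Suc p + r) \<le> 2 ^ (Suc p + r)" by (intro power_mono) auto
  moreover have "circular_weight c p r x = (1 - c * cis x) ^ p * cnj (1 - c * cis x) ^ r"
    using x by (simp add: circular_weight_def)
  ultimately show "norm ((1 - c * cis x) * circular_weight c p r x) \<le> 2 ^ (Suc p + r)"
    by (simp only: norm_mult norm_power complex_mod_cnj power_add power_Suc mult.assoc)
qed (auto simp: circular_weight_def)

lemma chord_zeros_finite: "finite {x \<in> {-pi..pi}. (2 - 2 * cos (x - y)) powr g = 0}" if y: "y \<in> {-pi..pi}"
proof (rule finite_subset)
  show "{x \<in> {-pi..pi}. (2 - 2 * cos (x - y)) powr g = 0} \<subseteq> (\<lambda>m::int. y + of_int m * 2 * pi) ` {-1..1}"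
  proof
    fix x assume x: "x \<in> {x \<in> {-pi..pi}. (2 - 2 * cos (x - y)) powr g = 0}"
    then have "(2 - 2 * cos (x - y)) powr g = 0" by (simp only: mem_Collect_eq)
    then have "2 - 2 * cos (x - y) = 0" by (simp only: powr_eq_0_iff)
    then have "cos (x - y) = 1" by linarith
    then obtain m :: int where m: "x - y = of_int m * 2 * pi" unfolding cos_one_2pi_int by blast
    have eq: "of_int m * (2 * pi) = x - y" using m by (simp only: mult.assoc)
    have "of_int m * (2 * pi) \<le> 1 * (2 * pi)" unfolding eq using x y by simp
    then have 1: "(of_int m :: real) \<le> 1" by (rule mult_right_le_imp_le) simp
    have "-1 * (2 * pi) \<le> of_int m * (2 * pi)" unfolding eq using x y by simp
    then have 2: "-1 \<le> (of_int m :: real)" by (rule mult_right_le_imp_le) simp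
    from 1 2 have "m \<in> {-1..1}" by auto
    then show "x \<in> (\<lambda>m::int. y + of_int m * 2 * pi) ` {-1..1}"
      using m by (intro image_eqI[of _ _ m]) auto
  qed
qed simp

text \<open>
  The boundary terms cancel by periodicity. Since \<open>\<rho> = q\<close>, the expression
  \<open>\<rho> x * q y - \<rho> y * q x\<close> is zero, and \<open>(\<rho> x - \<rho> y) * \<kappa>\<close> is computed by \<open>chord_flux_exchange\<close>.
\<close>

lemma pair_gas_circular:
  assumes c: "norm c = 1" and g: "0 < g"
  shows "pair_gas (-pi) pi (circular_weight c p r) (\<lambda>x. 1 - c * cis x) (\<lambda>x. 1 - c * cis x)
    (\<lambda>x y. (2 - 2 * cos (x - y)) powr g) (\<lambda>x y. g * sin (x - y) / (1 - cos (x - y)))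
    (- \<i> * of_nat (p + 1 + r)) (- \<i> * of_nat (p + 1)) 0 (- \<i> * of_real g) (- \<i> * of_real g)"
proof -
  let ?w = "\<lambda>x. 1 - c * cis x" and ?h = "circular_weight c p r"
  let ?d = "\<lambda>x y. (2 - 2 * cos (x - y)) powr g" and ?k = "\<lambda>x y. g * sin (x - y) / (1 - cos (x - y))"
  have flux: "?w x * ?h x = ?w x ^ Suc p * cnj (?w x) ^ r"
    if "x \<in> {-pi..pi}" for x
    using that by (simp add: circular_weight_def)
  show ?thesis
  proof
    show "- pi < pi" by simp
    show "integrable lborel (circular_weight c p r)"
    proof -
      have "integrable lborel (\<lambda>x. indicator {-pi..pi} x *\<^sub>R (?w x ^ p * cnj (?w x) ^ r))"
        by (intro borel_integrable_compact continuous_intros) auto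
      then show ?thesis unfolding circular_weight_def[abs_def] scaleR_conv_of_real .
    qed
    show "(\<lambda>x. 1 - c * cis x) \<in> borel_measurable borel"
      by (intro borel_measurable_continuous_onI continuous_intros)
    show "\<exists>B. \<forall>x\<in>{-pi..pi}. norm (?w x) \<le> B"
    proof (intro exI[of _ 2] ballI)
      fix x show "norm (?w x) \<le> 2"
        using norm_triangle_ineq4[of 1 "c * cis x"] c by (simp add: norm_mult)
    qed
    show "\<exists>B. \<forall>x\<in>{-pi..pi}. \<forall>y\<in>{-pi..pi}. ?d x y \<le> B"
    proof (intro exI[of _ "4 powr g"] ballI)
      fix x y show "?d x y \<le> 4 powr g"
        using g cos_ge_minus_one[of "x - y"] cos_le_one[of "x - y"] by (intro powr_mono2) linarith+
    qed
    show "?d x y = ?d y x" for x y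
      by (metis cos_minus minus_diff_eq)
    show "continuous_on {-pi..pi} (\<lambda>x. ?d x y)" for y
      using g by (intro continuous_on_powr' continuous_intros) auto
    show "finite {x \<in> {-pi..pi}. ?d x y = 0}" if "y \<in> {-pi..pi}" for y
      using that by (rule chord_zeros_finite)
    show "((\<lambda>x. ?d x y) has_real_derivative
        ?k x y * ?d x y) (at x)"
      if nz: "?d x y \<noteq> 0" for x y
    proof -
      have "cos (x - y) \<noteq> 1" using nz by auto
      moreover have "((\<lambda>x. x - y) has_real_derivative 1) (at x)"
        by (auto intro!: derivative_eq_intros)
      ultimately show ?thesis
        using DERIV_chain2[where f = "\<lambda>t. (2 - 2 * cos t) powr g" and g = "\<lambda>x. x - y", OF DERIV_chord_powr]
        by fastforce
    qed
    show "?k y x = - (?k x y)" for x y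
      using sin_minus[of "x - y"] cos_minus[of "x - y"] by simp
    show "continuous_on {-pi..pi} (\<lambda>x. ?w x * ?h x)"
      by (subst continuous_on_cong[OF refl flux]) (assumption, intro continuous_intros)
    show "((\<lambda>x. ?w x * ?h x) has_vector_derivative
        (- \<i> * of_nat (p + 1 + r) - - \<i> * of_nat (p + 1) * ?w x) * ?h x) (at x)"
      if x: "x \<in> {-pi<..<pi}" for x
    proof -
      have "?h x = ?w x ^ p * cnj (?w x) ^ r"
        using x by (simp add: circular_weight_def)
      with circular_flux_deriv[OF c, of p r x]
      have "((\<lambda>x. ?w x ^ Suc p * cnj (?w x) ^ r) has_vector_derivative
        (- \<i> * of_nat (p + 1 + r) - - \<i> * of_nat (p + 1) * ?w x) * ?h x) (at x)"
        by (simp only:)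
      then show ?thesis
      proof (rule has_vector_derivative_transform_within_open[where S = "{-pi<..<pi}"])
        fix y assume "y \<in> {-pi<..<pi}"
        then show "?w y ^ Suc p * cnj (?w y) ^ r = ?w y * ?h y"
          by (intro flux[symmetric]) auto
      qed (use x in auto)
    qed
    show "(1 - c * cis (- pi)) * circular_weight c p r (- pi) = 0 \<and> (1 - c * cis pi) * circular_weight c p r pi = 0 \<or>
      (1 - c * cis (- pi)) * circular_weight c p r (- pi) = (1 - c * cis pi) * circular_weight c p r pi \<and>
      (\<forall>y\<in>{-pi..pi}. (2 - 2 * cos (- pi - y)) powr g = (2 - 2 * cos (pi - y)) powr g)"
    proof -
      have 1: "cis (- pi) = cis pi" by (simp add: complex_eq_iff)
      have "cos (- pi - y) = cos (pi - y)" for y by (simp add: cos_diff)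
      then show ?thesis by (simp add: 1 circular_weight_def)
    qed
    show "\<exists>K<\<infinity>. \<forall>y\<in>{-pi..pi}. (\<integral>\<^sup>+x. ennreal (norm (?w x * ?h x) *
      (\<bar>?k x y\<bar> * ?d x y)) \<partial>lborel) \<le> K"
      by (rule circular_singular[OF c g])
    fix x y :: real assume "?d x y \<noteq> 0"
    then have nz: "complex_of_real (1 - cos (x - y)) \<noteq> 0" by auto
    have "(?w x - ?w y) * of_real (?k x y) =
      - c * of_real g * ((cis x - cis y) * of_real (sin (x - y)) / of_real (1 - cos (x - y)))"
      by (simp add: algebra_simps diff_divide_distrib)
    also have "\<dots> = - c * of_real g * (\<i> * (cis x + cis y))"
      unfolding chord_flux_exchange using nz by simp
    also have "\<dots> = 2 * (- \<i> * of_real g) - (- \<i> * of_real g) * (?w x + ?w y)"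
      by (simp add: algebra_simps)
    finally show "(?w x - ?w y) * of_real (?k x y) =
      2 * (- \<i> * of_real g) - (- \<i> * of_real g) * (?w x + ?w y)" .
  qed (auto simp: circular_weight_def)
qed

section \<open>Laws determined by their moments\<close>

lemma monomial_measurable [measurable]: "(\<lambda>z::complex. z ^ p * cnj z ^ r) \<in> borel_measurable borel"
  by (intro borel_measurable_continuous_onI continuous_intros)

definition law_on_disc :: "real \<Rightarrow> complex measure \<Rightarrow> bool" where
  "law_on_disc R \<mu> \<longleftrightarrow> prob_space \<mu> \<and> sets \<mu> = sets borel \<and> (AE z in \<mu>. norm z \<le> R)"

lemma law_on_discD:
  assumes "law_on_disc R \<mu>"
  shows "prob_space \<mu>" "sets \<mu> = sets borel" "AE z in \<mu>. norm z \<le> R"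
  using assms by (simp_all add: law_on_disc_def)

lemma integrable_continuous_on_disc:
  fixes \<mu> :: "complex measure" and g :: "complex \<Rightarrow> complex"
  assumes \<mu>: "law_on_disc R \<mu>" and g: "continuous_on UNIV g"
  shows "integrable \<mu> g"
proof -
  interpret prob_space \<mu> by (rule law_on_discD(1)[OF \<mu>])
  have "bounded (g ` cball 0 R)"
    using g by (intro compact_imp_bounded compact_continuous_image) (auto intro: continuous_on_subset)
  then obtain B where B': "\<forall>y\<in>g ` cball 0 R. norm y \<le> B"
    unfolding bounded_iff by blast
  have B: "norm (g z) \<le> B" if "norm z \<le> R" for z
    using B' that by simp
  have "g \<in> borel_measurable \<mu>"
    using borel_measurable_continuous_onI[OF g] law_on_discD(2)[OF \<mu>] by (simp cong: measurable_cong_sets)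
  then show ?thesis
    using law_on_discD(3)[OF \<mu>] by (intro integrable_const_bound[where B = B]) (auto elim!: eventually_mono intro: B)
qed

text \<open>
  The statement carries an additional factor \<open>g\<close> with equal moments, so that for a product of two
  polynomials the induction hypotheses can be applied one after the other. A linear function is a
  combination of \<open>z\<close> and \<open>cnj z\<close> and only shifts the exponents.
\<close>

lemma integral_real_polynomial_times:
  fixes \<mu> \<nu> :: "complex measure"
  assumes \<mu>: "law_on_disc R \<mu>"
    and \<nu>: "law_on_disc R \<nu>"
    and f: "real_polynomial_function f"
    and g: "continuous_on UNIV g" "\<And>p r. (\<integral>z. g z * (z ^ p * cnj z ^ r) \<partial>\<mu>) = (\<integral>z. g z * (z ^ p * cnj z ^ r) \<partial>\<nu>)"
  shows "(\<integral>z. of_real (f z) * g z * (z ^ p * cnj z ^ r) \<partial>\<mu>) = (\<integral>z. of_real (f z) * g z * (z ^ p * cnj z ^ r) \<partial>\<nu>)"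
  using f g
proof (induction f arbitrary: g p r rule: real_polynomial_function.induct)
  case (linear f)
  define a b where "a = (of_real (f 1) - \<i> * of_real (f \<i>)) / 2" and "b = (of_real (f 1) + \<i> * of_real (f \<i>)) / 2"
  have f: "complex_of_real (f z) = a * z + b * cnj z" for z
  proof -
    interpret bounded_linear f by fact
    have "f z = f (Re z *\<^sub>R 1 + Im z *\<^sub>R \<i>)"
      by (intro arg_cong[where f = f]) (simp add: complex_eq_iff)
    also have "\<dots> = Re z * f 1 + Im z * f \<i>" by (simp only: add scaleR real_scaleR_def)
    finally show ?thesis by (simp add: a_def b_def complex_eq_iff field_simps)
  qed
  have "(\<integral>z. of_real (f z) * g z * (z ^ p * cnj z ^ r) \<partial>\<xi>) =
      a * (\<integral>z. g z * (z ^ Suc p * cnj z ^ r) \<partial>\<xi>) + b * (\<integral>z. g z * (z ^ p * cnj z ^ Suc r) \<partial>\<xi>)"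
    if \<xi>: "law_on_disc R \<xi>" for \<xi>
  proof -
    have int: "integrable \<xi> (\<lambda>z. g z * (z ^ i * cnj z ^ j))" for i j
      using linear.prems(1) by (intro integrable_continuous_on_disc[OF \<xi>] continuous_intros)
    have "(\<integral>z. of_real (f z) * g z * (z ^ p * cnj z ^ r) \<partial>\<xi>) =
        (\<integral>z. a * (g z * (z ^ Suc p * cnj z ^ r)) + b * (g z * (z ^ p * cnj z ^ Suc r)) \<partial>\<xi>)"
      unfolding f by (intro Bochner_Integration.integral_cong refl) (simp add: algebra_simps)
    also have "\<dots> = a * (\<integral>z. g z * (z ^ Suc p * cnj z ^ r) \<partial>\<xi>) + b * (\<integral>z. g z * (z ^ p * cnj z ^ Suc r) \<partial>\<xi>)"
      by (simp only: Bochner_Integration.integral_add integrable_mult_right int integral_mult_right_zero)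
    finally show ?thesis .
  qed
  from this[OF \<mu>] this[OF \<nu>] show ?case by (simp only: linear.prems(2))
next
  case (const c)
  then show ?case by (simp only: mult.assoc integral_mult_right_zero)
next
  case (add f1 f2)
  have c: "continuous_on UNIV f1" "continuous_on UNIV f2"
    using add.hyps by (auto intro: continuous_on_polymonial_function simp: real_polynomial_function_eq)
  have "(\<integral>z. of_real (f1 z + f2 z) * g z * (z ^ p * cnj z ^ r) \<partial>\<xi>) =
      (\<integral>z. of_real (f1 z) * g z * (z ^ p * cnj z ^ r) \<partial>\<xi>) + (\<integral>z. of_real (f2 z) * g z * (z ^ p * cnj z ^ r) \<partial>\<xi>)"
    if \<xi>: "law_on_disc R \<xi>" for \<xi>
  proof -
    have int: "integrable \<xi> (\<lambda>z. of_real (f1 z) * g z * (z ^ p * cnj z ^ r))" "integrable \<xi> (\<lambda>z. of_real (f2 z) * g z * (z ^ p * cnj z ^ r))"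
      using add.prems(1) c by (intro integrable_continuous_on_disc[OF \<xi>] continuous_intros; simp)+
    show ?thesis
      by (simp only: of_real_add distrib_right Bochner_Integration.integral_add int)
  qed
  from this[OF \<mu>] this[OF \<nu>] show ?case by (simp only: add.IH[OF add.prems])
next
  case (mult f1 f2)
  have c: "continuous_on UNIV f2"
    using mult.hyps by (auto intro: continuous_on_polymonial_function simp: real_polynomial_function_eq)
  have "(\<integral>z. of_real (f1 z) * (of_real (f2 z) * g z) * (z ^ p * cnj z ^ r) \<partial>\<mu>) =
    (\<integral>z. of_real (f1 z) * (of_real (f2 z) * g z) * (z ^ p * cnj z ^ r) \<partial>\<nu>)"
    using mult.prems(1) c by (intro mult.IH(1) continuous_intros mult.IH(2)[OF mult.prems]) auto
  then show ?case by (simp only: of_real_mult mult.assoc)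
qed

lemma integral_continuous_eq_of_moments:
  fixes \<mu> \<nu> :: "complex measure" and f :: "complex \<Rightarrow> real"
  assumes \<mu>: "law_on_disc R \<mu>"
    and \<nu>: "law_on_disc R \<nu>"
    and moments: "\<And>p r. (\<integral>z. z ^ p * cnj z ^ r \<partial>\<mu>) = (\<integral>z. z ^ p * cnj z ^ r \<partial>\<nu>)"
    and f: "continuous_on UNIV f"
  shows "(\<integral>z. complex_of_real (f z) \<partial>\<mu>) = (\<integral>z. complex_of_real (f z) \<partial>\<nu>)"
proof -
  let ?f = "\<lambda>z. complex_of_real (f z)"
  have "norm ((\<integral>z. ?f z \<partial>\<mu>) - (\<integral>z. ?f z \<partial>\<nu>)) \<le> e" if e: "0 < e" for e
  proof -
    obtain g where g: "real_polynomial_function g" "\<And>z. z \<in> cball 0 R \<Longrightarrow> \<bar>f z - g z\<bar> < e / 2"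
      using Stone_Weierstrass_real_polynomial_function[of "cball 0 R" f "e / 2"] f e
      by (metis compact_cball continuous_on_subset half_gt_zero subset_UNIV)
    have cg: "continuous_on UNIV g"
      using g(1) by (auto intro: continuous_on_polymonial_function simp: real_polynomial_function_eq)
    have *: "norm ((\<integral>z. ?f z \<partial>\<xi>) - (\<integral>z. complex_of_real (g z) \<partial>\<xi>)) \<le> e / 2"
      if \<xi>: "law_on_disc R \<xi>" for \<xi>
    proof -
      interpret prob_space \<xi> by (rule law_on_discD(1)[OF \<xi>])
      have i: "integrable \<xi> ?f" "integrable \<xi> (\<lambda>z. complex_of_real (g z))"
        using f cg by (intro integrable_continuous_on_disc[OF \<xi>] continuous_intros; simp)+
      have "norm ((\<integral>z. ?f z \<partial>\<xi>) - (\<integral>z. complex_of_real (g z) \<partial>\<xi>)) =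
          norm (\<integral>z. ?f z - complex_of_real (g z) \<partial>\<xi>)"
        using i by simp
      also have "\<dots> \<le> (\<integral>z. norm (?f z - complex_of_real (g z)) \<partial>\<xi>)"
        by (rule integral_norm_bound)
      also have "\<dots> \<le> (\<integral>z. e / 2 \<partial>\<xi>)"
      proof (rule integral_mono_AE)
        show "AE z in \<xi>. norm (?f z - complex_of_real (g z)) \<le> e / 2"
          using law_on_discD(3)[OF \<xi>]
        proof eventually_elim
          case (elim z)
          have "norm (?f z - complex_of_real (g z)) = \<bar>f z - g z\<bar>"
            by (metis norm_of_real of_real_diff real_norm_def)
          then show ?case using g(2)[of z] elim by simp
        qed
      qed (use i in auto)
      also have "\<dots> = e / 2" by (simp add: prob_space)
      finally show ?thesis .
    qed
    have "(\<integral>z. complex_of_real (g z) \<partial>\<mu>) = (\<integral>z. complex_of_real (g z) \<partial>\<nu>)"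
      using integral_real_polynomial_times[OF \<mu> \<nu> g(1), of "\<lambda>_. 1" 0 0] moments by simp
    moreover note *[OF \<mu>] *[OF \<nu>]
    ultimately show ?thesis
      using norm_triangle_ineq4[of "(\<integral>z. ?f z \<partial>\<mu>) - (\<integral>z. complex_of_real (g z) \<partial>\<mu>)"
         "(\<integral>z. ?f z \<partial>\<nu>) - (\<integral>z. complex_of_real (g z) \<partial>\<nu>)"] by simp
  qed
  then have "norm ((\<integral>z. ?f z \<partial>\<mu>) - (\<integral>z. ?f z \<partial>\<nu>)) \<le> 0"
    by (rule field_le_epsilon[of _ 0, simplified])
  then show ?thesis by simp
qed

lemma integral_infdist_tendsto_measure:
  fixes \<xi> :: "complex measure"
  assumes \<xi>: "law_on_disc R \<xi>" and C: "closed C" "C \<noteq> {}"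
  shows "(\<lambda>n. \<integral>z. complex_of_real (max 0 (1 - real n * infdist z C)) \<partial>\<xi>) \<longlonglongrightarrow> of_real (measure \<xi> C)"
proof -
  let ?F = "\<lambda>n z. max 0 (1 - real n * infdist z C)"
  interpret prob_space \<xi> by (rule law_on_discD(1)[OF \<xi>])
  have C': "C \<in> sets \<xi>" using C law_on_discD(2)[OF \<xi>] by simp
  have "(\<lambda>n. \<integral>z. complex_of_real (?F n z) \<partial>\<xi>) \<longlonglongrightarrow> (\<integral>z. complex_of_real (indicator C z) \<partial>\<xi>)"
  proof (rule integral_dominated_convergence[where w = "\<lambda>_. 1"])
    show "(\<lambda>z. complex_of_real (indicator C z)) \<in> borel_measurable \<xi>" using C' by measurable
    show "(\<lambda>z. complex_of_real (?F n z)) \<in> borel_measurable \<xi>" for n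
    proof -
      have "(\<lambda>z. complex_of_real (?F n z)) \<in> borel_measurable borel"
        by (intro borel_measurable_continuous_onI continuous_intros)
      then show ?thesis using law_on_discD(2)[OF \<xi>] by (simp cong: measurable_cong_sets)
    qed
    show "AE z in \<xi>. (\<lambda>n. complex_of_real (?F n z)) \<longlonglongrightarrow> complex_of_real (indicator C z)"
    proof (rule AE_I2, rule tendsto_of_real)
      fix z
      show "(\<lambda>n. ?F n z) \<longlonglongrightarrow> indicator C z"
      proof (cases "z \<in> C")
        case False
        then have pos: "0 < infdist z C"
          using C in_closed_iff_infdist_zero[of C z] infdist_nonneg[of z C] by force
        obtain N where N: "1 / infdist z C < real N" using reals_Archimedean2 by blast
        have "\<forall>\<^sub>F n in sequentially. ?F n z = 0"
        proof (rule eventually_sequentiallyI)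
          fix n assume "N \<le> n"
          then have "1 / infdist z C < real n" using N by simp
          then have "1 < real n * infdist z C" using pos by (simp add: field_simps)
          then show "?F n z = 0" by simp
        qed
        then show ?thesis using False by (simp add: tendsto_eventually)
      qed simp
    qed
    show "AE z in \<xi>. norm (complex_of_real (?F n z)) \<le> 1" for n
      by (intro AE_I2) (simp add: norm_of_real infdist_nonneg max_def)
  qed auto
  also have "(\<integral>z. complex_of_real (indicator C z) \<partial>\<xi>) = of_real (measure \<xi> C)"
    using C' by simp
  finally show ?thesis .
qed

text \<open>
  Integrals of continuous functions agree by uniform approximation with polynomials on the disc that
  carries both measures; the measure of a closed set is a limit of such integrals.
\<close>

lemma measure_eq_of_moments:
  fixes \<mu> \<nu> :: "complex measure"
  assumes \<mu>: "law_on_disc R \<mu>"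
    and \<nu>: "law_on_disc R \<nu>"
    and moments: "\<And>p r. (\<integral>z. z ^ p * cnj z ^ r \<partial>\<mu>) = (\<integral>z. z ^ p * cnj z ^ r \<partial>\<nu>)"
  shows "\<mu> = \<nu>"
proof (rule measure_eqI_generator_eq[where E = "Collect closed" and \<Omega> = UNIV and A = "\<lambda>_. UNIV"])
  interpret \<mu>: prob_space \<mu> by (rule law_on_discD(1)[OF \<mu>])
  interpret \<nu>: prob_space \<nu> by (rule law_on_discD(1)[OF \<nu>])
  show "emeasure \<mu> C = emeasure \<nu> C" if "C \<in> Collect closed" for C
  proof (cases "C = {}")
    case False
    have "(\<integral>z. complex_of_real (max 0 (1 - real n * infdist z C)) \<partial>\<mu>) = (\<integral>z. complex_of_real (max 0 (1 - real n * infdist z C)) \<partial>\<nu>)" for n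
      by (intro integral_continuous_eq_of_moments[OF \<mu> \<nu> moments] continuous_intros)
    moreover have "(\<lambda>n. \<integral>z. complex_of_real (max 0 (1 - real n * infdist z C)) \<partial>\<mu>) \<longlonglongrightarrow> of_real (measure \<mu> C)"
      "(\<lambda>n. \<integral>z. complex_of_real (max 0 (1 - real n * infdist z C)) \<partial>\<nu>) \<longlonglongrightarrow> of_real (measure \<nu> C)"
      using that False by (simp_all only: mem_Collect_eq integral_infdist_tendsto_measure[OF \<mu>]
        integral_infdist_tendsto_measure[OF \<nu>] not_False_eq_True)
    ultimately have "complex_of_real (measure \<mu> C) = of_real (measure \<nu> C)"
      by (simp only: LIMSEQ_unique)
    then show ?thesis by (simp add: \<mu>.emeasure_eq_measure \<nu>.emeasure_eq_measure)
  qed simp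
  show "sets \<mu> = sigma_sets UNIV (Collect closed)" "sets \<nu> = sigma_sets UNIV (Collect closed)"
    unfolding law_on_discD(2)[OF \<mu>] law_on_discD(2)[OF \<nu>] borel_eq_closed by auto
  show "emeasure \<mu> UNIV \<noteq> \<infinity>" by simp
qed (auto simp: Int_stable_def)

lemma distr_eq_of_moments:
  fixes X :: "'a \<Rightarrow> complex" and Y :: "'b \<Rightarrow> complex"
  assumes M: "prob_space M" and N: "prob_space N"
    and X [measurable]: "X \<in> borel_measurable M" and Y [measurable]: "Y \<in> borel_measurable N"
    and bdX: "AE \<omega> in M. norm (X \<omega>) \<le> R" and bdY: "AE \<omega> in N. norm (Y \<omega>) \<le> R"
    and moments: "\<And>p r. (\<integral>\<omega>. X \<omega> ^ p * cnj (X \<omega>) ^ r \<partial>M) = (\<integral>\<omega>. Y \<omega> ^ p * cnj (Y \<omega>) ^ r \<partial>N)"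
  shows "distr M borel X = distr N borel Y"
proof (rule measure_eq_of_moments)
  show "(\<integral>z. z ^ p * cnj z ^ r \<partial>distr M borel X) = (\<integral>z. z ^ p * cnj z ^ r \<partial>distr N borel Y)" for p r
    using moments[of p r] by (simp add: integral_distr)
  show "law_on_disc R (distr M borel X)" "law_on_disc R (distr N borel Y)"
    using bdX bdY by (auto simp: law_on_disc_def AE_distr_iff intro: prob_space.prob_space_distr M N)
qed

lemma distr_eq_of_real_moments:
  fixes X :: "'a \<Rightarrow> real" and Y :: "'b \<Rightarrow> real"
  assumes M: "prob_space M" and N: "prob_space N"
    and X [measurable]: "X \<in> borel_measurable M" and Y [measurable]: "Y \<in> borel_measurable N"
    and bdX: "AE \<omega> in M. \<bar>X \<omega>\<bar> \<le> R" and bdY: "AE \<omega> in N. \<bar>Y \<omega>\<bar> \<le> R"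
    and moments: "\<And>m. (\<integral>\<omega>. X \<omega> ^ m \<partial>M) = (\<integral>\<omega>. Y \<omega> ^ m \<partial>N)"
  shows "distr M borel X = distr N borel Y"
proof -
  have "distr M borel (\<lambda>\<omega>. complex_of_real (X \<omega>)) = distr N borel (\<lambda>\<omega>. complex_of_real (Y \<omega>))"
  proof (rule distr_eq_of_moments[OF M N])
    fix p r
    have eq: "complex_of_real x ^ p * cnj (complex_of_real x) ^ r = complex_of_real (x ^ (p + r))" for x
      by (simp add: power_add)
    show "(\<integral>\<omega>. complex_of_real (X \<omega>) ^ p * cnj (complex_of_real (X \<omega>)) ^ r \<partial>M) =
       (\<integral>\<omega>. complex_of_real (Y \<omega>) ^ p * cnj (complex_of_real (Y \<omega>)) ^ r \<partial>N)"
      unfolding eq integral_complex_of_real moments ..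
  qed (use bdX bdY in auto)
  then have "distr (distr M borel (\<lambda>\<omega>. complex_of_real (X \<omega>))) borel Re =
     distr (distr N borel (\<lambda>\<omega>. complex_of_real (Y \<omega>))) borel Re" by (simp only:)
  then show ?thesis by (simp add: distr_distr o_def)
qed

section \<open>Moments of beta variables\<close>

text \<open>
  The total derivative identity for a single particle, where the product over the other particles
  is empty.
\<close>

lemma beta_weight_integral_step:
  assumes s: "0 < s" and t: "0 < t" and lu: "l < u"
  shows "(\<integral>x. beta_weight l u (s + 1) t x \<partial>lborel) = s * (u - l) / (s + t) * (\<integral>x. beta_weight l u s t x \<partial>lborel)"
proof -
  interpret pair_gas l u "\<lambda>x. of_real (beta_weight l u s t x)" "\<lambda>x. of_real ((u - x) * (x - l))" "\<lambda>x. of_real (u - x)"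
    "\<lambda>x y. \<bar>x - y\<bar> powr 1" "\<lambda>x y. 1 / (x - y)"
    "of_real (- (s * (u - l)))" "of_real (- (s + t))" "of_real (1 / 2)" "of_real (- (1 / 2 * (u - l)))" "of_real (- 1)"
    by (rule pair_gas_jacobi) (use assms in auto)
  have step: "(u - x) * beta_weight l u s t x = beta_weight l u (s + 1) t x" for x
  proof (cases "x \<in> {l..u}")
    case True
    then have "(u - x) * (u - x) powr (s - 1) = (u - x) powr s" by (auto simp: powr_mult_base)
    then show ?thesis using True by (simp add: beta_weight_def)
  qed (simp add: beta_weight_def)
  have int: "integrable lborel (beta_weight l u s t)" "integrable lborel (beta_weight l u (s + 1) t)"
    using assms by (auto intro: integrable_beta_weight)
  have "0 = (\<integral>y. complex_of_real (- (s * (u - l)) * beta_weight l u s t y + (s + t) * beta_weight l u (s + 1) t y) \<partial>lborel)"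
    unfolding step[symmetric] using integral_total_derivative[of "{}"] by (simp add: algebra_simps)
  then have "(\<integral>y. - (s * (u - l)) * beta_weight l u s t y + (s + t) * beta_weight l u (s + 1) t y \<partial>lborel) = 0"
    unfolding integral_complex_of_real by simp
  then have "- (s * (u - l)) * (\<integral>y. beta_weight l u s t y \<partial>lborel) + (s + t) * (\<integral>y. beta_weight l u (s + 1) t y \<partial>lborel) = 0"
    using int by (subst (asm) Bochner_Integration.integral_add) auto
  then show ?thesis using s t by (simp add: field_simps)
qed

definition beta_sym_const :: "real \<Rightarrow> real \<Rightarrow> real" where
  "beta_sym_const s t = 2 powr (1 - s - t) * Gamma (s + t) / (Gamma s * Gamma t)"

lemma beta_sym_eq_density:
  "beta_sym s t = density lborel (\<lambda>x. ennreal (beta_sym_const s t * beta_weight (- 1) 1 s t x))"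
  unfolding beta_sym_def beta_sym_const_def by (intro density_cong) (auto simp: beta_weight_def mult_ac add.commute)

lemma beta_sym_const_nonneg: "0 < s \<Longrightarrow> 0 < t \<Longrightarrow> 0 \<le> beta_sym_const s t"
  unfolding beta_sym_const_def by (intro divide_nonneg_nonneg mult_nonneg_nonneg) (auto intro!: less_imp_le Gamma_real_pos)

lemma AE_beta_sym: "AE x in beta_sym s t. x \<in> {-1..1}"
  unfolding beta_sym_eq_density by (subst AE_density) (auto simp: beta_weight_def indicator_def split: if_splits intro!: AE_I2)

lemma integral_beta_sym:
  fixes f :: "real \<Rightarrow> real"
  assumes "0 < s" "0 < t" and [measurable]: "f \<in> borel_measurable borel"
  shows "(\<integral>x. f x \<partial>beta_sym s t) = beta_sym_const s t * (\<integral>x. f x * beta_weight (- 1) 1 s t x \<partial>lborel)"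
proof -
  have "(\<integral>x. f x \<partial>beta_sym s t) = (\<integral>x. (beta_sym_const s t * beta_weight (- 1) 1 s t x) *\<^sub>R f x \<partial>lborel)"
    unfolding beta_sym_eq_density
  proof (rule integral_density)
    show "AE x in lborel. 0 \<le> beta_sym_const s t * beta_weight (- 1) 1 s t x"
      by (intro AE_I2 mult_nonneg_nonneg beta_sym_const_nonneg[OF assms(1,2)] beta_weight_nonneg)
  qed measurable
  also have "\<dots> = (\<integral>x. beta_sym_const s t * (f x * beta_weight (- 1) 1 s t x) \<partial>lborel)"
    by (intro Bochner_Integration.integral_cong refl) (simp only: real_scaleR_def mult_ac)
  also have "\<dots> = beta_sym_const s t * (\<integral>x. f x * beta_weight (- 1) 1 s t x \<partial>lborel)"
    by (rule integral_mult_right_zero)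
  finally show ?thesis .
qed

lemma beta_sym_moment_step:
  assumes s: "0 < s" and t: "0 < t"
  shows "(\<integral>x. (1 - x) ^ Suc m \<partial>beta_sym s t) = (\<integral>x. (1 - x) ^ m \<partial>beta_sym s t) * (2 * (s + m) / (s + t + m))"
proof -
  have eq: "(1 - x) ^ m * beta_weight (- 1) 1 s t x = beta_weight (- 1) 1 (s + m) t x" for x m
  proof (induction m)
    case (Suc m)
    have "(1 - x) ^ Suc m * beta_weight (- 1) 1 s t x = (1 - x) * beta_weight (- 1) 1 (s + m) t x"
      by (simp only: power_Suc mult.assoc Suc)
    also have "\<dots> = beta_weight (- 1) 1 (s + Suc m) t x"
    proof (cases "x \<in> {-1..1}")
      case True
      then have "(1 - x) * (1 - x) powr (s + m - 1) = (1 - x) powr (s + m)" by (auto simp: powr_mult_base)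
      then show ?thesis using True by (simp add: beta_weight_def add.assoc)
    qed (simp add: beta_weight_def)
    finally show ?case .
  qed simp
  have "(\<integral>x. beta_weight (- 1) 1 (s + m + 1) t x \<partial>lborel) =
      (s + m) * (1 - - 1) / (s + m + t) * (\<integral>x. beta_weight (- 1) 1 (s + m) t x \<partial>lborel)"
    using s t by (intro beta_weight_integral_step) auto
  moreover have "s + real (Suc m) = s + m + 1" by simp
  moreover have "(\<integral>x. (1 - x) ^ m \<partial>beta_sym s t) =
      beta_sym_const s t * (\<integral>x. beta_weight (- 1) 1 (s + m) t x \<partial>lborel)" for m
    unfolding eq[symmetric] by (rule integral_beta_sym[OF s t]) measurable
  ultimately show ?thesis by (simp only:) (simp add: field_simps)
qed

lemma integral_beta_sym_uminus:
  fixes f :: "real \<Rightarrow> real"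
  assumes s: "0 < s" and t: "0 < t" and f [measurable]: "f \<in> borel_measurable borel"
  shows "(\<integral>x. f (- x) \<partial>beta_sym s t) = (\<integral>x. f x \<partial>beta_sym t s)"
proof -
  have "(\<integral>x. f (- x) * beta_weight (- 1) 1 s t x \<partial>lborel) = (\<integral>x. f x * beta_weight (- 1) 1 t s x \<partial>lborel)"
  proof -
    have "beta_weight (- 1) 1 s t x = beta_weight (- 1) 1 t s (- x)" for x
      by (auto simp: beta_weight_def indicator_def add.commute)
    then have "(\<integral>x. f (- x) * beta_weight (- 1) 1 s t x \<partial>lborel) = (\<integral>x. (\<lambda>x. f x * beta_weight (- 1) 1 t s x) (0 + (- 1) * x) \<partial>lborel)"
      by simp
    then show ?thesis using lborel_integral_real_affine[of "-1" "\<lambda>x. f x * beta_weight (- 1) 1 t s x" 0] by simp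
  qed
  then show ?thesis
    using s t by (simp add: integral_beta_sym beta_sym_const_def add.commute mult.commute diff_diff_add)
qed

section \<open>The Jacobi ensemble\<close>

lemma norm_vandermonde_powr:
  fixes z :: "nat \<Rightarrow> 'a::real_normed_field"
  shows "norm (vandermonde n z) powr \<beta> = pair_prod (\<lambda>z w. norm (z - w) powr \<beta>) n z"
  by (simp add: vandermonde_def pair_prod_def prod_norm[symmetric] prod_powr_distrib norm_minus_commute)

lemma jacobi_weight_measurable [measurable]:
  "jacobi_weight n \<beta> a b \<in> borel_measurable (lborel_n n)"
proof -
  have [measurable]: "(\<lambda>x. \<bar>vandermonde n x\<bar> powr \<beta>) \<in> borel_measurable (lborel_n n)"
    unfolding real_norm_def[symmetric] norm_vandermonde_powr
    by (intro measurable_pair_prod) (simp add: case_prod_beta')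
  have [measurable]: "(\<lambda>x. \<Prod>j=1..n. (2 - x j) powr a * (2 + x j) powr b) \<in> borel_measurable (lborel_n n)"
  proof (rule borel_measurable_prod)
    fix j assume "j \<in> {1..n}"
    note coordinate_measurable[OF this, measurable]
    show "(\<lambda>x. (2 - x j) powr a * (2 + x j) powr b) \<in> borel_measurable (lborel_n n)" by measurable
  qed
  have [measurable]: "({1..n} \<rightarrow>\<^sub>E {-2..2}) \<in> sets (lborel_n n)"
    by (intro sets_PiM_I_finite) auto
  show ?thesis unfolding jacobi_weight_def[abs_def] by measurable
qed

lemma jacobi_weight_nonneg: "0 \<le> jacobi_weight n \<beta> a b x"
  unfolding jacobi_weight_def by (intro mult_nonneg_nonneg prod_nonneg) auto

definition jacobi_moment :: "nat \<Rightarrow> real \<Rightarrow> real \<Rightarrow> real \<Rightarrow> nat \<Rightarrow> real" where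
  "jacobi_moment n \<beta> a b m =
    (\<integral>x. (\<Prod>j=1..n. 2 - x j) ^ m * jacobi_weight n \<beta> a b x \<partial>lborel_n n)"

text \<open>
  For \<open>y = 2\<close> both sides are 0, because \<open>0 powr a = 0\<close> for every \<open>a\<close>, including 0.
\<close>

lemma beta_weight_times_power:
  "beta_weight (- 2) 2 (a + real m + 1) (b + 1) y = (2 - y) ^ m * ((2 - y) powr a * (2 + y) powr b) * indicator {-2..2} y"
proof (cases "y \<in> {-2..2}")
  case True
  show ?thesis
  proof (cases "y = 2")
    case False
    then have "(2 - y) powr (a + real m) = (2 - y) ^ m * (2 - y) powr a"
      using True by (simp add: powr_add powr_realpow mult.commute)
    then show ?thesis using True by (simp add: beta_weight_def add.commute)
  qed (simp add: beta_weight_def)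
qed (simp add: beta_weight_def)

lemma prod_indicator_PiE:
  assumes "x \<in> extensional I" "finite I"
  shows "(\<Prod>i\<in>I. indicator A (x i)) = (indicator (I \<rightarrow>\<^sub>E A) x :: real)"
proof (cases "\<forall>i\<in>I. x i \<in> A")
  case True
  then show ?thesis using assms by (simp add: indicator_def PiE_iff)
next
  case False
  then obtain i where "i \<in> I" "x i \<notin> A" by blast
  then have "(\<Prod>i\<in>I. indicator A (x i)) = (0 :: real)" using assms by (intro prod_zero bexI[of _ i]) auto
  then show ?thesis using False by (auto simp: indicator_def PiE_iff)
qed

lemma jacobi_weight_eq_prod:
  assumes x: "x \<in> space (lborel_n n)"
  shows "(\<Prod>i=1..n. beta_weight (- 2) 2 (a + real m + 1) (b + 1) (x i)) * pair_prod (\<lambda>x y. \<bar>x - y\<bar> powr \<beta>) n x =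
    (\<Prod>j=1..n. 2 - x j) ^ m * jacobi_weight n \<beta> a b x"
proof -
  have "x \<in> extensional {1..n}" using x by (simp add: space_PiM PiE_iff)
  then have ind: "(\<Prod>i=1..n. indicator {-2..2} (x i)) = (indicator ({1..n} \<rightarrow>\<^sub>E {-2..2}) x :: real)"
    by (rule prod_indicator_PiE) simp
  have pp: "\<bar>vandermonde n x\<bar> powr \<beta> = pair_prod (\<lambda>x y. \<bar>x - y\<bar> powr \<beta>) n x"
    using norm_vandermonde_powr[of n x \<beta>] by simp
  show ?thesis unfolding beta_weight_times_power prod.distrib prod_power_distrib ind jacobi_weight_def pp
    by (simp only: mult_ac)
qed

text \<open>
  The \<open>n\<close>-fold mean with exponent \<open>a + m\<close> is the zeroth mean with exponent \<open>a + Suc m\<close>, so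
  \<open>mean_prod_top\<close> is the quotient of consecutive moments.
\<close>

lemma jacobi_moment_step:
  assumes n: "1 \<le> n" and a: "-1 < a" and b: "-1 < b" and \<beta>: "0 < \<beta>"
  shows "jacobi_moment n \<beta> a b (Suc m) = jacobi_moment n \<beta> a b m *
    (\<Prod>j<n. 4 * (a + 1 + real m + real j * (\<beta> / 2)) / (a + b + 2 + real m + (real n - 1 + real j) * (\<beta> / 2)))"
proof -
  let ?r = "\<lambda>j. 4 * (a + 1 + real m + real j * (\<beta> / 2)) / (a + b + 2 + real m + (real n - 1 + real j) * (\<beta> / 2))"
  let ?s = "a + real m + 1" and ?t = "b + 1"
  interpret pair_gas "-2" 2 "\<lambda>x. of_real (beta_weight (-2) 2 ?s ?t x)" "\<lambda>x. of_real ((2 - x) * (x - -2))" "\<lambda>x. of_real (2 - x)"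
    "\<lambda>x y. \<bar>x - y\<bar> powr \<beta>" "\<lambda>x y. \<beta> / (x - y)"
    "of_real (- (?s * (2 - - 2)))" "of_real (- (?s + ?t))" "of_real (\<beta> / 2)" "of_real (- (\<beta> / 2 * (2 - - 2)))" "of_real (- \<beta>)"
    by (rule pair_gas_jacobi) (use assms in auto)
  let ?P = "lborel_n n"
  let ?N = "\<lambda>j. of_real (- (?s * (2 - - 2))) + of_nat j * of_real (- (\<beta> / 2 * (2 - - 2))) :: complex"
  let ?D = "\<lambda>j. of_real (- (?s + ?t)) - of_nat (n - 1 - j) * of_real (\<beta> / 2) + of_nat j * of_real (- \<beta>) :: complex"
  have w: "weight n x = of_real ((\<Prod>j=1..n. 2 - x j) ^ m * jacobi_weight n \<beta> a b x)" if "x \<in> space ?P" for x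
    unfolding weight_def of_real_prod[symmetric] of_real_mult[symmetric] jacobi_weight_eq_prod[OF that] ..
  have m0: "mean_prod n 0 = of_real (jacobi_moment n \<beta> a b m)"
    unfolding mean_prod_def jacobi_moment_def integral_complex_of_real[symmetric]
    by (intro Bochner_Integration.integral_cong refl) (simp add: w)
  have mn: "mean_prod n n = of_real (jacobi_moment n \<beta> a b (Suc m))"
    unfolding mean_prod_def jacobi_moment_def integral_complex_of_real[symmetric]
    by (intro Bochner_Integration.integral_cong refl) (simp add: w)
  have den: "?D j = complex_of_real (- (a + b + 2 + real m + (real n - 1 + real j) * (\<beta> / 2)))" if "j < n" for j
  proof -
    have r: "real (n - 1 - j) = real n - 1 - real j" using that by (simp add: of_nat_diff)
    have "- (?s + ?t) - real (n - 1 - j) * (\<beta> / 2) + real j * (- \<beta>) = - (a + b + 2 + real m + (real n - 1 + real j) * (\<beta> / 2))"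
      unfolding r by (simp add: field_simps)
    from arg_cong[OF this, of complex_of_real] show ?thesis
      by (simp only: of_real_add of_real_diff of_real_mult of_real_of_nat_eq)
  qed
  have pos: "0 < a + b + 2 + real m + (real n - 1 + real j) * (\<beta> / 2)" for j :: nat
  proof -
    have "0 \<le> (real n - 1 + real j) * (\<beta> / 2)" using n \<beta> by (intro mult_nonneg_nonneg) auto
    with a b show ?thesis by linarith
  qed
  have num: "?N j = complex_of_real (- (4 * (a + 1 + real m + real j * (\<beta> / 2))))" for j
  proof -
    have "- (?s * (2 - - 2)) + real j * (- (\<beta> / 2 * (2 - - 2))) = - (4 * (a + 1 + real m + real j * (\<beta> / 2)))"
      by (simp add: algebra_simps)
    from arg_cong[OF this, of complex_of_real] show ?thesis
      by (simp only: of_real_add of_real_mult of_real_of_nat_eq)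
  qed
  have "mean_prod n n = mean_prod n 0 * (\<Prod>j<n. ?N j / ?D j)"
  proof (rule mean_prod_top)
    fix j assume "j < n"
    show "?D j \<noteq> 0"
      unfolding den[OF \<open>j < n\<close>] of_real_eq_0_iff using pos[of j] by linarith
  qed
  also have "(\<Prod>j<n. ?N j / ?D j) =
    complex_of_real (\<Prod>j<n. ?r j)"
    unfolding of_real_prod
  proof (rule prod.cong[OF refl])
    fix j assume "j \<in> {..<n}"
    then have "j < n" by simp
    show "?N j / ?D j = complex_of_real (?r j)"
      unfolding den[OF \<open>j < n\<close>] num of_real_divide[symmetric] minus_divide_divide ..
  qed
  finally show ?thesis
    unfolding m0 mn of_real_mult[symmetric] of_real_eq_iff .
qed

lemma jacobi_weight_uminus:
  "jacobi_weight n \<beta> a b (\<lambda>i\<in>{1..n}. - x i) = jacobi_weight n \<beta> b a x" if "x \<in> extensional {1..n}"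
proof -
  have "\<bar>vandermonde n (\<lambda>i\<in>{1..n}. - x i)\<bar> powr \<beta> = \<bar>vandermonde n x\<bar> powr \<beta>"
    unfolding real_norm_def[symmetric] norm_vandermonde_powr unfolding pair_prod_def
    by (intro prod.cong refl) (auto simp: abs_minus_commute)
  moreover have "(\<Prod>j=1..n. (2 - (\<lambda>i\<in>{1..n}. - x i) j) powr a * (2 + (\<lambda>i\<in>{1..n}. - x i) j) powr b) =
      (\<Prod>j=1..n. (2 - x j) powr b * (2 + x j) powr a)"
    by (intro prod.cong refl) auto
  moreover have "indicator ({1..n} \<rightarrow>\<^sub>E {-2..2}) (\<lambda>i\<in>{1..n}. - x i) = (indicator ({1..n} \<rightarrow>\<^sub>E {-2..2}) x :: real)"
    using that by (auto simp: indicator_def PiE_iff minus_le_iff le_minus_iff)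
  ultimately show ?thesis by (simp only: jacobi_weight_def)
qed

lemma prod_diff_measurable:
  "(\<lambda>x. \<Prod>j=1..n. c - x j) \<in> borel_measurable (lborel_n n)"
proof (rule borel_measurable_prod)
  fix j assume "j \<in> {1..n}"
  note coordinate_measurable[OF this, measurable]
  show "(\<lambda>x. c - x j) \<in> borel_measurable (lborel_n n)" by measurable
qed

text \<open>
  The reflection of all coordinates maps \<open>2 + x\<close> to \<open>2 - x\<close> and exchanges the two exponents.
\<close>

lemma jacobi_moment_sign:
  assumes \<sigma>: "\<sigma> \<in> {1, -1}"
  shows "(\<integral>x. (\<Prod>j=1..n. \<sigma> * 2 - x j) ^ m * jacobi_weight n \<beta> a b x \<partial>lborel_n n) =
    (\<sigma> ^ n) ^ m * (if \<sigma> = 1 then jacobi_moment n \<beta> a b m else jacobi_moment n \<beta> b a m)"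
proof (cases "\<sigma> = 1")
  case True
  then show ?thesis by (simp add: jacobi_moment_def)
next
  case False
  then have \<sigma>: "\<sigma> = -1" using \<sigma> by simp
  let ?P = "lborel_n n"
  let ?f = "\<lambda>x::nat \<Rightarrow> real. \<lambda>i\<in>{1..n}. - x i"
  let ?g = "\<lambda>x. (\<Prod>j=1..n. -1 * 2 - x j) ^ m * jacobi_weight n \<beta> a b x"
  have f: "?f \<in> measurable ?P ?P"
  proof (rule measurable_restrict)
    fix i assume "i \<in> {1..n}"
    note coordinate_measurable[OF this, measurable]
    show "(\<lambda>x. - x i) \<in> measurable ?P lborel" by measurable
  qed
  note prod_diff_measurable[measurable]
  have g: "?g \<in> borel_measurable ?P" by measurable
  have "(\<integral>x. ?g x \<partial>?P) = (\<integral>x. ?g x \<partial>distr ?P ?P ?f)" by (subst distr_PiM_uminus) simp_all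
  also have "\<dots> = (\<integral>x. ?g (?f x) \<partial>?P)" by (rule integral_distr[OF f g])
  also have "\<dots> = (\<integral>x. ((-1) ^ n) ^ m * ((\<Prod>j=1..n. 2 - x j) ^ m * jacobi_weight n \<beta> b a x) \<partial>?P)"
  proof (intro Bochner_Integration.integral_cong refl)
    fix x assume "x \<in> space ?P"
    then have "x \<in> extensional {1..n}" by (simp add: space_PiM PiE_iff)
    moreover have "(\<Prod>j=1..n. -1 * 2 - ?f x j) = (\<Prod>j=1..n. -1 * (2 - x j))" by (intro prod.cong refl) auto
    moreover have "\<dots> = (-1) ^ n * (\<Prod>j=1..n. 2 - x j)" by (simp only: prod.distrib prod_constant card_atLeastAtMost diff_Suc_1)
    ultimately show "?g (?f x) = ((-1) ^ n) ^ m * ((\<Prod>j=1..n. 2 - x j) ^ m * jacobi_weight n \<beta> b a x)"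
      by (simp only: jacobi_weight_uminus power_mult_distrib mult.assoc)
  qed
  finally show ?thesis using False by (simp add: \<sigma> jacobi_moment_def)
qed

text \<open>
  The factors with odd \<open>k\<close> contribute, up to the factor 2, the numerators \<open>C + i * \<gamma>\<close> for
  \<open>i < n\<close>. These cancel the first \<open>n\<close> of the denominators \<open>C + k * \<gamma>\<close> for
  \<open>k \<le> 2 * n\<close>. The denominators that remain are those of the Jacobi ensemble.
\<close>

lemma jacobi_ratio_telescope:
  fixes A C \<gamma> :: real
  assumes A: "0 < A" and C: "0 < C" and \<gamma>: "0 < \<gamma>"
  shows "2 * (\<Prod>k=0..2 * n. 2 * (if even k then A + real k / 2 * \<gamma> else C + (real k - 1) / 2 * \<gamma>) / (C + real k * \<gamma>)) =
    (\<Prod>j<Suc n. 4 * (A + real j * \<gamma>) / (C + (real n + real j) * \<gamma>))"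
proof (induction n)
  case 0
  show ?case by simp
next
  case (Suc n)
  let ?S = "\<lambda>k::nat. 2 * (if even k then A + real k / 2 * \<gamma> else C + (real k - 1) / 2 * \<gamma>) / (C + real k * \<gamma>)"
  have pos: "0 < C + x * \<gamma>" if "0 \<le> x" for x using that C \<gamma> by (intro add_pos_nonneg) auto
  define D where "D m k = (\<Prod>j<k. C + (real m + real j) * \<gamma>)" for m k :: nat
  have D0: "D m k \<noteq> 0" for m k
    unfolding D_def using pos by (simp add: prod_zero_iff) (metis add_nonneg_nonneg of_nat_0_le_iff less_irrefl)
  \<comment> \<open>the denominators for \<open>n\<close> and \<open>Suc n\<close> overlap in all but the first one and the last two\<close>
  have split: "(\<Prod>j<k. 4 * (A + real j * \<gamma>) / (C + (real m + real j) * \<gamma>)) = (\<Prod>j<k. 4 * (A + real j * \<gamma>)) / D m k" for m k :: nat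
    unfolding D_def by (rule prod_dividef)
  have shift: "D n (Suc (Suc (Suc n))) = (C + n * \<gamma>) * D (Suc n) (Suc (Suc n))"
    unfolding D_def by (subst prod.lessThan_Suc_shift) (simp add: add_ac)
  have top: "D n (Suc (Suc (Suc n))) = D n (Suc n) * (C + (2 * real n + 1) * \<gamma>) * (C + (2 * real n + 2) * \<gamma>)"
    unfolding D_def prod.lessThan_Suc[of _ "Suc (Suc n)"] prod.lessThan_Suc[of _ "Suc n"] by (simp add: algebra_simps)
  have frac: "P / d * (2 * x / y) * (2 * z / w) = (P * (4 * z) * x) / (d * y * w)" for P d x y z w :: real
    by simp
  have "2 * (\<Prod>k=0..2 * Suc n. ?S k) = 2 * (\<Prod>k=0..2 * n. ?S k) * ?S (2 * n + 1) * ?S (2 * n + 2)"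
    by (simp add: mult_ac)
  also have "\<dots> = (\<Prod>j<Suc n. 4 * (A + real j * \<gamma>)) / D n (Suc n) * ?S (2 * n + 1) * ?S (2 * n + 2)"
    unfolding Suc.IH split ..
  also have "?S (2 * n + 1) = 2 * (C + n * \<gamma>) / (C + (2 * real n + 1) * \<gamma>)" by simp
  also have "?S (2 * n + 2) = 2 * (A + Suc n * \<gamma>) / (C + (2 * real n + 2) * \<gamma>)"
  proof -
    have "?S (2 * n + 2) = 2 * (A + real (2 * n + 2) / 2 * \<gamma>) / (C + real (2 * n + 2) * \<gamma>)" by simp
    moreover have "real (2 * n + 2) / 2 = real (Suc n)" "real (2 * n + 2) = 2 * real n + 2" by simp_all
    ultimately show ?thesis by (simp only:)
  qed
  also have "(\<Prod>j<Suc n. 4 * (A + real j * \<gamma>)) / D n (Suc n) * (2 * (C + n * \<gamma>) / (C + (2 * real n + 1) * \<gamma>)) *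
      (2 * (A + Suc n * \<gamma>) / (C + (2 * real n + 2) * \<gamma>)) =
      ((\<Prod>j<Suc n. 4 * (A + real j * \<gamma>)) * (4 * (A + Suc n * \<gamma>)) * (C + n * \<gamma>)) /
        (D n (Suc n) * (C + (2 * real n + 1) * \<gamma>) * (C + (2 * real n + 2) * \<gamma>))"
    by (rule frac)
  also have "\<dots> = ((\<Prod>j<Suc (Suc n). 4 * (A + real j * \<gamma>)) * (C + n * \<gamma>)) / ((C + n * \<gamma>) * D (Suc n) (Suc (Suc n)))"
    unfolding top[symmetric] shift by (simp only: prod.lessThan_Suc)
  also have "\<dots> = (\<Prod>j<Suc (Suc n). 4 * (A + real j * \<gamma>)) / D (Suc n) (Suc (Suc n))"
    using pos[of n] D0 by simp
  finally show ?case unfolding split .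
qed

lemma distr_beta_sym_moment:
  fixes Y :: "'a \<Rightarrow> real"
  assumes "prob_space N" and Y [measurable]: "Y \<in> borel_measurable N" and law: "distr N borel Y = beta_sym s t"
    and s: "0 < s" and t: "0 < t"
  shows "(\<integral>\<omega>. (1 - Y \<omega>) ^ m \<partial>N) = (\<integral>x. (1 - x) ^ m \<partial>beta_sym s t)"
    and "(\<integral>\<omega>. (1 + Y \<omega>) ^ m \<partial>N) = (\<integral>x. (1 - x) ^ m \<partial>beta_sym t s)"
    and "AE \<omega> in N. Y \<omega> \<in> {-1..1}"
proof -
  show "(\<integral>\<omega>. (1 - Y \<omega>) ^ m \<partial>N) = (\<integral>x. (1 - x) ^ m \<partial>beta_sym s t)"
    unfolding law[symmetric] by (subst integral_distr) auto
  have "(\<integral>\<omega>. (1 + Y \<omega>) ^ m \<partial>N) = (\<integral>x. (1 - (- x)) ^ m \<partial>beta_sym s t)"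
    unfolding law[symmetric] by (subst integral_distr) auto
  also have "\<dots> = (\<integral>x. (1 - x) ^ m \<partial>beta_sym t s)"
    by (rule integral_beta_sym_uminus[OF s t, of "\<lambda>x. (1 - x) ^ m"]) measurable
  finally show "(\<integral>\<omega>. (1 + Y \<omega>) ^ m \<partial>N) = (\<integral>x. (1 - x) ^ m \<partial>beta_sym t s)" .
  have "AE x in distr N borel Y. x \<in> {-1..1}" unfolding law by (rule AE_beta_sym)
  then show "AE \<omega> in N. Y \<omega> \<in> {-1..1}" by (subst (asm) AE_distr_iff) auto
qed

lemma norm_prod_le_power:
  fixes f :: "'a \<Rightarrow> 'b::real_normed_field"
  assumes "\<And>i. i \<in> I \<Longrightarrow> norm (f i) \<le> B"
  shows "norm (\<Prod>i\<in>I. f i) \<le> B ^ card I"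
proof -
  have "norm (\<Prod>i\<in>I. f i) = (\<Prod>i\<in>I. norm (f i))" by (rule prod_norm[symmetric])
  also have "\<dots> \<le> (\<Prod>i\<in>I. B)" using assms by (intro prod_mono) auto
  finally show ?thesis by simp
qed

text \<open>
  After \<open>\<sigma> ^ n\<close> is split off, the variable for \<open>\<sigma> = -1\<close> has the moments of the one for \<open>\<sigma> = 1\<close> with
  \<open>a\<close> and \<open>b\<close> exchanged; on the side of the independent factors the same exchange happens because
  \<open>1 + X k\<close> occurs for even \<open>k\<close> and the parameters for odd \<open>k\<close> are symmetric in \<open>a\<close> and \<open>b\<close>. Both
  sequences of moments start with 1 and have the same quotients.
\<close>

lemma jacobi_law:
  fixes M :: "'a measure" and N :: "'b measure" and x :: "nat \<Rightarrow> 'a \<Rightarrow> real" and X :: "nat \<Rightarrow> 'b \<Rightarrow> real"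
  assumes n: "1 \<le> n" and \<beta>: "0 < \<beta>" and a: "-1 < a" and b: "-1 < b"
    and ens: "jacobi_beta_ensemble M n \<beta> a b x"
    and N: "prob_space N"
    and indep: "prob_space.indep_vars N (\<lambda>_. borel) X {0..2 * n - 2}"
    and law: "\<forall>k\<in>{0..2 * n - 2}. distr N borel (X k) =
           (if even k
            then beta_sym (real k / 4 * \<beta> + a + 1) (real k / 4 * \<beta> + b + 1)
            else beta_sym ((real k - 1) / 4 * \<beta> + a + b + 2) ((real k + 1) / 4 * \<beta>))"
    and \<sigma>: "\<sigma> \<in> {1, -1}"
  shows "distr M borel (\<lambda>\<omega>. \<Prod>k=1..n. \<sigma> * 2 - x k \<omega>) =
    distr N borel (\<lambda>\<omega>. \<sigma> ^ n * (2 * (\<Prod>k=0..2 * n - 2. 1 - \<sigma> ^ (k + 1) * X k \<omega>)))"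
proof -
  let ?Z = "\<lambda>\<omega>. \<Prod>k=1..n. \<sigma> * 2 - x k \<omega>"
  interpret N: prob_space N by fact
  have M: "prob_space M" using ens by (simp add: jacobi_beta_ensemble_def)
  interpret M: prob_space M by fact
  let ?P = "lborel_n n"
  obtain c where c: "0 < c" and dist: "distributed M ?P (\<lambda>\<omega>. \<lambda>k\<in>{1..n}. x k \<omega>) (\<lambda>y. ennreal (c * jacobi_weight n \<beta> a b y))"
    using ens unfolding jacobi_beta_ensemble_def by blast
  define a' b' where "a' = (if \<sigma> = 1 then a else b)" and "b' = (if \<sigma> = 1 then b else a)"
  have a'b': "-1 < a'" "-1 < b'" "a' + b' = a + b" using a b by (auto simp: a'_def b'_def)

  have x_vec: "(\<lambda>\<omega>. \<lambda>k\<in>{1..n}. x k \<omega>) \<in> measurable M ?P" by (rule distributed_measurable[OF dist])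
  have x_meas: "x k \<in> borel_measurable M" if "k \<in> {1..n}" for k
    using measurable_compose[OF x_vec coordinate_measurable[OF that]] that by simp
  have x_bd: "AE \<omega> in M. \<forall>k\<in>{1..n}. x k \<omega> \<in> {-2..2}"
  proof -
    have box: "({1..n} \<rightarrow>\<^sub>E {-2..2}) \<in> sets ?P" by (intro sets_PiM_I_finite) auto
    have "AE \<omega> in M. (\<lambda>k\<in>{1..n}. x k \<omega>) \<in> ({1..n} \<rightarrow>\<^sub>E {-2..2})"
    proof (subst M.distributed_AE2[OF dist])
      show "AE y in ?P. 0 < ennreal (c * jacobi_weight n \<beta> a b y) \<longrightarrow> y \<in> ({1..n} \<rightarrow>\<^sub>E {-2..2})"
        by (intro AE_I2) (auto simp: jacobi_weight_def indicator_def split: if_splits)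
      show "Measurable.pred ?P (\<lambda>y. y \<in> ({1..n} \<rightarrow>\<^sub>E {-2..2}))" using box by measurable
    qed
    then show ?thesis by eventually_elim (auto simp: PiE_iff)
  qed
  have moment_M: "(\<integral>\<omega>. ?Z \<omega> ^ m \<partial>M) = (\<sigma> ^ n) ^ m * (c * jacobi_moment n \<beta> a' b' m)" for m
  proof -
    have "(\<integral>\<omega>. ?Z \<omega> ^ m \<partial>M) = (\<integral>\<omega>. (\<lambda>y. (\<Prod>k=1..n. \<sigma> * 2 - y k) ^ m) (\<lambda>k\<in>{1..n}. x k \<omega>) \<partial>M)"
      by (intro Bochner_Integration.integral_cong refl arg_cong[where f = "\<lambda>y. y ^ m"] prod.cong) auto
    also have "\<dots> = (\<integral>y. (c * jacobi_weight n \<beta> a b y) * (\<Prod>k=1..n. \<sigma> * 2 - y k) ^ m \<partial>?P)"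
      using c jacobi_weight_nonneg prod_diff_measurable
      by (intro distributed_integral[OF dist, symmetric] borel_measurable_power) auto
    also have "\<dots> = (\<integral>y. c * ((\<Prod>k=1..n. \<sigma> * 2 - y k) ^ m * jacobi_weight n \<beta> a b y) \<partial>?P)"
      by (simp only: mult_ac)
    also have "\<dots> = c * ((\<sigma> ^ n) ^ m * (if \<sigma> = 1 then jacobi_moment n \<beta> a b m else jacobi_moment n \<beta> b a m))"
      unfolding integral_mult_right_zero jacobi_moment_sign[OF \<sigma>] ..
    finally show ?thesis by (simp add: a'_def b'_def)
  qed

  define s where "s k = (if even k then real k / 4 * \<beta> + a' + 1 else (real k - 1) / 4 * \<beta> + a + b + 2)" for k :: nat
  define t where "t k = (if even k then real k / 4 * \<beta> + b' + 1 else (real k + 1) / 4 * \<beta>)" for k :: nat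
  have st: "0 < s k" "0 < t k" for k
  proof -
    have "0 < real k / 4 * \<beta> + z + 1" if "-1 < z" for z
    proof -
      have "0 \<le> real k / 4 * \<beta>" using \<beta> by simp
      with that show ?thesis by linarith
    qed
    moreover have "0 < (real k - 1) / 4 * \<beta> + a + b + 2" if "odd k"
    proof -
      have "0 \<le> (real k - 1) / 4 * \<beta>" using that \<beta> by (intro mult_nonneg_nonneg) (auto elim: oddE)
      with a b show ?thesis by linarith
    qed
    moreover have "0 < (real k + 1) / 4 * \<beta>" using \<beta> by simp
    ultimately show "0 < s k" "0 < t k" using a'b' by (auto simp: s_def t_def)
  qed
  define mom where "mom m k = (\<integral>x. (1 - x) ^ m \<partial>beta_sym (s k) (t k))" for m k
  define Y where "Y k \<omega> = 1 - \<sigma> ^ (k + 1) * X k \<omega>" for k \<omega>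
  let ?W = "\<lambda>\<omega>. \<sigma> ^ n * (2 * (\<Prod>k=0..2 * n - 2. Y k \<omega>))"
  have X_meas [measurable]: "X k \<in> borel_measurable N" if "k \<in> {0..2 * n - 2}" for k
    using indep that unfolding N.indep_vars_def by auto
  have Y_props: "(\<integral>\<omega>. Y k \<omega> ^ m \<partial>N) = mom m k" "AE \<omega> in N. \<bar>Y k \<omega>\<bar> \<le> 2"
    if k: "k \<in> {0..2 * n - 2}" for k m
  proof -
    show "(\<integral>\<omega>. Y k \<omega> ^ m \<partial>N) = mom m k"
    proof (cases "\<sigma> = 1 \<or> odd k")
      case True
      then have "Y k \<omega> = 1 - X k \<omega>" for \<omega> using \<sigma> by (auto simp: Y_def)
      moreover have "distr N borel (X k) = beta_sym (s k) (t k)"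
        using law k True by (auto simp: s_def t_def a'_def b'_def)
      ultimately show ?thesis using distr_beta_sym_moment(1)[OF N X_meas[OF k] _ st] by (simp add: mom_def)
    next
      case False
      then have "Y k \<omega> = 1 + X k \<omega>" for \<omega> using \<sigma> by (auto simp: Y_def)
      moreover have "distr N borel (X k) = beta_sym (t k) (s k)"
        using law k False by (auto simp: s_def t_def a'_def b'_def)
      ultimately show ?thesis using distr_beta_sym_moment(2)[OF N X_meas[OF k] _ st(2) st(1)] by (simp add: mom_def)
    qed
    have "distr N borel (X k) = beta_sym (s k) (t k) \<or> distr N borel (X k) = beta_sym (t k) (s k)"
      using law k by (auto simp: s_def t_def a'_def b'_def)
    then have "AE \<omega> in N. X k \<omega> \<in> {-1..1}"
      using distr_beta_sym_moment(3)[OF N X_meas[OF k]] st by blast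
    then show "AE \<omega> in N. \<bar>Y k \<omega>\<bar> \<le> 2"
    proof eventually_elim
      case (elim \<omega>)
      have "\<sigma> ^ (k + 1) \<in> {1, -1}" using \<sigma> by (cases "even k") auto
      then show ?case using elim by (auto simp: Y_def)
    qed
  qed
  have Y_indep: "N.indep_vars (\<lambda>_. borel) (\<lambda>k \<omega>. Y k \<omega> ^ m) {0..2 * n - 2}" for m
    unfolding Y_def by (rule N.indep_vars_compose2[OF indep]) measurable
  have Y_meas [measurable]: "Y k \<in> borel_measurable N" if "k \<in> {0..2 * n - 2}" for k
    unfolding Y_def using X_meas[OF that] by measurable
  have Y_int: "integrable N (\<lambda>\<omega>. Y k \<omega> ^ m)" if k: "k \<in> {0..2 * n - 2}" for k m
  proof (rule N.integrable_const_bound)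
    show "AE \<omega> in N. norm (Y k \<omega> ^ m) \<le> 2 ^ m"
      using Y_props(2)[OF k] by eventually_elim (auto simp: power_abs intro: power_mono)
  qed (use Y_meas[OF k] in measurable)
  define v where "v m = 2 ^ m * (\<Prod>k=0..2 * n - 2. mom m k)" for m :: nat
  have moment_N: "(\<integral>\<omega>. ?W \<omega> ^ m \<partial>N) = (\<sigma> ^ n) ^ m * v m" for m
  proof -
    have "(\<integral>\<omega>. ?W \<omega> ^ m \<partial>N) =
        (\<integral>\<omega>. (\<sigma> ^ n) ^ m * (2 ^ m * (\<Prod>k=0..2 * n - 2. Y k \<omega> ^ m)) \<partial>N)"
      by (simp only: power_mult_distrib prod_power_distrib)
    also have "\<dots> = (\<sigma> ^ n) ^ m * (2 ^ m * (\<Prod>k=0..2 * n - 2. \<integral>\<omega>. Y k \<omega> ^ m \<partial>N))"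
      unfolding integral_mult_right_zero using Y_indep Y_int by (subst N.indep_vars_lebesgue_integral) auto
    also have "(\<Prod>k=0..2 * n - 2. \<integral>\<omega>. Y k \<omega> ^ m \<partial>N) = (\<Prod>k=0..2 * n - 2. mom m k)"
      by (intro prod.cong refl Y_props(1))
    finally show ?thesis by (simp only: v_def)
  qed

  define r where "r m = (\<Prod>j<n. 4 * (a' + 1 + real m + real j * (\<beta> / 2)) / (a' + b' + 2 + real m + (real n - 1 + real j) * (\<beta> / 2)))" for m :: nat
  have v_step: "v (Suc m) = v m * r m" for m
  proof -
    let ?S = "\<lambda>k. if even k then (a' + 1 + m) + real k / 2 * (\<beta> / 2) else (a' + b' + 2 + m) + (real k - 1) / 2 * (\<beta> / 2)"
    have "v (Suc m) = 2 ^ Suc m * (\<Prod>k=0..2 * n - 2. mom m k * (2 * (s k + m) / (s k + t k + m)))"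
      unfolding v_def mom_def beta_sym_moment_step[OF st] ..
    also have "\<dots> = v m * (2 * (\<Prod>k=0..2 * n - 2. 2 * (s k + m) / (s k + t k + m)))"
      unfolding prod.distrib v_def by simp
    also have "(\<Prod>k=0..2 * n - 2. 2 * (s k + m) / (s k + t k + m)) =
       (\<Prod>k=0..2 * (n - 1). 2 * ?S k /
          ((a' + b' + 2 + m) + k * (\<beta> / 2)))"
    proof (intro prod.cong)
      fix k :: nat
      have "s k + m = ?S k"
        using a'b'(3) by (simp add: s_def)
      moreover have "s k + t k + m = (a' + b' + 2 + m) + k * (\<beta> / 2)"
        using a'b'(3) by (simp add: s_def t_def field_simps)
      ultimately show "2 * (s k + m) / (s k + t k + m) =
        2 * ?S k /
          ((a' + b' + 2 + m) + k * (\<beta> / 2))" by (simp only:)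
    qed (use n in auto)
    also have "2 * \<dots> = (\<Prod>j<Suc (n - 1). 4 * ((a' + 1 + m) + real j * (\<beta> / 2)) / ((a' + b' + 2 + m) + (real (n - 1) + real j) * (\<beta> / 2)))"
      using a'b' \<beta> by (intro jacobi_ratio_telescope) auto
    also have "\<dots> = r m" using n by (simp add: r_def of_nat_diff add_ac)
    finally show ?thesis .
  qed
  have u_step: "c * jacobi_moment n \<beta> a' b' (Suc m) = (c * jacobi_moment n \<beta> a' b' m) * r m" for m
    using jacobi_moment_step[OF n a'b'(1,2) \<beta>, of m] by (simp add: r_def)
  have "c * jacobi_moment n \<beta> a' b' m = v m" for m
  proof (induction m)
    case 0
    \<comment> \<open>the moments of order 0 are total masses\<close>
    have "v 0 = (\<Prod>k=0..2 * n - 2. \<integral>\<omega>. Y k \<omega> ^ 0 \<partial>N)"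
      unfolding v_def using Y_props(1)[of _ 0] by simp
    also have "\<dots> = 1" by (simp add: N.prob_space)
    finally show ?case using moment_M[of 0] by (simp add: M.prob_space)
  next
    case (Suc m)
    then show ?case unfolding u_step v_step by simp
  qed
  then have moments: "(\<integral>\<omega>. ?Z \<omega> ^ m \<partial>M) = (\<integral>\<omega>. ?W \<omega> ^ m \<partial>N)" for m
    unfolding moment_M moment_N by simp

  have "distr M borel (\<lambda>\<omega>. ?Z \<omega>) = distr N borel (\<lambda>\<omega>. ?W \<omega>)"
  proof (rule distr_eq_of_real_moments[OF M N _ _ _ _ moments])
    have \<sigma>n: "\<bar>\<sigma> ^ n\<bar> = 1" using \<sigma> by (auto simp: power_abs)
    show "AE \<omega> in M. \<bar>?Z \<omega>\<bar> \<le> 4 ^ n + 2 * 2 ^ (2 * n)"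
      using x_bd
    proof eventually_elim
      case (elim \<omega>)
      have "\<bar>?Z \<omega>\<bar> \<le> 4 ^ card {1..n}"
        unfolding real_norm_def[symmetric] using elim \<sigma> by (intro norm_prod_le_power) (force simp: abs_le_iff)
      then show ?case by (simp add: add_increasing2)
    qed
    have "AE \<omega> in N. \<forall>k\<in>{0..2 * n - 2}. \<bar>Y k \<omega>\<bar> \<le> 2"
      using Y_props(2) by (intro AE_finite_allI) auto
    then show "AE \<omega> in N. \<bar>?W \<omega>\<bar> \<le> 4 ^ n + 2 * 2 ^ (2 * n)"
    proof eventually_elim
      case (elim \<omega>)
      then have "\<bar>\<Prod>k=0..2 * n - 2. Y k \<omega>\<bar> \<le> 2 ^ card {0..2 * n - 2}" 
        unfolding real_norm_def[symmetric] by (intro norm_prod_le_power) auto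
      also have "\<dots> \<le> 2 ^ (2 * n)" using n by (intro power_increasing) auto
      finally show ?case unfolding abs_mult \<sigma>n by (simp add: add_increasing)
    qed
    show "(\<lambda>\<omega>. ?Z \<omega>) \<in> borel_measurable M"
      using x_meas by (intro borel_measurable_prod borel_measurable_diff) auto
    show "(\<lambda>\<omega>. ?W \<omega>) \<in> borel_measurable N"
      using Y_meas by (intro borel_measurable_times borel_measurable_prod borel_measurable_const) auto
  qed
  then show ?thesis by (simp only: Y_def)
qed

section \<open>The circular ensemble\<close>

lemma norm_cis_diff_powr:
  "norm (cis x - cis y) powr \<beta> = (2 - 2 * cos (x - y)) powr (\<beta> / 2)"
proof -
  have "(norm (cis x - cis y))\<^sup>2 = (cos x - cos y)\<^sup>2 + (sin x - sin y)\<^sup>2"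
    by (simp add: cmod_power2)
  also have "\<dots> = ((sin x)\<^sup>2 + (cos x)\<^sup>2) + ((sin y)\<^sup>2 + (cos y)\<^sup>2) - 2 * (cos x * cos y + sin x * sin y)"
    by (simp only: power2_eq_square) (simp add: algebra_simps)
  also have "\<dots> = 2 - 2 * cos (x - y)" by (simp add: sin_cos_squared_add cos_diff)
  finally have sq: "(norm (cis x - cis y))\<^sup>2 = 2 - 2 * cos (x - y)" .
  show ?thesis using power2_powr_half[of "norm (cis x - cis y)" \<beta>] unfolding sq by simp
qed

definition circular_moment :: "complex \<Rightarrow> nat \<Rightarrow> real \<Rightarrow> nat \<Rightarrow> nat \<Rightarrow> complex" where
  "circular_moment c n \<beta> p r = (\<integral>x. (\<Prod>i=1..n. circular_weight c p r (x i)) *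
     of_real (norm (vandermonde n (\<lambda>k. cis (x k))) powr \<beta>) \<partial>lborel_n n)"

lemma circular_moment_cnj: "circular_moment c n \<beta> r p = cnj (circular_moment c n \<beta> p r)"
proof -
  have "circular_weight c r p x = cnj (circular_weight c p r x)" for x
    by (simp add: circular_weight_def mult.commute)
  then have eq: "(\<Prod>i=1..n. circular_weight c r p (x i)) * of_real v = cnj ((\<Prod>i=1..n. circular_weight c p r (x i)) * of_real v)" for x v
    by simp
  show ?thesis unfolding circular_moment_def eq by (rule Bochner_Integration.integral_cnj)
qed

lemma circular_moment_step:
  assumes c: "norm c = 1" and \<beta>: "0 < \<beta>"
  shows "circular_moment c n \<beta> (Suc p) r = circular_moment c n \<beta> p r *
    of_real (\<Prod>j<n. (1 + real p + real r + real j * (\<beta> / 2)) / (1 + real p + real j * (\<beta> / 2)))"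
proof -
  let ?r = "\<lambda>j. (1 + real p + real r + real j * (\<beta> / 2)) / (1 + real p + real j * (\<beta> / 2))"
  interpret pair_gas "-pi" pi "circular_weight c p r" "\<lambda>x. 1 - c * cis x" "\<lambda>x. 1 - c * cis x"
    "\<lambda>x y. (2 - 2 * cos (x - y)) powr (\<beta> / 2)" "\<lambda>x y. (\<beta> / 2) * sin (x - y) / (1 - cos (x - y))"
    "- \<i> * of_nat (p + 1 + r)" "- \<i> * of_nat (p + 1)" 0 "- \<i> * of_real (\<beta> / 2)" "- \<i> * of_real (\<beta> / 2)"
    by (rule pair_gas_circular) (use c \<beta> in auto)
  let ?N = "\<lambda>j. - \<i> * of_nat (p + 1 + r) + of_nat j * (- \<i> * of_real (\<beta> / 2))"
  let ?D = "\<lambda>j. - \<i> * of_nat (p + 1) - of_nat (n - 1 - j) * 0 + of_nat j * (- \<i> * of_real (\<beta> / 2))"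
  have vdm: "norm (vandermonde n (\<lambda>k. cis (x k))) powr \<beta> = pair_prod (\<lambda>x y. (2 - 2 * cos (x - y)) powr (\<beta> / 2)) n x" for x
    unfolding norm_vandermonde_powr unfolding pair_prod_def norm_cis_diff_powr ..
  have m0: "mean_prod n 0 = circular_moment c n \<beta> p r"
    unfolding mean_prod_def circular_moment_def weight_def vdm by simp
  have step: "(1 - c * cis y) * circular_weight c p r y = circular_weight c (Suc p) r y" for y
    by (simp add: circular_weight_def)
  have mn: "mean_prod n n = circular_moment c n \<beta> (Suc p) r"
    unfolding mean_prod_def circular_moment_def weight_def vdm mult.assoc[symmetric] prod.distrib[symmetric] step ..
  have num: "?N j = - \<i> * complex_of_real (1 + real p + real r + real j * (\<beta> / 2))"
    and den: "?D j = - \<i> * complex_of_real (1 + real p + real j * (\<beta> / 2))" for j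
    by (simp_all add: algebra_simps)
  have ratio: "?N j / ?D j = complex_of_real (?r j)" for j
    unfolding num den by (simp only: of_real_divide) simp
  have "mean_prod n n = mean_prod n 0 * (\<Prod>j<n. ?N j / ?D j)"
  proof (rule mean_prod_top)
    fix j
    have "0 < 1 + real p + real j * (\<beta> / 2)" using \<beta> by (intro add_pos_nonneg) auto
    then have "complex_of_real (1 + real p + real j * (\<beta> / 2)) \<noteq> 0" unfolding of_real_eq_0_iff by linarith
    then show "?D j \<noteq> 0" unfolding den by (simp only: mult_eq_0_iff) simp
  qed
  then show ?thesis unfolding ratio of_real_prod[symmetric] m0 mn .
qed

text \<open>
  Each factor is \<open>Gamma c * Gamma (c + p + r) / (Gamma (c + p) * Gamma (c + r))\<close> for
  \<open>c = 1 + j * \<beta> / 2\<close>, and the product is the normalized Morris integral.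
\<close>

definition circular_ratio :: "nat \<Rightarrow> real \<Rightarrow> nat \<Rightarrow> nat \<Rightarrow> real" where
  "circular_ratio n \<beta> p r = (\<Prod>j<n. pochhammer (1 + real j * (\<beta> / 2) + p) r / pochhammer (1 + real j * (\<beta> / 2)) r)"

text \<open>
  The recursion raises \<open>p\<close> for fixed \<open>r\<close> and therefore has to be started at \<open>p = 0\<close>. There the
  moment is the conjugate of the one with exponents \<open>r\<close> and 0, which is reached from the zeroth
  moment by steps with quotient 1.
\<close>

lemma circular_moment_eq:
  assumes c: "norm c = 1" and \<beta>: "0 < \<beta>"
  shows "circular_moment c n \<beta> p r = circular_moment c n \<beta> 0 0 * of_real (circular_ratio n \<beta> p r)"
proof -
  let ?b = "\<lambda>j. 1 + real j * (\<beta> / 2)"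
  let ?m = "circular_moment c n \<beta>"
  let ?q = "\<lambda>p r j. (1 + real p + real r + real j * (\<beta> / 2)) / (1 + real p + real j * (\<beta> / 2))"
  have pos: "0 < ?b j + x" if "0 \<le> x" for j :: nat and x
    using \<beta> that by (intro add_pos_nonneg) auto
  have m0: "?m p 0 = ?m 0 0" for p
  proof (induction p)
    case (Suc p)
    have "(\<Prod>j<n. ?q p 0 j) = 1"
    proof (rule prod.neutral, rule ballI)
      fix j
      show "?q p 0 j = 1"
        using pos[of p j] by (simp add: add_ac)
    qed
    then show ?case unfolding circular_moment_step[OF c \<beta>] Suc by simp
  qed simp
  have base: "?m 0 r = ?m 0 0" for r
    using m0[of r] circular_moment_cnj[of c n \<beta> 0 r] circular_moment_cnj[of c n \<beta> 0 0] by simp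
  show ?thesis
  proof (induction p)
    case 0
    have "circular_ratio n \<beta> 0 r = 1"
      unfolding circular_ratio_def
    proof (rule prod.neutral, rule ballI)
      fix j
      have "0 < pochhammer (?b j) r" using pos[of 0 j] by (intro pochhammer_pos) simp
      then show "pochhammer (?b j + real 0) r / pochhammer (?b j) r = 1" by simp
    qed
    then show ?case by (simp only: base[of r] of_real_1 mult_1_right)
  next
    case (Suc p)
    have "circular_ratio n \<beta> p r * (\<Prod>j<n. ?q p r j) =
        circular_ratio n \<beta> (Suc p) r"
      unfolding circular_ratio_def prod.distrib[symmetric]
    proof (intro prod.cong refl)
      fix j
      define a where "a = ?b j + real p"
      have a: "0 < a" using pos[of p j] by (simp add: a_def)
      have "a * pochhammer (a + 1) r = pochhammer a r * (a + r)"
        using pochhammer_rec[of a r] pochhammer_Suc[of a r] by simp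
      then have "pochhammer (a + 1) r = pochhammer a r * ((a + r) / a)" using a by (simp add: field_simps)
      moreover have "?b j + real (Suc p) = a + 1" "1 + real p + real r + real j * (\<beta> / 2) = a + r"
        "1 + real p + real j * (\<beta> / 2) = a" "?b j + real p = a" by (simp_all add: a_def)
      ultimately show "pochhammer (?b j + real p) r / pochhammer (?b j) r *
          (?q p r j) =
        pochhammer (?b j + real (Suc p)) r / pochhammer (?b j) r"
        by (simp only: times_divide_times_eq times_divide_eq_right times_divide_eq_left divide_divide_eq_left mult.commute)
    qed
    then show ?case unfolding circular_moment_step[OF c \<beta>] Suc mult.assoc of_real_mult[symmetric] by simp
  qed
qed

text \<open>
  The Chu-Vandermonde identity at \<open>- p\<close> and \<open>- r\<close>, written with binomial coefficients.
\<close>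

lemma binomial_sum_eq_pochhammer_ratio:
  fixes c :: real
  assumes c: "0 < c"
  shows "(\<Sum>i\<le>p. real (p choose i) * real (r choose i) * (fact i / pochhammer c i)) = pochhammer (c + p) r / pochhammer c r"
proof -
  let ?t = "\<lambda>i. real (p choose i) * real (r choose i) * (fact i / pochhammer c i)"
  have bin: "real (m choose i) = (-1) ^ i * pochhammer (- real m) i / fact i" for m i
    by (simp add: binomial_gbinomial gbinomial_pochhammer)
  \<comment> \<open>the two signs from the negative arguments cancel\<close>
  have tm: "?t i = pochhammer (- real p) i * pochhammer (- real r) i / (of_nat (fact i) * pochhammer c i)" for i
  proof -
    have "(-1) ^ i * (-1) ^ i = (1 :: real)" by (simp flip: power_add)
    then have "?t i = (((-1) ^ i * (-1) ^ i) * pochhammer (- real p) i * pochhammer (- real r) i / fact i) * (1 / pochhammer c i)"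
      unfolding bin by simp
    then show ?thesis by (simp flip: power_add)
  qed
  have "(\<Sum>i\<le>p. ?t i) = (\<Sum>i\<le>p + r. ?t i)"
    by (rule sum.mono_neutral_left) auto
  also have "\<dots> = (\<Sum>i\<in>{0..r}. ?t i)"
    by (rule sum.mono_neutral_right) auto
  also have "\<dots> = pochhammer (c - - real p) r / pochhammer c r"
    unfolding tm by (rule Vandermonde_pochhammer) (use c in auto)
  finally show ?thesis by simp
qed

lemma integral_uniform_circle:
  "(\<integral>z. z ^ i * cnj z ^ j \<partial>uniform_circle) = (if i = j then 1 else 0)"
proof -
  have [measurable]: "cis \<in> borel_measurable borel"
    by (intro borel_measurable_continuous_onI continuous_intros)
  have [measurable]: "cis \<in> measurable (uniform_measure lborel {-pi..pi}) borel"
    by (simp add: uniform_measure_def)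
  have um: "uniform_measure lborel {-pi..pi} = density lborel (\<lambda>x. ennreal (indicator {-pi..pi} x / (2 * pi)))"
    unfolding uniform_measure_def
    by (intro density_cong) (auto simp: indicator_def divide_ennreal[symmetric] simp flip: ennreal_1)
  have "(\<integral>z. z ^ i * cnj z ^ j \<partial>uniform_circle) = (\<integral>x. cis x ^ i * cnj (cis x) ^ j \<partial>uniform_measure lborel {-pi..pi})"
    unfolding uniform_circle_def by (rule integral_distr) measurable
  also have "\<dots> = (\<integral>x. (indicator {-pi..pi} x / (2 * pi)) *\<^sub>R (cis x ^ i * cnj (cis x) ^ j) \<partial>lborel)"
    unfolding um
  proof (rule integral_density)
    have "(\<lambda>x. cis x ^ i * cnj (cis x) ^ j) \<in> borel_measurable borel"
      by (intro borel_measurable_continuous_onI continuous_intros)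
    then show "(\<lambda>x. cis x ^ i * cnj (cis x) ^ j) \<in> borel_measurable lborel"
      by (simp only: measurable_lborel2)
  qed auto
  also have "\<dots> = (\<integral>x. (1 / (2 * pi)) *\<^sub>R (indicator {-pi..pi} x *\<^sub>R cis ((real i - real j) * x)) \<partial>lborel)"
    by (intro Bochner_Integration.integral_cong refl)
      (simp add: cis_cnj Complex.DeMoivre cis_mult algebra_simps)
  also have "\<dots> = (1 / (2 * pi)) *\<^sub>R (\<integral>x. indicator {-pi..pi} x *\<^sub>R cis ((real i - real j) * x) \<partial>lborel)"
    by (simp only: integral_scaleR_right)
  also have "\<dots> = (if i = j then 1 else 0)"
  proof (cases "i = j")
    case False
    define k where "k = real i - real j"
    have k: "k \<noteq> 0" using False by (simp add: k_def)
    have "(\<integral>x. indicator {-pi..pi} x *\<^sub>R cis (k * x) \<partial>lborel) = cis (k * pi) / (\<i> * k) - cis (k * (- pi)) / (\<i> * k)"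
    proof (rule integral_FTC_atLeastAtMost)
      fix x
      have "((\<lambda>x. cis (k * x)) has_vector_derivative k *\<^sub>R (\<i> * cis (k * x))) (at x within {-pi..pi})"
        unfolding has_vector_derivative_def
        by (rule derivative_eq_intros refl)+ (auto simp: mult.commute)
      then have "((\<lambda>x. cis (k * x) / (\<i> * k)) has_vector_derivative (k *\<^sub>R (\<i> * cis (k * x))) / (\<i> * k)) (at x within {-pi..pi})"
        by (rule has_vector_derivative_divide)
      then show "((\<lambda>x. cis (k * x) / (\<i> * k)) has_vector_derivative cis (k * x)) (at x within {-pi..pi})"
        using k by (simp add: scaleR_conv_of_real)
    qed (auto intro!: continuous_intros)
    also have "\<dots> = 0"
    proof -
      have "sin (k * pi) = 0"
        unfolding sin_zero_iff_int2 k_def by (intro exI[of _ "int i - int j"]) simp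
      then have "cis (k * (- pi)) = cis (k * pi)" by (simp add: complex_eq_iff)
      then show ?thesis by (simp only: diff_self)
    qed
    finally show ?thesis using False by (simp add: k_def)
  qed simp
  finally show ?thesis .
qed

lemma integral_beta_weight_unit:
  assumes s: "0 < s" and t: "0 < t"
  shows "(\<integral>x. beta_weight 0 1 t s x \<partial>lborel) = Beta s t"
  using has_integral_integral_lborel[OF integrable_beta_weight[OF t s zero_less_one]] has_integral_beta_weight_unit[OF t s]
  by (rule has_integral_unique)

lemma beta_unit_eq_density:
  assumes "0 < t"
  shows "beta_unit 1 t = density lborel (\<lambda>x. ennreal (Gamma (1 + t) / (Gamma 1 * Gamma t) * beta_weight 0 1 t 1 x))"
  using assms unfolding beta_unit_def by (auto simp: beta_weight_def mult_ac intro!: density_cong)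

lemma AE_beta_unit:
  assumes t: "0 \<le> t"
  shows "AE x in beta_unit 1 t. x \<in> {0..1}"
proof (cases "t = 0")
  case True
  then have "beta_unit 1 t = return borel 1" by (simp add: beta_unit_def)
  then show ?thesis by (simp only:) (subst AE_return, auto)
next
  case False
  then have "0 < t" using t by simp
  then show ?thesis
    by (simp only: beta_unit_eq_density) (subst AE_density, auto simp: beta_weight_def indicator_def split: if_splits intro!: AE_I2)
qed

text \<open>
  The point mass at 1, which is the case \<open>t = 0\<close>, is covered because \<open>pochhammer 1 i = fact i\<close>.
\<close>

lemma beta_unit_moment:
  assumes t: "0 \<le> t"
  shows "(\<integral>x. x ^ i \<partial>beta_unit 1 t) = fact i / pochhammer (1 + t) i"
proof (cases "t = 0")
  case True
  then show ?thesis by (simp add: beta_unit_def integral_return pochhammer_fact[symmetric])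
next
  case False
  then have t: "0 < t" using t by simp
  let ?C = "Gamma (1 + t) / (Gamma 1 * Gamma t)"
  have G: "0 < Gamma t" "0 < Gamma (1 + t)" using t by (auto intro: Gamma_real_pos)
  have pw: "x ^ i * beta_weight 0 1 t 1 x = beta_weight 0 1 t (real i + 1) x" if "x \<noteq> 0" for x
    using that by (auto simp: beta_weight_def powr_realpow indicator_def)
  have "(\<integral>x. x ^ i \<partial>beta_unit 1 t) = (\<integral>x. (?C * beta_weight 0 1 t 1 x) *\<^sub>R x ^ i \<partial>lborel)"
    unfolding beta_unit_eq_density[OF t]
  proof (rule integral_density)
    show "AE x in lborel. 0 \<le> ?C * beta_weight 0 1 t 1 x"
      using G beta_weight_nonneg by (intro AE_I2 mult_nonneg_nonneg) (auto simp: less_imp_le)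
  qed measurable
  also have "\<dots> = (\<integral>x. ?C * beta_weight 0 1 t (real i + 1) x \<partial>lborel)"
  proof (rule integral_cong_AE)
    show "AE x in lborel. (?C * beta_weight 0 1 t 1 x) *\<^sub>R x ^ i = ?C * beta_weight 0 1 t (real i + 1) x"
      using AE_lborel_singleton[of "0::real"]
    proof eventually_elim
      case (elim x)
      show ?case unfolding pw[OF elim, symmetric] by simp
    qed
  qed measurable
  also have "\<dots> = ?C * Beta (real i + 1) t"
    using t by (simp only: integral_mult_right_zero) (subst integral_beta_weight_unit, auto)
  also have "\<dots> = fact i / pochhammer (1 + t) i"
  proof (induction i)
    case 0
    show ?case using G by (simp add: Beta_def)
  next
    case (Suc i)
    have nz: "real i + 1 \<notin> \<int>\<^sub>\<le>\<^sub>0" using nonpos_Ints_nonpos[of "real i + 1"] by auto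
    have pos: "0 < 1 + t + real i" using t by simp
    have "(real i + 1 + t) * Beta (real i + 1 + 1) t = (real i + 1) * Beta (real i + 1) t"
      by (rule Beta_plus1_left[OF nz])
    then have "Beta (real i + 1 + 1) t = (real i + 1) / (1 + t + real i) * Beta (real i + 1) t"
      using pos by (simp add: field_simps)
    moreover have "real (Suc i) + 1 = real i + 1 + 1" by simp
    ultimately have "?C * Beta (real (Suc i) + 1) t = (real i + 1) / (1 + t + real i) * (?C * Beta (real i + 1) t)"
      by (simp only: mult.left_commute)
    also have "\<dots> = fact (Suc i) / pochhammer (1 + t) (Suc i)"
      unfolding Suc using pos by (simp add: pochhammer_Suc add_ac)
    finally show ?case .
  qed
  finally show ?thesis .
qed

text \<open>
  In the binomial expansion of both powers the uniform angle annihilates all terms except those with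
  equal exponents, which contain integer powers of the beta variable only.
\<close>

lemma circular_factor_moment:
  fixes N :: "'b measure" and \<phi> X :: "nat \<Rightarrow> 'b \<Rightarrow> real"
  assumes N: "prob_space N"
    and indep: "prob_space.indep_vars N (\<lambda>_. borel) (case_sum \<phi> X) {Inl k, Inr j}"
    and \<phi>: "distr N borel (\<lambda>\<omega>. cis (\<phi> k \<omega>)) = uniform_circle"
    and X: "distr N borel (X j) = beta_unit 1 t" and t: "0 \<le> t"
  shows "(\<integral>\<omega>. (1 + cis (\<phi> k \<omega>) * of_real (sqrt (X j \<omega>))) ^ p * cnj (1 + cis (\<phi> k \<omega>) * of_real (sqrt (X j \<omega>))) ^ r \<partial>N) =
    of_real (pochhammer (1 + t + p) r / pochhammer (1 + t) r)"
proof -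
  let ?U = "\<lambda>\<omega>. cis (\<phi> k \<omega>) * complex_of_real (sqrt (X j \<omega>))"
  let ?m = "\<lambda>i. complex_of_real (fact i / pochhammer (1 + t) i)"
  let ?c = "\<lambda>i. complex_of_real (real (p choose i) * real (r choose i) * (fact i / pochhammer (1 + t) i))"
  interpret N: prob_space N by fact
  have meas [measurable]: "\<phi> k \<in> borel_measurable N" "X j \<in> borel_measurable N"
    using indep unfolding N.indep_vars_def by auto
  have [measurable]: "cis \<in> borel_measurable borel"
    by (intro borel_measurable_continuous_onI continuous_intros)
  have X_bd: "AE \<omega> in N. X j \<omega> \<in> {0..1}"
  proof -
    have "AE x in distr N borel (X j). x \<in> {0..1}" unfolding X by (rule AE_beta_unit[OF t])
    then show ?thesis by (subst (asm) AE_distr_iff) auto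
  qed
  define T where "T i m \<omega> = (cis (\<phi> k \<omega>) ^ i * cnj (cis (\<phi> k \<omega>)) ^ m) * complex_of_real (sqrt (X j \<omega>) ^ (i + m))" for i m \<omega>
  have T: "integrable N (T i m)" "(\<integral>\<omega>. T i m \<omega> \<partial>N) = (if i = m then ?m i else 0)" for i m
  proof -
    define F where "F = case_sum (\<lambda>_::nat. \<lambda>v. cis v ^ i * cnj (cis v) ^ m) (\<lambda>_::nat. \<lambda>v. complex_of_real (sqrt v ^ (i + m)))"
    have F_meas: "F s \<in> borel_measurable borel" for s
      unfolding F_def by (cases s) (auto intro!: borel_measurable_continuous_onI continuous_intros)
    have ind: "N.indep_vars (\<lambda>_. borel) (\<lambda>s \<omega>. F s (case_sum \<phi> X s \<omega>)) {Inl k, Inr j}"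
      by (rule N.indep_vars_compose2[OF indep]) (rule F_meas)
    have m1: "(\<lambda>\<omega>. F (Inl k) (\<phi> k \<omega>)) \<in> borel_measurable N" and m2: "(\<lambda>\<omega>. F (Inr j) (X j \<omega>)) \<in> borel_measurable N"
      using measurable_compose[OF meas(1) F_meas] measurable_compose[OF meas(2) F_meas] by auto
    have i1: "integrable N (\<lambda>\<omega>. F (Inl k) (\<phi> k \<omega>))"
      using m1 by (intro N.integrable_const_bound[where B = 1]) (auto simp: F_def norm_mult norm_power)
    have i2: "integrable N (\<lambda>\<omega>. F (Inr j) (X j \<omega>))"
    proof (rule N.integrable_const_bound[where B = 1])
      show "AE \<omega> in N. norm (F (Inr j) (X j \<omega>)) \<le> 1"
        using X_bd by eventually_elim (auto simp: F_def norm_power intro!: power_le_one)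
    qed (rule m2)
    have ints: "integrable N (\<lambda>\<omega>. F s (case_sum \<phi> X s \<omega>))" if "s \<in> {Inl k, Inr j}" for s
      using that i1 i2 by auto
    have prod: "(\<Prod>s\<in>{Inl k, Inr j}. F s (case_sum \<phi> X s \<omega>)) = T i m \<omega>" for \<omega>
      by (simp add: F_def T_def)
    show "integrable N (T i m)"
      using N.indep_vars_integrable[OF _ ind ints] unfolding prod by simp
    have "(\<integral>\<omega>. T i m \<omega> \<partial>N) = (\<Prod>s\<in>{Inl k, Inr j}. \<integral>\<omega>. F s (case_sum \<phi> X s \<omega>) \<partial>N)"
      using N.indep_vars_lebesgue_integral[OF _ ind ints] unfolding prod by simp
    also have "\<dots> = (\<integral>\<omega>. cis (\<phi> k \<omega>) ^ i * cnj (cis (\<phi> k \<omega>)) ^ m \<partial>N) * (\<integral>\<omega>. complex_of_real (sqrt (X j \<omega>) ^ (i + m)) \<partial>N)"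
      by (simp add: F_def)
    also have "(\<integral>\<omega>. cis (\<phi> k \<omega>) ^ i * cnj (cis (\<phi> k \<omega>)) ^ m \<partial>N) = (\<integral>z. z ^ i * cnj z ^ m \<partial>uniform_circle)"
      unfolding \<phi>[symmetric] by (subst integral_distr) auto
    also have "\<dots> = (if i = m then 1 else 0)" by (rule integral_uniform_circle)
    also have "(if i = m then 1 else 0) * (\<integral>\<omega>. complex_of_real (sqrt (X j \<omega>) ^ (i + m)) \<partial>N) =
        (if i = m then ?m i else 0)"
    proof (cases "i = m")
      case True
      have "(\<integral>\<omega>. sqrt (X j \<omega>) ^ (i + m) \<partial>N) = (\<integral>\<omega>. X j \<omega> ^ i \<partial>N)"
      proof (rule integral_cong_AE)
        show "AE \<omega> in N. sqrt (X j \<omega>) ^ (i + m) = X j \<omega> ^ i"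
          using X_bd
        proof eventually_elim
          case (elim \<omega>)
          then have "sqrt (X j \<omega>) ^ (i + i) = (sqrt (X j \<omega>) * sqrt (X j \<omega>)) ^ i" by (simp only: power_add power_mult_distrib)
          also have "sqrt (X j \<omega>) * sqrt (X j \<omega>) = X j \<omega>" using elim by simp
          finally show ?case using True by simp
        qed
      qed measurable
      also have "\<dots> = (\<integral>x. x ^ i \<partial>beta_unit 1 t)"
        unfolding X[symmetric] by (subst integral_distr) auto
      also have "\<dots> = fact i / pochhammer (1 + t) i" by (rule beta_unit_moment[OF t])
      finally show ?thesis using True by (simp only: integral_complex_of_real) simp
    qed simp
    finally show "(\<integral>\<omega>. T i m \<omega> \<partial>N) = (if i = m then ?m i else 0)" .
  qed
  have expand: "(1 + u) ^ p * cnj (1 + u) ^ r = (\<Sum>i\<le>p. \<Sum>m\<le>r. of_nat (p choose i) * of_nat (r choose m) * (u ^ i * cnj u ^ m))" for u :: complex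
  proof -
    have "(1 + u) ^ p = (\<Sum>i\<le>p. of_nat (p choose i) * u ^ i)" "cnj (1 + u) ^ r = (\<Sum>m\<le>r. of_nat (r choose m) * cnj u ^ m)"
      using binomial_ring[of u 1 p] binomial_ring[of "cnj u" 1 r] by (simp_all add: add.commute)
    then show ?thesis by (simp only: sum_product) (simp only: mult_ac)
  qed
  have uT: "?U \<omega> ^ i * cnj (?U \<omega>) ^ m = T i m \<omega>" for i m \<omega>
    unfolding T_def by (simp add: power_mult_distrib power_add)
  have "(\<integral>\<omega>. (1 + ?U \<omega>) ^ p * cnj (1 + ?U \<omega>) ^ r \<partial>N) =
      (\<Sum>i\<le>p. \<Sum>m\<le>r. of_nat (p choose i) * of_nat (r choose m) * (\<integral>\<omega>. T i m \<omega> \<partial>N))"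
    unfolding expand uT
    by (simp only: Bochner_Integration.integral_sum Bochner_Integration.integrable_sum integrable_mult_right T(1) integral_mult_right_zero)
  also have "\<dots> = (\<Sum>i\<le>p. ?c i)"
  proof (rule sum.cong[OF refl])
    fix i
    have "(\<Sum>m\<le>r. of_nat (p choose i) * of_nat (r choose m) * (\<integral>\<omega>. T i m \<omega> \<partial>N)) =
        (\<Sum>m\<le>r. if i = m then ?c i else 0)"
      unfolding T(2) by (intro sum.cong refl) simp
    also have "\<dots> = ?c i"
      by (subst sum.delta') (auto simp: binomial_eq_0)
    finally show "(\<Sum>m\<le>r. of_nat (p choose i) * of_nat (r choose m) * (\<integral>\<omega>. T i m \<omega> \<partial>N)) = \<dots>" .
  qed
  also have "\<dots> = of_real (pochhammer (1 + t + p) r / pochhammer (1 + t) r)"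
    unfolding of_real_sum[symmetric] using t by (subst binomial_sum_eq_pochhammer_ratio) auto
  finally show ?thesis .
qed

text \<open>
  The ensemble is specified by bounded symmetric test functions, so the monomial is cut off outside
  the disc of radius \<open>2 ^ n\<close>, which contains all values of the product. The test function 1 supplies
  the normalization.
\<close>

lemma circular_ensemble_moment:
  fixes M :: "'a measure" and \<eta> :: "nat \<Rightarrow> 'a \<Rightarrow> real"
  assumes ens: "circular_beta_ensemble M n \<beta> (\<lambda>k \<omega>. cis (\<eta> k \<omega>))" and \<beta>: "0 < \<beta>" and c: "norm c = 1"
  shows "(\<integral>\<omega>. (\<Prod>k=1..n. 1 - c * cis (\<eta> k \<omega>)) ^ p * cnj (\<Prod>k=1..n. 1 - c * cis (\<eta> k \<omega>)) ^ r \<partial>M) = of_real (circular_ratio n \<beta> p r)"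
proof -
  let ?P = "lborel_n n"
  let ?Z = "\<lambda>z. \<Prod>k=1..n. 1 - c * z k"
  interpret M: prob_space M using ens by (simp add: circular_beta_ensemble_def)
  define K where "K = complex_of_real (1 / circular_Z n \<beta>) * of_real (1 / (2 * pi) ^ n)"
  have bd: "norm (?Z z) \<le> 2 ^ n" if "\<And>k. k \<in> {1..n} \<Longrightarrow> norm (z k) = 1" for z
  proof -
    have "norm (?Z z) \<le> 2 ^ card {1..n}"
    proof (rule norm_prod_le_power)
      fix k assume "k \<in> {1..n}"
      then show "norm (1 - c * z k) \<le> 2"
        using norm_triangle_ineq4[of 1 "c * z k"] c that by (simp add: norm_mult)
    qed
    then show ?thesis by simp
  qed
  have main: "(\<integral>\<omega>. ?Z (\<lambda>k. cis (\<eta> k \<omega>)) ^ p * cnj (?Z (\<lambda>k. cis (\<eta> k \<omega>))) ^ r \<partial>M) = K * circular_moment c n \<beta> p r" for p r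
  proof -
    define g where "g w = (if norm w \<le> 2 ^ n then w ^ p * cnj w ^ r else 0)" for w :: complex
    define f where "f z = g (?Z z)" for z
    have g_bd: "norm (g w) \<le> (2 ^ n) ^ (p + r)" for w
      unfolding g_def by (auto simp: norm_mult norm_power power_add[symmetric] intro: power_mono)
    have f_bd: "bounded (range f)"
      unfolding bounded_iff f_def using g_bd by blast
    have g_meas: "g \<in> borel_measurable borel"
    proof -
      show ?thesis unfolding g_def by measurable
    qed
    have Z_meas: "?Z \<in> borel_measurable (Pi\<^sub>M {1..n} (\<lambda>_. borel))"
    proof (rule borel_measurable_prod)
      fix k assume "k \<in> {1..n}"
      then have [measurable]: "(\<lambda>z. z k) \<in> borel_measurable (Pi\<^sub>M {1..n} (\<lambda>_. borel :: complex measure))"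
        by (rule measurable_component_singleton)
      show "(\<lambda>z. 1 - c * z k) \<in> borel_measurable (Pi\<^sub>M {1..n} (\<lambda>_. borel))" by measurable
    qed
    have f_meas: "f \<in> borel_measurable (Pi\<^sub>M {1..n} (\<lambda>_. borel))"
      unfolding f_def by (rule measurable_compose[OF Z_meas g_meas])
    have f_sym: "symmetric_fun n f"
      unfolding symmetric_fun_def
    proof (intro allI impI)
      fix p' and z :: "nat \<Rightarrow> complex" assume p': "p' permutes {1..n}"
      have "?Z (z \<circ> p') = ?Z z"
        unfolding o_def by (rule prod.reindex_bij_betw[OF permutes_imp_bij[OF p']])
      then show "f (z \<circ> p') = f z" by (simp only: f_def)
    qed
    have f_cis: "f (\<lambda>k\<in>{1..n}. cis (y k)) = ?Z (\<lambda>k. cis (y k)) ^ p * cnj (?Z (\<lambda>k. cis (y k))) ^ r" for y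
    proof -
      have "?Z (\<lambda>k\<in>{1..n}. cis (y k)) = ?Z (\<lambda>k. cis (y k))" by (intro prod.cong refl) auto
      moreover have "norm (?Z (\<lambda>k. cis (y k))) \<le> 2 ^ n" by (rule bd) simp
      ultimately show ?thesis unfolding f_def g_def by (simp only: if_True)
    qed
    have "(\<integral>\<omega>. f (\<lambda>k\<in>{1..n}. cis (\<eta> k \<omega>)) \<partial>M) = complex_of_real (1 / circular_Z n \<beta>) *
        (LINT y:({1..n} \<rightarrow>\<^sub>E {-pi..pi})|?P. f (\<lambda>k\<in>{1..n}. cis (y k)) *
           complex_of_real (norm (vandermonde n (\<lambda>k. cis (y k))) powr \<beta> / (2 * pi) ^ n))"
      using ens f_meas f_bd f_sym unfolding circular_beta_ensemble_def by blast
    also have "(LINT y:({1..n} \<rightarrow>\<^sub>E {-pi..pi})|?P. f (\<lambda>k\<in>{1..n}. cis (y k)) *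
           complex_of_real (norm (vandermonde n (\<lambda>k. cis (y k))) powr \<beta> / (2 * pi) ^ n)) =
        (\<integral>y. of_real (1 / (2 * pi) ^ n) * ((\<Prod>i=1..n. circular_weight c p r (y i)) *
     of_real (norm (vandermonde n (\<lambda>k. cis (y k))) powr \<beta>)) \<partial>?P)"
      unfolding set_lebesgue_integral_def
    proof (intro Bochner_Integration.integral_cong refl)
      fix y assume "y \<in> space ?P"
      then have "y \<in> extensional {1..n}" by (simp add: space_PiM PiE_iff)
      then have ind: "(\<Prod>i=1..n. indicator {-pi..pi} (y i)) = (indicator ({1..n} \<rightarrow>\<^sub>E {-pi..pi}) y :: real)"
        by (rule prod_indicator_PiE) simp
      have "(\<Prod>i=1..n. circular_weight c p r (y i)) = of_real (\<Prod>i=1..n. indicator {-pi..pi} (y i)) *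
          (?Z (\<lambda>k. cis (y k)) ^ p * cnj (?Z (\<lambda>k. cis (y k))) ^ r)"
        unfolding circular_weight_def prod.distrib prod_power_distrib cnj_prod of_real_prod ..
      then show "indicator ({1..n} \<rightarrow>\<^sub>E {-pi..pi}) y *\<^sub>R (f (\<lambda>k\<in>{1..n}. cis (y k)) *
           complex_of_real (norm (vandermonde n (\<lambda>k. cis (y k))) powr \<beta> / (2 * pi) ^ n)) =
        of_real (1 / (2 * pi) ^ n) * ((\<Prod>i=1..n. circular_weight c p r (y i)) *
           of_real (norm (vandermonde n (\<lambda>k. cis (y k))) powr \<beta>))"
        unfolding f_cis ind by (simp add: scaleR_conv_of_real)
    qed
    finally show ?thesis
      unfolding f_cis by (simp only: K_def circular_moment_def integral_mult_right_zero mult.assoc)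
  qed
  have "K * circular_moment c n \<beta> 0 0 = 1"
    using main[of 0 0] by (simp add: M.prob_space)
  then show ?thesis unfolding main circular_moment_eq[OF c \<beta>, of n p r] by (simp only: mult.assoc[symmetric] mult_1_left)
qed

text \<open>
  The factors \<open>1 + cis (\<phi> k) * sqrt (X (k - 1))\<close> are independent since they are built from disjoint
  groups of the given independent variables.
\<close>

lemma circular_law:
  fixes M :: "'a measure" and N :: "'b measure" and \<eta> :: "nat \<Rightarrow> 'a \<Rightarrow> real" and \<phi> X :: "nat \<Rightarrow> 'b \<Rightarrow> real"
  assumes \<beta>: "0 < \<beta>"
    and ens: "circular_beta_ensemble M n \<beta> (\<lambda>k \<omega>. cis (\<eta> k \<omega>))"
    and N: "prob_space N"
    and indep: "prob_space.indep_vars N (\<lambda>_. borel) (case_sum \<phi> X) ({1..n} <+> {0..<n})"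
    and \<phi>: "\<forall>k\<in>{1..n}. distr N borel (\<lambda>\<omega>. cis (\<phi> k \<omega>)) = uniform_circle"
    and X: "\<forall>j\<in>{0..<n}. distr N borel (X j) = beta_unit 1 (real j * \<beta> / 2)"
  shows "distr M borel (\<lambda>\<omega>. \<Prod>k=1..n. 1 - cis (- (\<theta> - \<eta> k \<omega>))) =
        distr N borel (\<lambda>\<omega>. \<Prod>k=1..n. 1 + cis (\<phi> k \<omega>) * complex_of_real (sqrt (X (k - 1) \<omega>)))"
proof -
  interpret N: prob_space N by fact
  have M: "prob_space M" using ens by (simp add: circular_beta_ensemble_def)
  define c where "c = cis (- \<theta>)"
  have c: "norm c = 1" by (simp add: c_def)
  have cis: "cis (- (\<theta> - y)) = c * cis y" for y by (simp add: c_def cis_mult)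
  let ?Z = "\<lambda>\<omega>. \<Prod>k=1..n. 1 - c * cis (\<eta> k \<omega>)"
  define V where "V k \<omega> = 1 + cis (\<phi> k \<omega>) * complex_of_real (sqrt (X (k - 1) \<omega>))" for k \<omega>
  have rv: "\<forall>s\<in>{1..n} <+> {0..<n}. case_sum \<phi> X s \<in> borel_measurable N"
    using indep unfolding N.indep_vars_def by blast
  have X_meas: "X j \<in> borel_measurable N" if "j \<in> {0..<n}" for j
    using bspec[OF rv InrI[OF that]] by simp
  have [measurable]: "cis \<in> borel_measurable borel"
    by (intro borel_measurable_continuous_onI continuous_intros)
  have V_bd: "AE \<omega> in N. norm (V k \<omega>) \<le> 2" if k: "k \<in> {1..n}" for k
  proof -
    let ?u = "\<lambda>\<omega>. cis (\<phi> k \<omega>) * complex_of_real (sqrt (X (k - 1) \<omega>))"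
    have j: "k - 1 \<in> {0..<n}" using k by auto
    have "distr N borel (X (k - 1)) = beta_unit 1 (real (k - 1) * \<beta> / 2)" using X j by blast
    moreover have "AE x in beta_unit 1 (real (k - 1) * \<beta> / 2). x \<in> {0..1}" using \<beta> by (intro AE_beta_unit) simp
    ultimately have "AE x in distr N borel (X (k - 1)). x \<in> {0..1}" by (simp only:)
    then have "AE \<omega> in N. X (k - 1) \<omega> \<in> {0..1}" using X_meas[OF j] by (subst (asm) AE_distr_iff) auto
    then show ?thesis
    proof eventually_elim
      case (elim \<omega>)
      then have "norm (?u \<omega>) \<le> 1" by (simp add: norm_mult)
      then show ?case unfolding V_def using norm_triangle_ineq[of 1 "?u \<omega>"] by simp
    qed
  qed
  have V_indep: "N.indep_vars (\<lambda>_. borel) (\<lambda>k \<omega>. V k \<omega> ^ p * cnj (V k \<omega>) ^ r) {1..n}" for p r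
  proof -
    let ?K = "\<lambda>k::nat. {Inl k, Inr (k - 1)} :: (nat + nat) set"
    let ?u = "\<lambda>k f. 1 + cis (f (Inl k)) * complex_of_real (sqrt (f (Inr (k - 1))))"
    let ?g = "\<lambda>k f. ?u k f ^ p * cnj (?u k f) ^ r"
    have "N.indep_vars (\<lambda>k. Pi\<^sub>M (?K k) (\<lambda>_. borel)) (\<lambda>k \<omega>. restrict (\<lambda>s. case_sum \<phi> X s \<omega>) (?K k)) {1..n}"
      by (rule N.indep_vars_restrict[OF indep]) (auto simp: disjoint_family_on_def)
    then have "N.indep_vars (\<lambda>_. borel) (\<lambda>k \<omega>. ?g k (restrict (\<lambda>s. case_sum \<phi> X s \<omega>) (?K k))) {1..n}"
    proof (rule N.indep_vars_compose2)
      fix k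
      have [measurable]: "(\<lambda>f. f (Inl k)) \<in> borel_measurable (Pi\<^sub>M (?K k) (\<lambda>_. borel :: real measure))"
        "(\<lambda>f. f (Inr (k - 1))) \<in> borel_measurable (Pi\<^sub>M (?K k) (\<lambda>_. borel :: real measure))"
        by (intro measurable_component_singleton; simp)+
      have "(\<lambda>f. (\<lambda>z. z ^ p * cnj z ^ r) (?u k f)) \<in> borel_measurable (Pi\<^sub>M (?K k) (\<lambda>_. borel))"
        by (rule measurable_compose[where N = borel]) measurable
      then show "?g k \<in> borel_measurable (Pi\<^sub>M (?K k) (\<lambda>_. borel))" .
    qed
    then show ?thesis by (simp add: V_def)
  qed
  have V_meas: "V k \<in> borel_measurable N" if "k \<in> {1..n}" for k
    using V_indep[of 1 0] that unfolding N.indep_vars_def by simp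
  have V_int: "integrable N (\<lambda>\<omega>. V k \<omega> ^ p * cnj (V k \<omega>) ^ r)" if k: "k \<in> {1..n}" for k p r
  proof (rule N.integrable_const_bound)
    show "AE \<omega> in N. norm (V k \<omega> ^ p * cnj (V k \<omega>) ^ r) \<le> 2 ^ (p + r)"
      using V_bd[OF k] by eventually_elim (auto simp: norm_mult norm_power power_add[symmetric] intro: power_mono)
    show "(\<lambda>\<omega>. V k \<omega> ^ p * cnj (V k \<omega>) ^ r) \<in> borel_measurable N"
      using V_indep[of p r] k unfolding N.indep_vars_def by auto
  qed
  have V_moment: "(\<integral>\<omega>. V k \<omega> ^ p * cnj (V k \<omega>) ^ r \<partial>N) =
      of_real (pochhammer (1 + real (k - 1) * (\<beta> / 2) + p) r / pochhammer (1 + real (k - 1) * (\<beta> / 2)) r)"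
    if k: "k \<in> {1..n}" for k p r
  proof -
    have j: "k - 1 \<in> {0..<n}" using k by auto
    have "N.indep_vars (\<lambda>_. borel) (case_sum \<phi> X) {Inl k, Inr (k - 1)}"
      using indep by (rule N.indep_vars_subset) (use k j in auto)
    from circular_factor_moment[OF N this, of "real (k - 1) * \<beta> / 2" p r] show ?thesis
      using \<phi> X k j \<beta> unfolding V_def by simp
  qed
  have moments: "(\<integral>\<omega>. ?Z \<omega> ^ p * cnj (?Z \<omega>) ^ r \<partial>M) = (\<integral>\<omega>. (\<Prod>k=1..n. V k \<omega>) ^ p * cnj (\<Prod>k=1..n. V k \<omega>) ^ r \<partial>N)" for p r
  proof -
    have "(\<integral>\<omega>. (\<Prod>k=1..n. V k \<omega>) ^ p * cnj (\<Prod>k=1..n. V k \<omega>) ^ r \<partial>N) = (\<integral>\<omega>. (\<Prod>k=1..n. V k \<omega> ^ p * cnj (V k \<omega>) ^ r) \<partial>N)"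
      by (simp only: cnj_prod prod_power_distrib prod.distrib)
    also have "\<dots> = (\<Prod>k=1..n. \<integral>\<omega>. V k \<omega> ^ p * cnj (V k \<omega>) ^ r \<partial>N)"
      by (rule N.indep_vars_lebesgue_integral[OF _ V_indep V_int]) simp_all
    also have "\<dots> = (\<Prod>k=1..n. of_real (pochhammer (1 + real (k - 1) * (\<beta> / 2) + p) r / pochhammer (1 + real (k - 1) * (\<beta> / 2)) r))"
      by (intro prod.cong refl V_moment)
    also have "\<dots> = of_real (circular_ratio n \<beta> p r)"
      unfolding circular_ratio_def of_real_prod
      by (rule prod.reindex_bij_witness[of _ Suc "\<lambda>k. k - 1"]) auto
    finally show ?thesis using circular_ensemble_moment[OF ens \<beta> c, of p r] by (simp only:)
  qed
  have "distr M borel ?Z = distr N borel (\<lambda>\<omega>. \<Prod>k=1..n. V k \<omega>)"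
  proof (rule distr_eq_of_moments[OF M N _ _ _ _ moments])
    have "(\<lambda>\<omega>. cis (\<eta> k \<omega>)) \<in> borel_measurable M" if "k \<in> {1..n}" for k
      using ens that by (simp add: circular_beta_ensemble_def)
    then show "?Z \<in> borel_measurable M"
      by (intro borel_measurable_prod borel_measurable_diff borel_measurable_times borel_measurable_const)
    show "(\<lambda>\<omega>. \<Prod>k=1..n. V k \<omega>) \<in> borel_measurable N"
      by (intro borel_measurable_prod V_meas)
    show "AE \<omega> in M. norm (?Z \<omega>) \<le> 2 ^ n"
    proof (rule AE_I2)
      fix \<omega>
      have "norm (?Z \<omega>) \<le> 2 ^ card {1..n}"
      proof (rule norm_prod_le_power)
        fix k show "norm (1 - c * cis (\<eta> k \<omega>)) \<le> 2"
          using norm_triangle_ineq4[of 1 "c * cis (\<eta> k \<omega>)"] c by (simp add: norm_mult)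
      qed
      then show "norm (?Z \<omega>) \<le> 2 ^ n" by simp
    qed
    have "AE \<omega> in N. \<forall>k\<in>{1..n}. norm (V k \<omega>) \<le> 2"
      using V_bd by (intro AE_finite_allI) auto
    then show "AE \<omega> in N. norm (\<Prod>k=1..n. V k \<omega>) \<le> 2 ^ n"
    proof eventually_elim
      case (elim \<omega>)
      then have "norm (\<Prod>k=1..n. V k \<omega>) \<le> 2 ^ card {1..n}" by (intro norm_prod_le_power) auto
      then show ?case by simp
    qed
  qed
  then show ?thesis by (simp only: cis V_def)
qed

section \<open>Equality in law\<close>

theorem theorem1p1:
  fixes n :: nat and \<beta> :: real
  assumes "n \<ge> 1" and "\<beta> > 0"
  shows
    "(\<forall>(M :: 'a measure) (\<eta> :: nat \<Rightarrow> 'a \<Rightarrow> real)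
        (N :: 'b measure) (\<phi> :: nat \<Rightarrow> 'b \<Rightarrow> real) (X :: nat \<Rightarrow> 'b \<Rightarrow> real) (\<theta> :: real).
        circular_beta_ensemble M n \<beta> (\<lambda>k \<omega>. cis (\<eta> k \<omega>)) \<longrightarrow>
        prob_space N \<longrightarrow>
        prob_space.indep_vars N (\<lambda>_. borel) (case_sum \<phi> X) ({1..n} <+> {0..<n}) \<longrightarrow>
        (\<forall>k\<in>{1..n}. distr N borel (\<lambda>\<omega>. cis (\<phi> k \<omega>)) = uniform_circle) \<longrightarrow>
        (\<forall>j\<in>{0..<n}. distr N borel (X j) = beta_unit 1 (real j * \<beta> / 2)) \<longrightarrow>
        distr M borel (\<lambda>\<omega>. \<Prod>k=1..n. 1 - cis (- (\<theta> - \<eta> k \<omega>))) =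
        distr N borel (\<lambda>\<omega>. \<Prod>k=1..n. 1 + cis (\<phi> k \<omega>) * complex_of_real (sqrt (X (k - 1) \<omega>))))
     \<and>
     (\<forall>(M :: 'c measure) (x :: nat \<Rightarrow> 'c \<Rightarrow> real)
        (N :: 'd measure) (X :: nat \<Rightarrow> 'd \<Rightarrow> real) (a :: real) (b :: real) (\<sigma> :: real).
        a > -1 \<longrightarrow> b > -1 \<longrightarrow>
        jacobi_beta_ensemble M n \<beta> a b x \<longrightarrow>
        prob_space N \<longrightarrow>
        prob_space.indep_vars N (\<lambda>_. borel) X {0..2 * n - 2} \<longrightarrow>
        (\<forall>k\<in>{0..2 * n - 2}. distr N borel (X k) =
           (if even k
            then beta_sym (real k / 4 * \<beta> + a + 1) (real k / 4 * \<beta> + b + 1)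
            else beta_sym ((real k - 1) / 4 * \<beta> + a + b + 2) ((real k + 1) / 4 * \<beta>))) \<longrightarrow>
        \<sigma> \<in> {1, -1} \<longrightarrow>
        distr M borel (\<lambda>\<omega>. \<Prod>k=1..n. \<sigma> * 2 - x k \<omega>) =
        distr N borel (\<lambda>\<omega>. \<sigma> ^ n * (2 * (\<Prod>k=0..2 * n - 2. 1 - \<sigma> ^ (k + 1) * X k \<omega>))))"
proof (intro conjI allI impI, goal_cases)
  case (1 M \<eta> N \<phi> X \<theta>)
  then show ?case by (intro circular_law[OF assms(2)])
next
  case (2 M x N X a b \<sigma>)
  then show ?case by (intro jacobi_law[OF assms])
qed

end
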